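(* Let $\mathcal H=(\mathcal H_L,\mathcal H_R,S)$ be a Hopf algebroid with a bijective antipode and $B\subseteq A$ an $\mathcal H$-cleft extension, and let $T$ be a subalgebra of $B$. Write $\mu_B:B\otimes_TB\to B$ for the multiplication map. Strong $T$-connections in $B\subseteq A$ are in bijective correspondence with $L$-$L$ bilinear maps $f:H\to B\otimes_TB$ such that $\mu_B\circ f=\eta_L\circ\pi_L$.
   Context: $k$ is a commutative unital ring; algebras are associative unital $k$-algebras; for an algebra $R$, an $R$-ring is an algebra $A$ with an algebra map $R\to A$ (the unit map). Summations are suppressed in Sweedler notation. Left bialgebroid $\mathcal H_L=(H,L,s_L,t_L,\gamma_L,\pi_L)$: algebras $H,L$; algebra maps $s_L:L\to H$, $t_L:L^{op}\to H$ with commuting images; $H$ is an $L$-bimodule via $l h l'=s_L(l)t_L(l')h$; $L$-bimodule maps $\gamma_L:H\to H\otimes_L H$, $h\mapsto h_{(1)}\otimes_L h_{(2)}$, and $\pi_L:H\to L$ form a coassociative counital $L$-coring; $h_{(1)}t_L(l)\otimes_L h_{(2)}=h_{(1)}\otimes_L h_{(2)}s_L(l)$; $\gamma_L(1)=1\otimes_L 1$; $\gamma_L(hh')=\gamma_L(h)\gamma_L(h')$; $\pi_L(1)=1$; $\pi_L(hs_L(\pi_L(h')))=\pi_L(hh')=\pi_L(ht_L(\pi_L(h')))$. Right bialgebroid $\mathcal H_R=(H,R,s_R,t_R,\gamma_R,\pi_R)$: algebra maps $s_R:R\to H$, $t_R:R^{op}\to H$ with commuting images; $R$-bimodule $rhr'=h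 s_R(r')t_R(r)$; $R$-coring $\gamma_R:H\to H\otimes_RH$, $h\mapsto h^{(1)}\otimes_R h^{(2)}$, $\pi_R:H\to R$; $s_R(r)h^{(1)}\otimes_R h^{(2)}=h^{(1)}\otimes_R t_R(r)h^{(2)}$; $\gamma_R$ unital and multiplicative; $\pi_R(1)=1$; $\pi_R(s_R(\pi_R(h))h')=\pi_R(hh')=\pi_R(t_R(\pi_R(h))h')$. Hopf algebroid $\mathcal H=(\mathcal H_L,\mathcal H_R,S)$: a left bialgebroid $\mathcal H_L=(H,L,s_L,t_L,\gamma_L,\pi_L)$ and a right bialgebroid $\mathcal H_R=(H,R,s_R,t_R,\gamma_R,\pi_R)$ on the same algebra $H$ with $s_L\pi_Lt_R=t_R$, $t_L\pi_Ls_R=s_R$, $s_R\pi_Rt_L=t_L$, $t_R\pi_Rs_L=s_L$; $(\gamma_L\otimes_R H)\gamma_R=(H\otimes_L\gamma_R)\gamma_L$, $(\gamma_R\otimes_L H)\gamma_L=(H\otimes_R\gamma_L)\gamma_R$; and a $k$-linear antipode $S:H\to H$ with $S(t_L(l)ht_R(r))=s_R(r)S(h)s_L(l)$, $S(t_R(r)ht_L(l))=s_L(l)S(h)s_R(r)$, $S(h_{(1)})h_{(2)}=s_R(\pi_R(h))$, $h^{(1)}S(h^{(2)})=s_L(\pi_L(h))$. A right $\mathcal H_R$-comodule is a right comodule $m\mapsto m^{[0]}\otimes_R m^{[1]}$ of the $R$-coring $H$; it is an $R$-bimodule with left action $rm=m^{[0]}\pi_R(s_R(r)m^{[1]})$.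 A right $\mathcal H_L$-comodule is a right comodule $m\mapsto m_{[0]}\otimes_Lm_{[1]}$ of the $L$-coring $H$. A right $\mathcal H$-comodule is a right $R$- and right $L$-module $M$ with an $\mathcal H_R$-coaction $\varrho_R$ and an $\mathcal H_L$-coaction $\varrho_L$ such that $\varrho_R$ is right $L$-linear, $\varrho_L$ is right $R$-linear, $(M\otimes_R\gamma_L)\varrho_R=(\varrho_R\otimes_LH)\varrho_L$ and $(M\otimes_L\gamma_R)\varrho_L=(\varrho_L\otimes_RH)\varrho_R$ (here $(m\otimes_R h)l=m\otimes_R t_L(l)h$, $(m\otimes_L h)r=m\otimes_L hs_R(r)$). Morphisms are maps colinear for both coactions. $H$ itself is a right $\mathcal H$-comodule via $\gamma_R,\gamma_L$. A right $\mathcal H$-comodule algebra is an $R$-ring $A$ with unit map $\eta_R:R\to A$ that is a right $\mathcal H$-comodule, the $R$-bimodule structure being given by multiplication with $\eta_R$ (and the right $L$-action then being $al=\eta_R(\pi_R(t_L(l)))a$), such that both coactions are unital and multiplicative. A right $\mathcal H$-extension $B\subseteq A$ is a right $\mathcal H$-comodule algebra $A$ with $B=\{b\in A: b^{[0]}\otimes_R b^{[1]}=b\otimes_R 1_H\}$. The extension is $\mathcal H$-cleft if (a) $A$ is an $L$-ring with unit map $\eta_L:L\to A$, and $B$ is an $L$-subring (so $\eta_L(L)\subseteq B$); and (b) there is a left $L$-linear ($j(s_L(l)h)=\eta_L(l)j(h)$) right $\mathcal H$-comodule map $j:H\to A$ (a cleaving map) that is convolution invertible: there is a $k$-linear $j^{c}:H\to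 A$ with $j^{c}(t_L(l)ht_R(r))=\eta_R(r)j^{c}(h)\eta_L(l)$, $j(h^{(1)})j^{c}(h^{(2)})=\eta_L(\pi_L(h))$, $j^{c}(h_{(1)})j(h_{(2)})=\eta_R(\pi_R(h))$. Strong $T$-connections ($S$ bijective, $T$ a subalgebra of $B$): $A$ is a left $\mathcal H_R$-comodule via ${}^A\varrho:A\to H\otimes_RA$, $a\mapsto S^{-1}(a_{[1]})\otimes_Ra_{[0]}$, and a right one via $\varrho^A:a\mapsto a^{[0]}\otimes_Ra^{[1]}$; $A\otimes_TA$ has left coaction ${}^A\varrho\otimes_TA$ and right coaction $A\otimes_T\varrho^A$; $H$ is a left and right $\mathcal H_R$-comodule via $\gamma_R$. A strong $T$-connection is a left and right $\mathcal H_R$-comodule map $\ell_T:H\to A\otimes_TA$ such that $\widetilde{\mathrm{can}}_T(\ell_T(h))=1_A\otimes_Rh$ for all $h\in H$, where $\widetilde{\mathrm{can}}_T:A\otimes_TA\to A\otimes_RH$, $a\otimes_Ta'\mapsto aa'^{[0]}\otimes_Ra'^{[1]}$. $L$-$L$ bilinearity of $f$: $f(s_L(l)t_L(l')h)=\eta_L(l)f(h)\eta_L(l')$, with $B\otimes_TB$ a $B$-bimodule via the outer actions. *)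

theory Defs
  imports
    "HOL.Modules"
    "HOL-Library.Poly_Mapping"
    "HOL-Library.Set_Algebras"
    "HOL-Computational_Algebra.Group_Closure"
begin

text \<open>
  Unital associative rings have the sort \<open>{ring, monoid_mult}\<close>, which, unlike \<open>ring_1\<close>,
  admits the zero ring.
\<close>

section \<open>Algebras over a commutative ring\<close>

locale k_algebra =
  fixes scale :: "'k::{comm_ring,comm_monoid_mult} \<Rightarrow> 'a::{ring,monoid_mult} \<Rightarrow> 'a"
  assumes scale_add_right: "scale c (a + b) = scale c a + scale c b"
    and scale_add_left: "scale (c + d) a = scale c a + scale d a"
    and scale_scale: "scale c (scale d a) = scale (c * d) a"
    and scale_one: "scale 1 a = a"
    and scale_mult_left: "scale c a * b = scale c (a * b)"
    and scale_mult_right: "a * scale c b = scale c (a * b)"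

definition k_linear ::
  "('k \<Rightarrow> 'a::ab_group_add \<Rightarrow> 'a) \<Rightarrow> ('k \<Rightarrow> 'b::ab_group_add \<Rightarrow> 'b) \<Rightarrow> ('a \<Rightarrow> 'b) \<Rightarrow> bool" where
  "k_linear kA kB f \<longleftrightarrow> additive f \<and> (\<forall>c a. f (kA c a) = kB c (f a))"

definition algebra_map ::
  "('k \<Rightarrow> 'a::{ring,monoid_mult} \<Rightarrow> 'a) \<Rightarrow> ('k \<Rightarrow> 'b::{ring,monoid_mult} \<Rightarrow> 'b) \<Rightarrow> ('a \<Rightarrow> 'b) \<Rightarrow> bool" where
  "algebra_map kA kB f \<longleftrightarrow> k_linear kA kB f \<and> f 1 = 1 \<and> (\<forall>a b. f (a * b) = f a * f b)"

definition anti_algebra_map ::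
  "('k \<Rightarrow> 'a::{ring,monoid_mult} \<Rightarrow> 'a) \<Rightarrow> ('k \<Rightarrow> 'b::{ring,monoid_mult} \<Rightarrow> 'b) \<Rightarrow> ('a \<Rightarrow> 'b) \<Rightarrow> bool" where
  "anti_algebra_map kA kB f \<longleftrightarrow> k_linear kA kB f \<and> f 1 = 1 \<and> (\<forall>a b. f (a * b) = f b * f a)"

definition subalgebra :: "('k \<Rightarrow> 'a::{ring,monoid_mult} \<Rightarrow> 'a) \<Rightarrow> 'a set \<Rightarrow> bool" where
  "subalgebra kA T \<longleftrightarrow> 1 \<in> T \<and> (\<forall>x\<in>T. \<forall>y\<in>T. x + y \<in> T \<and> x * y \<in> T) \<and> (\<forall>c. \<forall>x\<in>T. kA c x \<in> T)"

section \<open>Modules over noncommutative rings\<close>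

locale left_module =
  fixes la :: "'s::{ring,monoid_mult} \<Rightarrow> 'm::ab_group_add \<Rightarrow> 'm"
  assumes left_add: "la s (m + m') = la s m + la s m'"
    and left_add_scalar: "la (s + s') m = la s m + la s' m"
    and left_mult: "la (s * s') m = la s (la s' m)"
    and left_one: "la 1 m = m"

locale right_module =
  fixes ra :: "'m::ab_group_add \<Rightarrow> 's::{ring,monoid_mult} \<Rightarrow> 'm"
  assumes right_add: "ra (m + m') s = ra m s + ra m' s"
    and right_add_scalar: "ra m (s + s') = ra m s + ra m s'"
    and right_mult: "ra m (s * s') = ra (ra m s) s'"
    and right_one: "ra m 1 = m"

locale bimodule = left_module la + right_module ra
  for la :: "'s::{ring,monoid_mult} \<Rightarrow> 'm::ab_group_add \<Rightarrow> 'm" and ra :: "'m \<Rightarrow> 's \<Rightarrow> 'm" +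
  assumes left_right: "ra (la s m) s' = la s (ra m s')"

section \<open>Tensor products over noncommutative rings\<close>

text \<open>
  For a right module \<open>M\<close> and a left module \<open>N\<close> over \<open>S\<close> (subsets of types, with actions
  \<open>ra\<close> and \<open>la\<close>), the tensor product is the quotient of the free abelian group on \<open>M \<times> N\<close>
  by the subgroup \<open>tensor_null M S N ra la\<close>. Its elements are the cosets of that subgroup; they are
  added with the addition of sets, and \<open>m \<otimes> n\<close> is \<open>frag_of (m, n) +o tensor_null M S N ra la\<close>.
  Over algebras this group is also the tensor product of \<open>k\<close>-modules.
\<close>

type_synonym ('m, 'n) tensor = "(('m \<times> 'n) \<Rightarrow>\<^sub>0 int) set"

definition tensor_null ::
  "'m::ab_group_add set \<Rightarrow> 's set \<Rightarrow> 'n::ab_group_add set \<Rightarrow> ('m \<Rightarrow> 's \<Rightarrow> 'm) \<Rightarrow> ('s \<Rightarrow> 'n \<Rightarrow> 'n)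
    \<Rightarrow> (('m \<times> 'n) \<Rightarrow>\<^sub>0 int) set" where
  "tensor_null M S N ra la = group_closure
     ({frag_of (m + m', n) - frag_of (m, n) - frag_of (m', n) | m m' n. m \<in> M \<and> m' \<in> M \<and> n \<in> N}
    \<union> {frag_of (m, n + n') - frag_of (m, n) - frag_of (m, n') | m n n'. m \<in> M \<and> n \<in> N \<and> n' \<in> N}
    \<union> {frag_of (ra m s, n) - frag_of (m, la s n) | m s n. m \<in> M \<and> s \<in> S \<and> n \<in> N})"

definition tensor ::
  "'m::ab_group_add set \<Rightarrow> 's set \<Rightarrow> 'n::ab_group_add set \<Rightarrow> ('m \<Rightarrow> 's \<Rightarrow> 'm) \<Rightarrow> ('s \<Rightarrow> 'n \<Rightarrow> 'n)
    \<Rightarrow> ('m, 'n) tensor set" where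
  "tensor M S N ra la = {p +o tensor_null M S N ra la | p. Poly_Mapping.keys p \<subseteq> M \<times> N}"

text \<open>
  The analogous relations for \<open>M \<otimes>\<^sub>S N \<otimes>\<^sub>S\<^sub>' P\<close>, where \<open>M\<close>, \<open>N\<close>, \<open>P\<close> are full types:
  \<open>ra1\<close>, \<open>la1\<close> are the actions of \<open>S\<close> on \<open>M\<close> and \<open>N\<close>; \<open>ra2\<close>, \<open>la2\<close> those of \<open>S'\<close> on \<open>N\<close> and \<open>P\<close>.
\<close>

definition tensor3_null ::
  "'s set \<Rightarrow> ('m::ab_group_add \<Rightarrow> 's \<Rightarrow> 'm) \<Rightarrow> ('s \<Rightarrow> 'n::ab_group_add \<Rightarrow> 'n)
    \<Rightarrow> 'u set \<Rightarrow> ('n \<Rightarrow> 'u \<Rightarrow> 'n) \<Rightarrow> ('u \<Rightarrow> 'p::ab_group_add \<Rightarrow> 'p)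
    \<Rightarrow> (('m \<times> 'n \<times> 'p) \<Rightarrow>\<^sub>0 int) set" where
  "tensor3_null S ra1 la1 S' ra2 la2 = group_closure
     ({frag_of (m + m', n, p) - frag_of (m, n, p) - frag_of (m', n, p) | m m' n p. True}
    \<union> {frag_of (m, n + n', p) - frag_of (m, n, p) - frag_of (m, n', p) | m n n' p. True}
    \<union> {frag_of (m, n, p + p') - frag_of (m, n, p) - frag_of (m, n, p') | m n p p'. True}
    \<union> {frag_of (ra1 m s, n, p) - frag_of (m, la1 s n, p) | m s n p. s \<in> S}
    \<union> {frag_of (m, ra2 n s, p) - frag_of (m, n, la2 s p) | m n s p. s \<in> S'})"

definition frag_sum :: "('x \<Rightarrow> 'g::ab_group_add) \<Rightarrow> ('x \<Rightarrow>\<^sub>0 int) \<Rightarrow> 'g" where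
  "frag_sum \<phi> p = (\<Sum>x\<in>Poly_Mapping.keys p.
     (\<Sum>i<nat (Poly_Mapping.lookup p x). \<phi> x) - (\<Sum>i<nat (- Poly_Mapping.lookup p x). \<phi> x))"

text \<open>
  Sweedler notation: if \<open>x\<close> is the class of \<open>\<Sum>\<^sub>i m\<^sub>i \<otimes> n\<^sub>i\<close>, then \<open>sweedler x \<phi>\<close> is \<open>\<Sum>\<^sub>i \<phi> m\<^sub>i n\<^sub>i\<close>, computed
  from a chosen representative. It is used only for \<open>\<phi>\<close> whose value, where applicable up to the
  relations of the target tensor product, does not depend on that choice.
\<close>

definition sweedler :: "('m, 'n) tensor \<Rightarrow> ('m \<Rightarrow> 'n \<Rightarrow> 'g::ab_group_add) \<Rightarrow> 'g" where
  "sweedler x \<phi> = frag_sum (\<lambda>(m, n). \<phi> m n) (SOME p. p \<in> x)"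

section \<open>Corings and comodules\<close>

locale coring = bimodule la ra
  for la :: "'s::{ring,monoid_mult} \<Rightarrow> 'c::ab_group_add \<Rightarrow> 'c" and ra :: "'c \<Rightarrow> 's \<Rightarrow> 'c" +
  fixes \<Delta> :: "'c \<Rightarrow> ('c, 'c) tensor" and \<epsilon> :: "'c \<Rightarrow> 's"
  assumes comult_in: "\<Delta> c \<in> tensor UNIV UNIV UNIV ra la"
    and comult_add: "\<Delta> (c + c') = \<Delta> c + \<Delta> c'"
    and comult_bilinear: "\<Delta> (la s (ra c s')) =
      sweedler (\<Delta> c) (\<lambda>c1 c2. frag_of (la s c1, ra c2 s')) +o tensor_null UNIV UNIV UNIV ra la"
    and counit_add: "\<epsilon> (c + c') = \<epsilon> c + \<epsilon> c'"
    and counit_bilinear: "\<epsilon> (la s (ra c s')) = s * \<epsilon> c * s'"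
    and coassoc:
      "sweedler (\<Delta> c) (\<lambda>c1 c2. sweedler (\<Delta> c1) (\<lambda>c11 c12. frag_of (c11, c12, c2)))
          +o tensor3_null UNIV ra la UNIV ra la
       = sweedler (\<Delta> c) (\<lambda>c1 c2. sweedler (\<Delta> c2) (\<lambda>c21 c22. frag_of (c1, c21, c22)))
          +o tensor3_null UNIV ra la UNIV ra la"
    and counit_left: "sweedler (\<Delta> c) (\<lambda>c1 c2. la (\<epsilon> c1) c2) = c"
    and counit_right: "sweedler (\<Delta> c) (\<lambda>c1 c2. ra c1 (\<epsilon> c2)) = c"

locale right_comodule = coring la ra \<Delta> \<epsilon> + M: right_module raM
  for la :: "'s::{ring,monoid_mult} \<Rightarrow> 'c::ab_group_add \<Rightarrow> 'c" and ra :: "'c \<Rightarrow> 's \<Rightarrow> 'c"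
    and \<Delta> :: "'c \<Rightarrow> ('c, 'c) tensor" and \<epsilon> :: "'c \<Rightarrow> 's"
    and raM :: "'m::ab_group_add \<Rightarrow> 's \<Rightarrow> 'm" +
  fixes \<rho> :: "'m \<Rightarrow> ('m, 'c) tensor"
  assumes coact_in: "\<rho> m \<in> tensor UNIV UNIV UNIV raM la"
    and coact_add: "\<rho> (m + m') = \<rho> m + \<rho> m'"
    and coact_linear: "\<rho> (raM m s) =
      sweedler (\<rho> m) (\<lambda>m0 m1. frag_of (m0, ra m1 s)) +o tensor_null UNIV UNIV UNIV raM la"
    and coact_coassoc:
      "sweedler (\<rho> m) (\<lambda>m0 m1. sweedler (\<rho> m0) (\<lambda>m00 m01. frag_of (m00, m01, m1)))
          +o tensor3_null UNIV raM la UNIV ra la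
       = sweedler (\<rho> m) (\<lambda>m0 m1. sweedler (\<Delta> m1) (\<lambda>c1 c2. frag_of (m0, c1, c2)))
          +o tensor3_null UNIV raM la UNIV ra la"
    and coact_counit: "sweedler (\<rho> m) (\<lambda>m0 m1. raM m0 (\<epsilon> m1)) = m"

text \<open>Right comodule maps \<open>(M, \<rho>M) \<rightarrow> (N, \<rho>N)\<close>; \<open>la\<close> is the left action on the coring.\<close>

definition right_comodule_map ::
  "('s \<Rightarrow> 'c::ab_group_add \<Rightarrow> 'c) \<Rightarrow> ('m::ab_group_add \<Rightarrow> 's \<Rightarrow> 'm) \<Rightarrow> ('m \<Rightarrow> ('m, 'c) tensor)
    \<Rightarrow> ('n::ab_group_add \<Rightarrow> 's \<Rightarrow> 'n) \<Rightarrow> ('n \<Rightarrow> ('n, 'c) tensor) \<Rightarrow> ('m \<Rightarrow> 'n) \<Rightarrow> bool" where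
  "right_comodule_map la raM \<rho>M raN \<rho>N f \<longleftrightarrow>
     additive f \<and> (\<forall>m s. f (raM m s) = raN (f m) s)
   \<and> (\<forall>m. \<rho>N (f m) = sweedler (\<rho>M m) (\<lambda>m0 m1. frag_of (f m0, m1)) +o tensor_null UNIV UNIV UNIV raN la)"

section \<open>Hopf algebroids\<close>

locale left_bialgebroid_base = H: k_algebra kH + L: k_algebra kL
  for kH :: "'k::{comm_ring,comm_monoid_mult} \<Rightarrow> 'h::{ring,monoid_mult} \<Rightarrow> 'h"
    and kL :: "'k \<Rightarrow> 'l::{ring,monoid_mult} \<Rightarrow> 'l" +
  fixes sL :: "'l \<Rightarrow> 'h" and tL :: "'l \<Rightarrow> 'h"
  assumes sL_map: "algebra_map kL kH sL"
    and tL_map: "anti_algebra_map kL kH tL"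
    and sL_tL_commute: "sL l * tL l' = tL l' * sL l"
begin

abbreviation laL :: "'l \<Rightarrow> 'h \<Rightarrow> 'h" where "laL l h \<equiv> sL l * h"
abbreviation raL :: "'h \<Rightarrow> 'l \<Rightarrow> 'h" where "raL h l \<equiv> tL l * h"
abbreviation nullL :: "(('h \<times> 'h) \<Rightarrow>\<^sub>0 int) set" where "nullL \<equiv> tensor_null UNIV UNIV UNIV raL laL"

end

locale left_bialgebroid =
  left_bialgebroid_base kH kL sL tL + L: coring "\<lambda>l h. sL l * h" "\<lambda>h l. tL l * h" \<gamma>L \<pi>L
  for kH :: "'k::{comm_ring,comm_monoid_mult} \<Rightarrow> 'h::{ring,monoid_mult} \<Rightarrow> 'h"
    and kL :: "'k \<Rightarrow> 'l::{ring,monoid_mult} \<Rightarrow> 'l"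
    and sL :: "'l \<Rightarrow> 'h" and tL :: "'l \<Rightarrow> 'h"
    and \<gamma>L :: "'h \<Rightarrow> ('h, 'h) tensor" and \<pi>L :: "'h \<Rightarrow> 'l" +
  assumes \<gamma>L_takeuchi:
      "sweedler (\<gamma>L h) (\<lambda>h1 h2. frag_of (h1 * tL l, h2)) +o nullL
       = sweedler (\<gamma>L h) (\<lambda>h1 h2. frag_of (h1, h2 * sL l)) +o nullL"
    and \<gamma>L_one: "\<gamma>L 1 = frag_of (1, 1) +o nullL"
    and \<gamma>L_mult: "\<gamma>L (h * h') =
      sweedler (\<gamma>L h) (\<lambda>h1 h2. sweedler (\<gamma>L h') (\<lambda>h1' h2'. frag_of (h1 * h1', h2 * h2'))) +o nullL"
    and \<pi>L_one: "\<pi>L 1 = 1"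
    and \<pi>L_sL: "\<pi>L (h * sL (\<pi>L h')) = \<pi>L (h * h')"
    and \<pi>L_tL: "\<pi>L (h * tL (\<pi>L h')) = \<pi>L (h * h')"

locale right_bialgebroid_base = H: k_algebra kH + R: k_algebra kR
  for kH :: "'k::{comm_ring,comm_monoid_mult} \<Rightarrow> 'h::{ring,monoid_mult} \<Rightarrow> 'h"
    and kR :: "'k \<Rightarrow> 'r::{ring,monoid_mult} \<Rightarrow> 'r" +
  fixes sR :: "'r \<Rightarrow> 'h" and tR :: "'r \<Rightarrow> 'h"
  assumes sR_map: "algebra_map kR kH sR"
    and tR_map: "anti_algebra_map kR kH tR"
    and sR_tR_commute: "sR r * tR r' = tR r' * sR r"
begin

abbreviation laR :: "'r \<Rightarrow> 'h \<Rightarrow> 'h" where "laR r h \<equiv> h * tR r"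
abbreviation raR :: "'h \<Rightarrow> 'r \<Rightarrow> 'h" where "raR h r \<equiv> h * sR r"
abbreviation nullR :: "(('h \<times> 'h) \<Rightarrow>\<^sub>0 int) set" where "nullR \<equiv> tensor_null UNIV UNIV UNIV raR laR"

end

locale right_bialgebroid =
  right_bialgebroid_base kH kR sR tR + R: coring "\<lambda>r h. h * tR r" "\<lambda>h r. h * sR r" \<gamma>R \<pi>R
  for kH :: "'k::{comm_ring,comm_monoid_mult} \<Rightarrow> 'h::{ring,monoid_mult} \<Rightarrow> 'h"
    and kR :: "'k \<Rightarrow> 'r::{ring,monoid_mult} \<Rightarrow> 'r"
    and sR :: "'r \<Rightarrow> 'h" and tR :: "'r \<Rightarrow> 'h"
    and \<gamma>R :: "'h \<Rightarrow> ('h, 'h) tensor" and \<pi>R :: "'h \<Rightarrow> 'r" +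
  assumes \<gamma>R_takeuchi:
      "sweedler (\<gamma>R h) (\<lambda>h1 h2. frag_of (sR r * h1, h2)) +o nullR
       = sweedler (\<gamma>R h) (\<lambda>h1 h2. frag_of (h1, tR r * h2)) +o nullR"
    and \<gamma>R_one: "\<gamma>R 1 = frag_of (1, 1) +o nullR"
    and \<gamma>R_mult: "\<gamma>R (h * h') =
      sweedler (\<gamma>R h) (\<lambda>h1 h2. sweedler (\<gamma>R h') (\<lambda>h1' h2'. frag_of (h1 * h1', h2 * h2'))) +o nullR"
    and \<pi>R_one: "\<pi>R 1 = 1"
    and \<pi>R_sR: "\<pi>R (sR (\<pi>R h) * h') = \<pi>R (h * h')"
    and \<pi>R_tR: "\<pi>R (tR (\<pi>R h) * h') = \<pi>R (h * h')"

locale hopf_algebroid =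
  left_bialgebroid kH kL sL tL \<gamma>L \<pi>L + right_bialgebroid kH kR sR tR \<gamma>R \<pi>R
  for kH :: "'k::{comm_ring,comm_monoid_mult} \<Rightarrow> 'h::{ring,monoid_mult} \<Rightarrow> 'h"
    and kL :: "'k \<Rightarrow> 'l::{ring,monoid_mult} \<Rightarrow> 'l"
    and sL :: "'l \<Rightarrow> 'h" and tL :: "'l \<Rightarrow> 'h"
    and \<gamma>L :: "'h \<Rightarrow> ('h, 'h) tensor" and \<pi>L :: "'h \<Rightarrow> 'l"
    and kR :: "'k \<Rightarrow> 'r::{ring,monoid_mult} \<Rightarrow> 'r"
    and sR :: "'r \<Rightarrow> 'h" and tR :: "'r \<Rightarrow> 'h"
    and \<gamma>R :: "'h \<Rightarrow> ('h, 'h) tensor" and \<pi>R :: "'h \<Rightarrow> 'r" +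
  fixes S :: "'h \<Rightarrow> 'h"
  assumes sL_\<pi>L_tR: "sL (\<pi>L (tR r)) = tR r"
    and tL_\<pi>L_sR: "tL (\<pi>L (sR r)) = sR r"
    and sR_\<pi>R_tL: "sR (\<pi>R (tL l)) = tL l"
    and tR_\<pi>R_sL: "tR (\<pi>R (sL l)) = sL l"
    and mixed_coassoc_LR:
      "sweedler (\<gamma>R h) (\<lambda>h1 h2. sweedler (\<gamma>L h1) (\<lambda>h11 h12. frag_of (h11, h12, h2)))
          +o tensor3_null UNIV raL laL UNIV raR laR
       = sweedler (\<gamma>L h) (\<lambda>h1 h2. sweedler (\<gamma>R h2) (\<lambda>h21 h22. frag_of (h1, h21, h22)))
          +o tensor3_null UNIV raL laL UNIV raR laR"
    and mixed_coassoc_RL: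
      "sweedler (\<gamma>L h) (\<lambda>h1 h2. sweedler (\<gamma>R h1) (\<lambda>h11 h12. frag_of (h11, h12, h2)))
          +o tensor3_null UNIV raR laR UNIV raL laL
       = sweedler (\<gamma>R h) (\<lambda>h1 h2. sweedler (\<gamma>L h2) (\<lambda>h21 h22. frag_of (h1, h21, h22)))
          +o tensor3_null UNIV raR laR UNIV raL laL"
    and S_k_linear: "k_linear kH kH S"
    and S_tL_tR: "S (tL l * h * tR r) = sR r * S h * sL l"
    and S_tR_tL: "S (tR r * h * tL l) = sL l * S h * sR r"
    and antipode_L: "sweedler (\<gamma>L h) (\<lambda>h1 h2. S h1 * h2) = sR (\<pi>R h)"
    and antipode_R: "sweedler (\<gamma>R h) (\<lambda>h1 h2. h1 * S h2) = sL (\<pi>L h)"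

section \<open>Comodules and comodule algebras of a Hopf algebroid\<close>

text \<open>\<open>raMR\<close> and \<open>raML\<close> are the right actions of \<open>R\<close> and \<open>L\<close> on \<open>M\<close>.\<close>

locale right_hopf_comodule =
  hopf_algebroid kH kL sL tL \<gamma>L \<pi>L kR sR tR \<gamma>R \<pi>R S
  + onR: right_comodule "\<lambda>r h. h * tR r" "\<lambda>h r. h * sR r" \<gamma>R \<pi>R raMR \<rho>R
  + onL: right_comodule "\<lambda>l h. sL l * h" "\<lambda>h l. tL l * h" \<gamma>L \<pi>L raML \<rho>L
  for kH :: "'k::{comm_ring,comm_monoid_mult} \<Rightarrow> 'h::{ring,monoid_mult} \<Rightarrow> 'h"
    and kL :: "'k \<Rightarrow> 'l::{ring,monoid_mult} \<Rightarrow> 'l"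
    and sL :: "'l \<Rightarrow> 'h" and tL :: "'l \<Rightarrow> 'h"
    and \<gamma>L :: "'h \<Rightarrow> ('h, 'h) tensor" and \<pi>L :: "'h \<Rightarrow> 'l"
    and kR :: "'k \<Rightarrow> 'r::{ring,monoid_mult} \<Rightarrow> 'r"
    and sR :: "'r \<Rightarrow> 'h" and tR :: "'r \<Rightarrow> 'h"
    and \<gamma>R :: "'h \<Rightarrow> ('h, 'h) tensor" and \<pi>R :: "'h \<Rightarrow> 'r"
    and S :: "'h \<Rightarrow> 'h"
    and raMR :: "'m::ab_group_add \<Rightarrow> 'r \<Rightarrow> 'm" and raML :: "'m \<Rightarrow> 'l \<Rightarrow> 'm"
    and \<rho>R :: "'m \<Rightarrow> ('m, 'h) tensor" and \<rho>L :: "'m \<Rightarrow> ('m, 'h) tensor" +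
  assumes \<rho>R_L_linear: "\<rho>R (raML m l) =
      sweedler (\<rho>R m) (\<lambda>m0 m1. frag_of (m0, raL m1 l)) +o tensor_null UNIV UNIV UNIV raMR laR"
    and \<rho>L_R_linear: "\<rho>L (raMR m r) =
      sweedler (\<rho>L m) (\<lambda>m0 m1. frag_of (m0, raR m1 r)) +o tensor_null UNIV UNIV UNIV raML laL"
    and \<rho>_mixed_RL:
      "sweedler (\<rho>R m) (\<lambda>m0 m1. sweedler (\<gamma>L m1) (\<lambda>h1 h2. frag_of (m0, h1, h2)))
          +o tensor3_null UNIV raMR laR UNIV raL laL
       = sweedler (\<rho>L m) (\<lambda>m0 m1. sweedler (\<rho>R m0) (\<lambda>m00 m01. frag_of (m00, m01, m1)))
          +o tensor3_null UNIV raMR laR UNIV raL laL"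
    and \<rho>_mixed_LR:
      "sweedler (\<rho>L m) (\<lambda>m0 m1. sweedler (\<gamma>R m1) (\<lambda>h1 h2. frag_of (m0, h1, h2)))
          +o tensor3_null UNIV raML laL UNIV raR laR
       = sweedler (\<rho>R m) (\<lambda>m0 m1. sweedler (\<rho>L m0) (\<lambda>m00 m01. frag_of (m00, m01, m1)))
          +o tensor3_null UNIV raML laL UNIV raR laR"

locale right_comodule_algebra =
  A: k_algebra kA +
  right_hopf_comodule kH kL sL tL \<gamma>L \<pi>L kR sR tR \<gamma>R \<pi>R S
    "\<lambda>a r. a * \<eta>R r" "\<lambda>a l. \<eta>R (\<pi>R (tL l)) * a" \<rho>R \<rho>L
  for kH :: "'k::{comm_ring,comm_monoid_mult} \<Rightarrow> 'h::{ring,monoid_mult} \<Rightarrow> 'h"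
    and kL :: "'k \<Rightarrow> 'l::{ring,monoid_mult} \<Rightarrow> 'l"
    and sL :: "'l \<Rightarrow> 'h" and tL :: "'l \<Rightarrow> 'h"
    and \<gamma>L :: "'h \<Rightarrow> ('h, 'h) tensor" and \<pi>L :: "'h \<Rightarrow> 'l"
    and kR :: "'k \<Rightarrow> 'r::{ring,monoid_mult} \<Rightarrow> 'r"
    and sR :: "'r \<Rightarrow> 'h" and tR :: "'r \<Rightarrow> 'h"
    and \<gamma>R :: "'h \<Rightarrow> ('h, 'h) tensor" and \<pi>R :: "'h \<Rightarrow> 'r"
    and S :: "'h \<Rightarrow> 'h"
    and kA :: "'k \<Rightarrow> 'a::{ring,monoid_mult} \<Rightarrow> 'a"
    and \<eta>R :: "'r \<Rightarrow> 'a"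
    and \<rho>R :: "'a \<Rightarrow> ('a, 'h) tensor" and \<rho>L :: "'a \<Rightarrow> ('a, 'h) tensor" +
  assumes \<eta>R_map: "algebra_map kR kA \<eta>R"
    and left_R_action: "sweedler (\<rho>R a) (\<lambda>a0 a1. a0 * \<eta>R (\<pi>R (sR r * a1))) = \<eta>R r * a"
    and \<rho>R_one: "\<rho>R 1 = frag_of (1, 1) +o tensor_null UNIV UNIV UNIV (\<lambda>a r. a * \<eta>R r) laR"
    and \<rho>R_mult: "\<rho>R (a * a') =
      sweedler (\<rho>R a) (\<lambda>a0 a1. sweedler (\<rho>R a') (\<lambda>a0' a1'. frag_of (a0 * a0', a1 * a1')))
        +o tensor_null UNIV UNIV UNIV (\<lambda>a r. a * \<eta>R r) laR"
    and \<rho>L_one: "\<rho>L 1 = frag_of (1, 1) +o tensor_null UNIV UNIV UNIV (\<lambda>a l. \<eta>R (\<pi>R (tL l)) * a) laL"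
    and \<rho>L_mult: "\<rho>L (a * a') =
      sweedler (\<rho>L a) (\<lambda>a0 a1. sweedler (\<rho>L a') (\<lambda>a0' a1'. frag_of (a0 * a0', a1 * a1')))
        +o tensor_null UNIV UNIV UNIV (\<lambda>a l. \<eta>R (\<pi>R (tL l)) * a) laL"

locale right_hopf_extension =
  right_comodule_algebra kH kL sL tL \<gamma>L \<pi>L kR sR tR \<gamma>R \<pi>R S kA \<eta>R \<rho>R \<rho>L
  for kH :: "'k::{comm_ring,comm_monoid_mult} \<Rightarrow> 'h::{ring,monoid_mult} \<Rightarrow> 'h"
    and kL :: "'k \<Rightarrow> 'l::{ring,monoid_mult} \<Rightarrow> 'l"
    and sL :: "'l \<Rightarrow> 'h" and tL :: "'l \<Rightarrow> 'h"
    and \<gamma>L :: "'h \<Rightarrow> ('h, 'h) tensor" and \<pi>L :: "'h \<Rightarrow> 'l"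
    and kR :: "'k \<Rightarrow> 'r::{ring,monoid_mult} \<Rightarrow> 'r"
    and sR :: "'r \<Rightarrow> 'h" and tR :: "'r \<Rightarrow> 'h"
    and \<gamma>R :: "'h \<Rightarrow> ('h, 'h) tensor" and \<pi>R :: "'h \<Rightarrow> 'r"
    and S :: "'h \<Rightarrow> 'h"
    and kA :: "'k \<Rightarrow> 'a::{ring,monoid_mult} \<Rightarrow> 'a"
    and \<eta>R :: "'r \<Rightarrow> 'a"
    and \<rho>R :: "'a \<Rightarrow> ('a, 'h) tensor" and \<rho>L :: "'a \<Rightarrow> ('a, 'h) tensor" +
  fixes B :: "'a set"
  assumes B_coinvariants:
    "B = {b. \<rho>R b = frag_of (b, 1) +o tensor_null UNIV UNIV UNIV (\<lambda>a r. a * \<eta>R r) laR}"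

section \<open>Cleft extensions\<close>

context right_hopf_extension
begin

definition cleaving_map :: "('l \<Rightarrow> 'a) \<Rightarrow> ('h \<Rightarrow> 'a) \<Rightarrow> bool" where
  "cleaving_map \<eta>L j \<longleftrightarrow>
     (\<forall>l h. j (sL l * h) = \<eta>L l * j h)
   \<and> right_comodule_map laR raR \<gamma>R (\<lambda>a r. a * \<eta>R r) \<rho>R j
   \<and> right_comodule_map laL raL \<gamma>L (\<lambda>a l. \<eta>R (\<pi>R (tL l)) * a) \<rho>L j
   \<and> (\<exists>jc. k_linear kH kA jc
        \<and> (\<forall>l h r. jc (tL l * h * tR r) = \<eta>R r * jc h * \<eta>L l)
        \<and> (\<forall>h. sweedler (\<gamma>R h) (\<lambda>h1 h2. j h1 * jc h2) = \<eta>L (\<pi>L h))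
        \<and> (\<forall>h. sweedler (\<gamma>L h) (\<lambda>h1 h2. jc h1 * j h2) = \<eta>R (\<pi>R h)))"

end

locale cleft_extension =
  right_hopf_extension kH kL sL tL \<gamma>L \<pi>L kR sR tR \<gamma>R \<pi>R S kA \<eta>R \<rho>R \<rho>L B
  for kH :: "'k::{comm_ring,comm_monoid_mult} \<Rightarrow> 'h::{ring,monoid_mult} \<Rightarrow> 'h"
    and kL :: "'k \<Rightarrow> 'l::{ring,monoid_mult} \<Rightarrow> 'l"
    and sL :: "'l \<Rightarrow> 'h" and tL :: "'l \<Rightarrow> 'h"
    and \<gamma>L :: "'h \<Rightarrow> ('h, 'h) tensor" and \<pi>L :: "'h \<Rightarrow> 'l"
    and kR :: "'k \<Rightarrow> 'r::{ring,monoid_mult} \<Rightarrow> 'r"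
    and sR :: "'r \<Rightarrow> 'h" and tR :: "'r \<Rightarrow> 'h"
    and \<gamma>R :: "'h \<Rightarrow> ('h, 'h) tensor" and \<pi>R :: "'h \<Rightarrow> 'r"
    and S :: "'h \<Rightarrow> 'h"
    and kA :: "'k \<Rightarrow> 'a::{ring,monoid_mult} \<Rightarrow> 'a"
    and \<eta>R :: "'r \<Rightarrow> 'a"
    and \<rho>R :: "'a \<Rightarrow> ('a, 'h) tensor" and \<rho>L :: "'a \<Rightarrow> ('a, 'h) tensor"
    and B :: "'a set" +
  fixes \<eta>L :: "'l \<Rightarrow> 'a"
  assumes \<eta>L_map: "algebra_map kL kA \<eta>L"
    and \<eta>L_in_B: "\<eta>L l \<in> B"
    and cleaving_map_exists: "\<exists>j. cleaving_map \<eta>L j"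

section \<open>Strong connections\<close>

text \<open>The left coaction \<open>a \<mapsto> S\<inverse>(a\<^sub>[\<^sub>1\<^sub>]) \<otimes>\<^sub>R a\<^sub>[\<^sub>0\<^sub>]\<close> on \<open>A\<close>; \<open>R\<close> acts on \<open>A\<close> from the left through \<open>\<eta>R\<close>.\<close>

definition left_coaction ::
  "('r \<Rightarrow> 'h::{ring,monoid_mult}) \<Rightarrow> ('h \<Rightarrow> 'h) \<Rightarrow> ('r \<Rightarrow> 'a::{ring,monoid_mult})
    \<Rightarrow> ('a \<Rightarrow> ('a, 'h) tensor) \<Rightarrow> 'a \<Rightarrow> ('h, 'a) tensor" where
  "left_coaction sR S \<eta>R \<rho>L a =
     sweedler (\<rho>L a) (\<lambda>a0 a1. frag_of (inv S a1, a0))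
       +o tensor_null UNIV UNIV UNIV (\<lambda>h r. h * sR r) (\<lambda>r a. \<eta>R r * a)"

definition lifted_can ::
  "('r \<Rightarrow> 'h::{ring,monoid_mult}) \<Rightarrow> ('r \<Rightarrow> 'a::{ring,monoid_mult})
    \<Rightarrow> ('a \<Rightarrow> ('a, 'h) tensor) \<Rightarrow> ('a, 'a) tensor \<Rightarrow> ('a, 'h) tensor" where
  "lifted_can tR \<eta>R \<rho>R x =
     sweedler x (\<lambda>a a'. sweedler (\<rho>R a') (\<lambda>a0 a1. frag_of (a * a0, a1)))
       +o tensor_null UNIV UNIV UNIV (\<lambda>a r. a * \<eta>R r) (\<lambda>r h. h * tR r)"

text \<open>
  In the definition below, the third and fourth conditions are left and right \<open>R\<close>-linearity;
  the fifth and sixth are left and right colinearity, which are identities in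
  \<open>H \<otimes>\<^sub>R A \<otimes>\<^sub>T A\<close> and \<open>A \<otimes>\<^sub>T A \<otimes>\<^sub>R H\<close>.
\<close>

definition strong_connection ::
  "('r \<Rightarrow> 'h::{ring,monoid_mult}) \<Rightarrow> ('r \<Rightarrow> 'h) \<Rightarrow> ('h \<Rightarrow> ('h, 'h) tensor) \<Rightarrow> ('h \<Rightarrow> 'h)
    \<Rightarrow> ('r \<Rightarrow> 'a::{ring,monoid_mult}) \<Rightarrow> ('a \<Rightarrow> ('a, 'h) tensor) \<Rightarrow> ('a \<Rightarrow> ('a, 'h) tensor)
    \<Rightarrow> 'a set \<Rightarrow> ('h \<Rightarrow> ('a, 'a) tensor) \<Rightarrow> bool" where
  "strong_connection sR tR \<gamma>R S \<eta>R \<rho>R \<rho>L T l \<longleftrightarrow>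
     (\<forall>h. l h \<in> tensor UNIV T UNIV (*) (*))
   \<and> (\<forall>h h'. l (h + h') = l h + l h')
   \<and> (\<forall>r h. l (h * tR r) =
        sweedler (l h) (\<lambda>a a'. frag_of (\<eta>R r * a, a')) +o tensor_null UNIV T UNIV (*) (*))
   \<and> (\<forall>r h. l (h * sR r) =
        sweedler (l h) (\<lambda>a a'. frag_of (a, a' * \<eta>R r)) +o tensor_null UNIV T UNIV (*) (*))
   \<and> (\<forall>h. sweedler (l h) (\<lambda>a a'. sweedler (left_coaction sR S \<eta>R \<rho>L a) (\<lambda>g a0. frag_of (g, a0, a')))
            +o tensor3_null UNIV (\<lambda>h r. h * sR r) (\<lambda>r a. \<eta>R r * a) T (*) (*)
          = sweedler (\<gamma>R h) (\<lambda>h1 h2. sweedler (l h2) (\<lambda>a a'. frag_of (h1, a, a')))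
            +o tensor3_null UNIV (\<lambda>h r. h * sR r) (\<lambda>r a. \<eta>R r * a) T (*) (*))
   \<and> (\<forall>h. sweedler (l h) (\<lambda>a a'. sweedler (\<rho>R a') (\<lambda>a0 a1. frag_of (a, a0, a1)))
            +o tensor3_null T (*) (*) UNIV (\<lambda>a r. a * \<eta>R r) (\<lambda>r h. h * tR r)
          = sweedler (\<gamma>R h) (\<lambda>h1 h2. sweedler (l h1) (\<lambda>a a'. frag_of (a, a', h2)))
            +o tensor3_null T (*) (*) UNIV (\<lambda>a r. a * \<eta>R r) (\<lambda>r h. h * tR r))
   \<and> (\<forall>h. lifted_can tR \<eta>R \<rho>R (l h) =
        frag_of (1, h) +o tensor_null UNIV UNIV UNIV (\<lambda>a r. a * \<eta>R r) (\<lambda>r h. h * tR r))"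

definition LL_bilinear ::
  "('l \<Rightarrow> 'h::{ring,monoid_mult}) \<Rightarrow> ('l \<Rightarrow> 'h) \<Rightarrow> ('l \<Rightarrow> 'a::{ring,monoid_mult})
    \<Rightarrow> 'a set \<Rightarrow> 'a set \<Rightarrow> ('h \<Rightarrow> ('a, 'a) tensor) \<Rightarrow> bool" where
  "LL_bilinear sL tL \<eta>L B T f \<longleftrightarrow>
     (\<forall>h. f h \<in> tensor B T B (*) (*))
   \<and> (\<forall>h h'. f (h + h') = f h + f h')
   \<and> (\<forall>l l' h. f (sL l * tL l' * h) =
        sweedler (f h) (\<lambda>b b'. frag_of (\<eta>L l * b, b' * \<eta>L l')) +o tensor_null B T B (*) (*))"

definition tensor_mult :: "('a::{ring,monoid_mult}, 'a) tensor \<Rightarrow> 'a" where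
  "tensor_mult x = sweedler x (*)"

end

theory Submission
  imports Defs
begin

text \<open>
  Let \<open>jc\<close> be the convolution inverse of a cleaving map \<open>j\<close>. Convolution with \<open>j\<close> and \<open>jc\<close> on the two
  sides turns one kind of map into the other: a strong
  connection \<open>l\<close> corresponds to \<open>h \<mapsto> j(h\<^sup>1) l(h\<^sup>2) jc(h\<^sup>3)\<close> and a map \<open>f\<close> to \<open>h \<mapsto> jc(h\<^sub>1) f(h\<^sub>2) j(h\<^sub>3)\<close>;
  mixed coassociativity and \<open>jc(h\<^sub>1) j(h\<^sub>2) = \<eta>R(\<pi>R h)\<close>, \<open>j(h\<^sup>1) jc(h\<^sup>2) = \<eta>L(\<pi>L h)\<close> make the two
  constructions mutually inverse. That the first one lands in \<open>B \<otimes>\<^sub>T B\<close> and not just in \<open>A \<otimes>\<^sub>T A\<close> is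
  seen by writing it, using the colinearity of \<open>l\<close>, as \<open>(F \<otimes> E) \<circ> l\<close> with the maps
  \<open>F a = j(S\<inverse>(a\<^sub>[\<^sub>1\<^sub>])) a\<^sub>[\<^sub>0\<^sub>]\<close> and \<open>E a = a\<^sup>0 jc(a\<^sup>1)\<close>, whose values are coinvariant. This rests on
  \<open>\<rho>R(jc h) = jc(h\<^sub>2) \<otimes> S(h\<^sub>1)\<close> and \<open>\<rho>L(jc h) = jc(h\<^sup>2) \<otimes> S(h\<^sup>1)\<close>; for \<open>A = H\<close>, \<open>j = id\<close> these say that the
  antipode reverses the coproducts.
\<close>

section \<open>Quotients of abelian groups\<close>

text \<open>Tensor signs over \<open>R\<close> and over \<open>L\<close> occur side by side, and the
  antipode exchanges the two kinds. A Sweedler sum is meaningful only if its summand is balanced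
  over the proper base, while \<open>sweedler\<close> computes from an arbitrary representative.
  Hence tensors are handled by evaluating them on balanced maps, and the substance of most steps is
  a proof that the summand is balanced. Equality is tested with balanced maps into one fixed group.
  Multiplying coactions is legitimate only because their values satisfy Takeuchi conditions. For
  \<open>H\<close> these are axioms; for \<open>A\<close> they are derived from the left action of
  \<open>R\<close> and the counit of \<open>\<rho>L\<close>. The formulas for the coactions on
  \<open>jc\<close> come from uniqueness of convolution inverses: the proposed right-hand side
  inverts \<open>\<rho>R \<circ> j\<close> (or \<open>\<rho>L \<circ> j\<close>) from the right, and
  applying the coaction to \<open>jc\<close> gives a left inverse. Bijectivity of \<open>S\<close>
  enters through \<open>F\<close>. Another obstacle is that B \<otimes> B over \<open>T\<close> has
  its own relations and is not by definition part of A \<otimes> A, so equations in it must be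
  pulled back along an injection.\<close>

definition is_subgroup :: "'g::ab_group_add set \<Rightarrow> bool" where
  "is_subgroup K \<longleftrightarrow> 0 \<in> K \<and> (\<forall>x\<in>K. \<forall>y\<in>K. x - y \<in> K)"

lemma is_subgroup_closure [simp]: "is_subgroup (group_closure X)"
  by (simp add: is_subgroup_def group_closure.diff)

lemma is_subgroup_diff: "is_subgroup K \<Longrightarrow> x \<in> K \<Longrightarrow> y \<in> K \<Longrightarrow> x - y \<in> K"
  by (simp add: is_subgroup_def)

lemma is_subgroup_minus: "is_subgroup K \<Longrightarrow> x \<in> K \<Longrightarrow> - x \<in> K"
  unfolding is_subgroup_def by (metis diff_0)

lemma is_subgroup_add: "is_subgroup K \<Longrightarrow> x \<in> K \<Longrightarrow> y \<in> K \<Longrightarrow> x + y \<in> K"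
  by (metis is_subgroup_def is_subgroup_minus diff_minus_eq_add)

lemma coset_eq_iff:
  assumes "is_subgroup K"
  shows "x +o K = y +o K \<longleftrightarrow> x - y \<in> K"
proof
  assume "x +o K = y +o K"
  moreover have "x \<in> x +o K"
    using assms by (force simp: elt_set_plus_def is_subgroup_def)
  ultimately obtain k where "k \<in> K" "x = y + k"
    by (auto simp: elt_set_plus_def)
  then show "x - y \<in> K" by simp
next
  have sub: "x +o K \<subseteq> y +o K" if d: "x - y \<in> K" for x y
  proof
    fix z assume "z \<in> x +o K"
    then obtain k where "k \<in> K" "z = x + k" by (auto simp: elt_set_plus_def)
    then have "z = y + ((x - y) + k)" "(x - y) + k \<in> K"
      using d assms by (simp_all add: is_subgroup_add)
    then show "z \<in> y +o K" unfolding elt_set_plus_def by blast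
  qed
  assume "x - y \<in> K"
  then show "x +o K = y +o K"
    using sub is_subgroup_minus[OF assms, of "x - y"] by (simp add: subset_antisym)
qed

lemma coset_add:
  assumes "is_subgroup K"
  shows "(x +o K) + (y +o K) = (x + y) +o K"
proof (intro set_eqI iffI)
  fix z assume "z \<in> (x +o K) + (y +o K)"
  then obtain k l where "k \<in> K" "l \<in> K" "z = (x + k) + (y + l)"
    by (auto simp: elt_set_plus_def elim!: set_plus_elim)
  then have "z = (x + y) + (k + l)" "k + l \<in> K"
    using assms by (simp_all add: is_subgroup_add)
  then show "z \<in> (x + y) +o K" unfolding elt_set_plus_def by blast
next
  fix z assume "z \<in> (x + y) +o K"
  then obtain k where k: "k \<in> K" "z = (x + 0) + (y + k)"
    by (auto simp: elt_set_plus_def add.assoc)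
  moreover have "0 \<in> K" using assms by (simp add: is_subgroup_def)
  ultimately show "z \<in> (x +o K) + (y +o K)"
    unfolding elt_set_plus_def by (blast intro: set_plus_intro)
qed

text \<open>
  The product of all quotients \<open>G / K\<close> of a group \<open>G\<close>. As it does not depend on \<open>K\<close>, it is a type,
  in which every \<open>G / K\<close> embeds: congruences modulo a subgroup become equations in a group.
\<close>

quotient_type (overloaded) 'g quotients = "'g::ab_group_add set \<Rightarrow> 'g" /
  "\<lambda>f g. \<forall>K. is_subgroup K \<longrightarrow> f K - g K \<in> K"
proof (rule equivpI)
  show "reflp (\<lambda>f g :: 'g set \<Rightarrow> 'g. \<forall>K. is_subgroup K \<longrightarrow> f K - g K \<in> K)"
    by (auto simp: reflp_def is_subgroup_def)
  show "symp (\<lambda>f g :: 'g set \<Rightarrow> 'g. \<forall>K. is_subgroup K \<longrightarrow> f K - g K \<in> K)"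
    unfolding symp_def by (metis is_subgroup_minus minus_diff_eq)
  show "transp (\<lambda>f g :: 'g set \<Rightarrow> 'g. \<forall>K. is_subgroup K \<longrightarrow> f K - g K \<in> K)"
    unfolding transp_def using is_subgroup_add
    by (metis (no_types, lifting) diff_add_cancel add_diff_eq)
qed

lemma add_diff_add_eq: "a + b - (c + d) = (a - c) + (b - d)" for a b c d :: "'g::ab_group_add"
  by simp

lemma minus_diff_minus_eq: "- a - - b = - (a - b)" for a b :: "'g::ab_group_add"
  by simp

lemma diff_diff_diff_eq: "a - b - (c - d) = (a - c) - (b - d)" for a b c d :: "'g::ab_group_add"
  by simp

instantiation quotients :: (ab_group_add) ab_group_add
begin

lift_definition zero_quotients :: "'a quotients" is "\<lambda>_. 0" .

lift_definition plus_quotients :: "'a quotients \<Rightarrow> 'a quotients \<Rightarrow> 'a quotients"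
  is "\<lambda>f g K. f K + g K"
  unfolding add_diff_add_eq by (blast intro: is_subgroup_add)

lift_definition uminus_quotients :: "'a quotients \<Rightarrow> 'a quotients" is "\<lambda>f K. - f K"
  unfolding minus_diff_minus_eq by (blast intro: is_subgroup_minus)

lift_definition minus_quotients :: "'a quotients \<Rightarrow> 'a quotients \<Rightarrow> 'a quotients"
  is "\<lambda>f g K. f K - g K"
  unfolding diff_diff_diff_eq by (blast intro: is_subgroup_diff)

instance
  by standard (transfer; auto simp: is_subgroup_def algebra_simps)+

end

text \<open>All components at other subgroups are set to 0, so equality of two such elements tests
  the congruence modulo \<open>K\<close> alone.\<close>

lift_definition cls :: "'g::ab_group_add set \<Rightarrow> 'g \<Rightarrow> 'g quotients"
  is "\<lambda>K x K'. if K' = K then x else 0" .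

lemma cls_eq_iff: "is_subgroup K \<Longrightarrow> cls K x = cls K y \<longleftrightarrow> x - y \<in> K"
  by transfer (auto simp: is_subgroup_def)

lemma additive_cls: "additive (cls K)"
  by (unfold_locales, transfer) (auto simp: is_subgroup_def)

section \<open>Sums over tensors\<close>

lemma additive_0: "additive f \<Longrightarrow> f 0 = 0"
  by (rule additive.zero)

lemma frag_sum_hom: "additive f \<Longrightarrow> f (frag_sum \<phi> p) = frag_sum (\<lambda>x. f (\<phi> x)) p"
  unfolding frag_sum_def by (simp add: additive.sum additive.diff)

lemma frag_sum_add_fun: "frag_sum (\<lambda>x. \<phi> x + \<psi> x) p = frag_sum \<phi> p + frag_sum \<psi> p"
  unfolding frag_sum_def by (simp add: sum.distrib sum_subtractf algebra_simps)

lemma zmult_add: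
  fixes a :: "'g::ab_group_add" and k l :: int
  shows "(\<Sum>i<nat (k + l). a) - (\<Sum>i<nat (- (k + l)). a)
    = ((\<Sum>i<nat k. a) - (\<Sum>i<nat (- k). a)) + ((\<Sum>i<nat l. a) - (\<Sum>i<nat (- l). a))"
proof -
  define s where "s n = (\<Sum>i<n. a)" for n :: nat
  have s_add: "s (m + n) = s m + s n" for m n
    by (induction n) (simp_all add: s_def add.assoc)
  \<comment> \<open>With every subtracted multiple moved to the other side, only an equation between
    natural numbers of summands remains.\<close>
  have "nat (k + l) + nat (- k) + nat (- l) = nat (- (k + l)) + nat k + nat l"
    by simp
  then have "s (nat (k + l)) + s (nat (- k)) + s (nat (- l)) = s (nat (- (k + l))) + s (nat k) + s (nat l)"
    by (metis s_add)
  then show ?thesis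
    unfolding s_def by (simp add: algebra_simps)
qed

text \<open>Points outside the support have coefficient 0. This allows \<open>p\<close>,
  \<open>q\<close> and \<open>p + q\<close>, whose supports differ, to be summed over one common
  set.\<close>

lemma frag_sum_superset:
  assumes "finite X" "Poly_Mapping.keys p \<subseteq> X"
  shows "frag_sum \<phi> p = (\<Sum>x\<in>X. (\<Sum>i<nat (Poly_Mapping.lookup p x). \<phi> x)
    - (\<Sum>i<nat (- Poly_Mapping.lookup p x). \<phi> x))"
  unfolding frag_sum_def
  by (rule sum.mono_neutral_left) (use assms in \<open>auto simp: in_keys_iff\<close>)

lemma additive_frag_sum: "additive (frag_sum \<phi>)"
proof
  fix p q :: "'a \<Rightarrow>\<^sub>0 int"
  let ?X = "Poly_Mapping.keys p \<union> Poly_Mapping.keys q"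
  have "Poly_Mapping.keys (p + q) \<subseteq> ?X" by (rule keys_add)
  then show "frag_sum \<phi> (p + q) = frag_sum \<phi> p + frag_sum \<phi> q"
    by (simp only: frag_sum_superset[of ?X] finite_Un finite_keys Un_upper1 Un_upper2 lookup_add
      zmult_add sum.distrib)
qed

lemma frag_sum_single [simp]: "frag_sum \<phi> (frag_of x) = \<phi> x"
  by (simp add: frag_sum_def)

lemma frag_sum_cong: "(\<And>x. x \<in> Poly_Mapping.keys p \<Longrightarrow> \<phi> x = \<psi> x) \<Longrightarrow> frag_sum \<phi> p = frag_sum \<psi> p"
  unfolding frag_sum_def by (intro sum.cong) simp_all

lemma frag_sum_group_closure:
  assumes "\<And>p. p \<in> X \<Longrightarrow> frag_sum \<phi> p = 0" "p \<in> group_closure X"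
  shows "frag_sum \<phi> p = 0"
  using assms(2)
  by induction (auto simp: assms(1) additive_0[OF additive_frag_sum] additive.diff[OF additive_frag_sum])

lemma sweedler_hom: "additive f \<Longrightarrow> f (sweedler x \<phi>) = sweedler x (\<lambda>m n. f (\<phi> m n))"
  unfolding sweedler_def by (simp add: frag_sum_hom case_prod_unfold)

lemma sweedler_add_fun: "sweedler x (\<lambda>m n. \<phi> m n + \<psi> m n) = sweedler x \<phi> + sweedler x \<psi>"
  unfolding sweedler_def by (simp add: frag_sum_add_fun case_prod_unfold)

lemma additive_sweedler: "(\<And>m n. additive (\<lambda>y. \<phi> y m n)) \<Longrightarrow> additive (\<lambda>y. sweedler x (\<phi> y))"
proof
  fix a b
  assume "\<And>m n. additive (\<lambda>y. \<phi> y m n)"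
  then have "\<phi> (a + b) = (\<lambda>m n. \<phi> a m n + \<phi> b m n)"
    by (auto simp: additive_def fun_eq_iff)
  then show "sweedler x (\<phi> (a + b)) = sweedler x (\<phi> a) + sweedler x (\<phi> b)"
    by (simp add: sweedler_add_fun)
qed

lemma frag_sum_swap:
  "frag_sum (\<lambda>x. frag_sum (\<chi> x) q) p = frag_sum (\<lambda>y. frag_sum (\<lambda>x. \<chi> x y) p) q"
proof -
  have "Poly_Mapping.keys p \<subseteq> UNIV" by simp
  then show ?thesis
  proof (induction p rule: frag_induction)
    case zero
    then show ?case
      by (simp add: additive_0[OF additive_frag_sum]) (simp add: frag_sum_def)
  next
    case (diff a b)
    have "frag_sum (\<lambda>y. frag_sum (\<lambda>x. \<chi> x y) a - frag_sum (\<lambda>x. \<chi> x y) b) q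
      = frag_sum (\<lambda>y. frag_sum (\<lambda>x. \<chi> x y) a) q - frag_sum (\<lambda>y. frag_sum (\<lambda>x. \<chi> x y) b) q"
      using frag_sum_add_fun[of "\<lambda>y. frag_sum (\<lambda>x. \<chi> x y) a - frag_sum (\<lambda>x. \<chi> x y) b"
          "\<lambda>y. frag_sum (\<lambda>x. \<chi> x y) b" q]
      by simp
    with diff show ?case
      by (simp add: additive.diff[OF additive_frag_sum])
  qed simp
qed

lemma sweedler_swap:
  "sweedler x (\<lambda>m n. sweedler y (\<lambda>m' n'. \<phi> m n m' n')) = sweedler y (\<lambda>m' n'. sweedler x (\<lambda>m n. \<phi> m n m' n'))"
  unfolding sweedler_def case_prod_unfold by (rule frag_sum_swap)

lemma frag_sum_frag_of: "frag_sum frag_of p = p"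
proof -
  have "Poly_Mapping.keys p \<subseteq> UNIV" by simp
  then show ?thesis
    by (induction p rule: frag_induction)
      (simp_all add: additive_0[OF additive_frag_sum] additive.diff[OF additive_frag_sum])
qed

lemma keys_frag_sum:
  assumes "\<And>x. Poly_Mapping.keys (g x) \<subseteq> X"
  shows "Poly_Mapping.keys (frag_sum g p) \<subseteq> X"
proof -
  have "Poly_Mapping.keys p \<subseteq> UNIV" by simp
  then show ?thesis
  proof (induction p rule: frag_induction)
    case (diff a b)
    then have "Poly_Mapping.keys (frag_sum g a - frag_sum g b) \<subseteq> X"
      by (intro order_trans[OF keys_diff] Un_least)
    then show ?case
      by (simp add: additive.diff[OF additive_frag_sum])
  qed (simp_all add: additive_0[OF additive_frag_sum] assms)
qed

lemma keys_sweedler: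
  "(\<And>m n. Poly_Mapping.keys (g m n) \<subseteq> X) \<Longrightarrow> Poly_Mapping.keys (sweedler x g) \<subseteq> X"
  unfolding sweedler_def by (rule keys_frag_sum) (simp add: case_prod_unfold)

section \<open>Balanced maps\<close>

text \<open>The conditions are relative to subsets because \<open>B\<close> is a subset of the type
  of \<open>A\<close>: a map balanced on \<open>B\<close> need not be additive elsewhere.\<close>

definition balanced_on ::
  "'m::ab_group_add set \<Rightarrow> 's set \<Rightarrow> 'n::ab_group_add set \<Rightarrow> ('m \<Rightarrow> 's \<Rightarrow> 'm) \<Rightarrow> ('s \<Rightarrow> 'n \<Rightarrow> 'n)
    \<Rightarrow> ('m \<Rightarrow> 'n \<Rightarrow> 'g::ab_group_add) \<Rightarrow> bool" where
  "balanced_on M S N ra la \<beta> \<longleftrightarrow>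
     (\<forall>m\<in>M. \<forall>m'\<in>M. \<forall>n\<in>N. \<beta> (m + m') n = \<beta> m n + \<beta> m' n)
   \<and> (\<forall>m\<in>M. \<forall>n\<in>N. \<forall>n'\<in>N. \<beta> m (n + n') = \<beta> m n + \<beta> m n')
   \<and> (\<forall>m\<in>M. \<forall>s\<in>S. \<forall>n\<in>N. \<beta> (ra m s) n = \<beta> m (la s n))"

abbreviation "balanced S \<equiv> balanced_on UNIV S UNIV"

lemma balancedI:
  assumes "\<And>n. additive (\<lambda>m. \<beta> m n)" "\<And>m. additive (\<beta> m)"
    and "\<And>m s n. s \<in> S \<Longrightarrow> \<beta> (ra m s) n = \<beta> m (la s n)"
  shows "balanced S ra la \<beta>"
  using assms by (simp add: balanced_on_def additive_def)

lemma balanced_additive: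
  assumes "balanced S ra la \<beta>"
  shows "additive (\<lambda>m. \<beta> m n)" "additive (\<beta> m)" "additive (\<lambda>n. \<beta> m n)"
  using assms by (unfold_locales; simp add: balanced_on_def)+

lemma balanced_on_subset:
  "balanced_on M S N ra la \<beta> \<Longrightarrow> M' \<subseteq> M \<Longrightarrow> N' \<subseteq> N \<Longrightarrow> balanced_on M' S N' ra la \<beta>"
  unfolding balanced_on_def by blast

lemma is_subgroup_tensor_null [simp]: "is_subgroup (tensor_null M S N ra la)"
  by (simp add: tensor_null_def)

lemma is_subgroup_tensor3_null [simp]: "is_subgroup (tensor3_null S ra la S' ra' la')"
  by (simp add: tensor3_null_def)

lemma frag_sum_tensor_null:
  assumes "balanced_on M S N ra la \<beta>" "p \<in> tensor_null M S N ra la"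
  shows "frag_sum (\<lambda>(m, n). \<beta> m n) p = 0"
proof (rule frag_sum_group_closure[OF _ assms(2)[unfolded tensor_null_def]], elim UnE CollectE exE conjE)
qed (use assms(1) in \<open>simp_all add: additive.diff[OF additive_frag_sum] balanced_on_def\<close>)

text \<open>The chosen representative differs from \<open>p\<close> by an element of the null
  subgroup, and balanced maps kill that subgroup. This is the universal property of the tensor
  product; it removes the choice from \<open>sweedler\<close>.\<close>

lemma sweedler_coset:
  assumes "balanced_on M S N ra la \<beta>"
  shows "sweedler (p +o tensor_null M S N ra la) \<beta> = frag_sum (\<lambda>(m, n). \<beta> m n) p"
proof -
  let ?N = "tensor_null M S N ra la"
  have "p + 0 \<in> p +o ?N"
    unfolding elt_set_plus_def using is_subgroup_tensor_null[unfolded is_subgroup_def] by blast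
  then have "(SOME q. q \<in> p +o ?N) \<in> p +o ?N"
    by (rule someI)
  then obtain k where "k \<in> ?N" "(SOME q. q \<in> p +o ?N) = p + k"
    by (auto simp: elt_set_plus_def)
  then show ?thesis
    using frag_sum_tensor_null[OF assms]
    by (simp add: sweedler_def additive.add[OF additive_frag_sum])
qed

lemma sweedler_coset_eq:
  assumes "x = p +o tensor_null M S N ra la" "balanced_on M S N ra la \<beta>"
  shows "sweedler x \<beta> = frag_sum (\<lambda>(m, n). \<beta> m n) p"
  unfolding assms(1) by (rule sweedler_coset[OF assms(2)])

text \<open>The axioms describe coactions as cosets of sums over other tensors. This lemma converts
  such an equation into a rule for evaluating balanced maps.\<close>

lemma sweedler_of_sweedler:
  assumes "x = sweedler y g +o tensor_null M S N ra la" "balanced_on M S N ra la \<beta>"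
  shows "sweedler x \<beta> = sweedler y (\<lambda>a b. frag_sum (\<lambda>(m, n). \<beta> m n) (g a b))"
  by (simp add: sweedler_coset_eq[OF assms] sweedler_hom[OF additive_frag_sum])

lemma sweedler_pure:
  assumes "x = frag_of (m, n) +o tensor_null M S N ra la" "balanced_on M S N ra la \<beta>"
  shows "sweedler x \<beta> = \<beta> m n"
  by (simp add: sweedler_coset_eq[OF assms])

lemma sweedler_plus:
  assumes "x \<in> tensor M S N ra la" "y \<in> tensor M S N ra la" "balanced_on M S N ra la \<beta>"
  shows "sweedler (x + y) \<beta> = sweedler x \<beta> + sweedler y \<beta>"
  using assms(1,2)
  by (auto simp: tensor_def coset_add sweedler_coset[OF assms(3)] additive.add[OF additive_frag_sum])

lemma sweedler2_elim:
  assumes "sweedler x f +o tensor_null M S N ra la = sweedler y g +o tensor_null M S N ra la"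
    and \<beta>: "balanced_on M S N ra la \<beta>"
  shows "sweedler x (\<lambda>a b. frag_sum (\<lambda>(m, n). \<beta> m n) (f a b))
    = sweedler y (\<lambda>a b. frag_sum (\<lambda>(m, n). \<beta> m n) (g a b))"
  using sweedler_coset[OF \<beta>, of "sweedler x f"] sweedler_coset[OF \<beta>, of "sweedler y g"]
  unfolding assms(1) by (simp only: sweedler_hom[OF additive_frag_sum])

text \<open>The universal balanced map. It takes values in \<open>quotients\<close> rather than in
  cosets, since addition of sets is not a group operation on the whole type of sets.\<close>

definition pure_tensor ::
  "'m::ab_group_add set \<Rightarrow> 's set \<Rightarrow> 'n::ab_group_add set \<Rightarrow> ('m \<Rightarrow> 's \<Rightarrow> 'm) \<Rightarrow> ('s \<Rightarrow> 'n \<Rightarrow> 'n)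
    \<Rightarrow> 'm \<Rightarrow> 'n \<Rightarrow> (('m \<times> 'n) \<Rightarrow>\<^sub>0 int) quotients" where
  "pure_tensor M S N ra la m n = cls (tensor_null M S N ra la) (frag_of (m, n))"

lemma balanced_pure_tensor: "balanced_on M S N ra la (pure_tensor M S N ra la)"
proof -
  let ?K = "tensor_null M S N ra la"
  have 1: "cls ?K (frag_of (m + m', n)) = cls ?K (frag_of (m, n)) + cls ?K (frag_of (m', n))"
    if "m \<in> M" "m' \<in> M" "n \<in> N" for m m' n
  proof -
    have "frag_of (m + m', n) - frag_of (m, n) - frag_of (m', n) \<in> ?K"
      unfolding tensor_null_def using that by (intro group_closure.base) blast
    then show ?thesis
      by (simp add: additive.add[OF additive_cls, symmetric] cls_eq_iff diff_diff_eq)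
  qed
  have 2: "cls ?K (frag_of (m, n + n')) = cls ?K (frag_of (m, n)) + cls ?K (frag_of (m, n'))"
    if "m \<in> M" "n \<in> N" "n' \<in> N" for m n n'
  proof -
    have "frag_of (m, n + n') - frag_of (m, n) - frag_of (m, n') \<in> ?K"
      unfolding tensor_null_def using that by (intro group_closure.base) blast
    then show ?thesis
      by (simp add: additive.add[OF additive_cls, symmetric] cls_eq_iff diff_diff_eq)
  qed
  have 3: "cls ?K (frag_of (ra m s, n)) = cls ?K (frag_of (m, la s n))"
    if "m \<in> M" "s \<in> S" "n \<in> N" for m s n
  proof -
    have "frag_of (ra m s, n) - frag_of (m, la s n) \<in> ?K"
      unfolding tensor_null_def using that by (intro group_closure.base) blast
    then show ?thesis
      by (simp add: cls_eq_iff)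
  qed
  from 1 2 3 show ?thesis
    by (simp add: balanced_on_def pure_tensor_def)
qed

lemma sweedler_pure_tensor:
  assumes "x = p +o tensor_null M S N ra la"
  shows "sweedler x (pure_tensor M S N ra la) = cls (tensor_null M S N ra la) p"
proof -
  have "sweedler x (pure_tensor M S N ra la)
    = frag_sum (\<lambda>z. cls (tensor_null M S N ra la) (frag_of z)) p"
    using sweedler_coset_eq[OF assms balanced_pure_tensor] by (simp add: pure_tensor_def case_prod_unfold)
  then show ?thesis
    by (simp add: frag_sum_hom[OF additive_cls, symmetric] frag_sum_frag_of)
qed

lemma tensor_eqI:
  assumes "x \<in> tensor M S N ra la" "y \<in> tensor M S N ra la"
    and "sweedler x (pure_tensor M S N ra la) = sweedler y (pure_tensor M S N ra la)"
  shows "x = y"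
proof -
  from assms(1,2) obtain p q
    where "x = p +o tensor_null M S N ra la" "y = q +o tensor_null M S N ra la"
    by (auto simp: tensor_def)
  with assms(3) show ?thesis
    by (simp add: sweedler_pure_tensor[OF refl] cls_eq_iff coset_eq_iff)
qed

lemma coset_in_tensor: "Poly_Mapping.keys p \<subseteq> M \<times> N \<Longrightarrow> p +o tensor_null M S N ra la \<in> tensor M S N ra la"
  by (auto simp: tensor_def)

text \<open>Only the universal map is needed as a test; quantifying over all balanced
  \<open>\<beta>\<close> lets the evaluation rules prove the hypothesis directly.\<close>

lemma tensor_eq_cosetI:
  fixes x :: "('m::ab_group_add, 'n::ab_group_add) tensor"
  assumes "x \<in> tensor M S N ra la" "Poly_Mapping.keys p \<subseteq> M \<times> N"
    and "\<And>\<beta> :: 'm \<Rightarrow> 'n \<Rightarrow> (('m \<times> 'n) \<Rightarrow>\<^sub>0 int) quotients.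
      balanced_on M S N ra la \<beta> \<Longrightarrow> sweedler x \<beta> = frag_sum (\<lambda>(m, n). \<beta> m n) p"
  shows "x = p +o tensor_null M S N ra la"
  by (rule tensor_eqI[OF assms(1) coset_in_tensor[OF assms(2)]])
    (simp add: assms(3)[OF balanced_pure_tensor] sweedler_coset[OF balanced_pure_tensor])

lemma keys_tensor_null:
  assumes M: "\<And>m m'. m \<in> M \<Longrightarrow> m' \<in> M \<Longrightarrow> m + m' \<in> M" "\<And>m s. m \<in> M \<Longrightarrow> s \<in> S \<Longrightarrow> ra m s \<in> M"
    and N: "\<And>n n'. n \<in> N \<Longrightarrow> n' \<in> N \<Longrightarrow> n + n' \<in> N" "\<And>n s. n \<in> N \<Longrightarrow> s \<in> S \<Longrightarrow> la s n \<in> N"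
    and "p \<in> tensor_null M S N ra la"
  shows "Poly_Mapping.keys p \<subseteq> M \<times> N"
  using assms(5) unfolding tensor_null_def
proof induction
  case (diff p q)
  then show ?case using keys_diff[of p q] by blast
next
  case (base p)
  have keys_diff': "Poly_Mapping.keys (frag_of a - frag_of b) \<subseteq> M \<times> N" if "a \<in> M \<times> N" "b \<in> M \<times> N" for a b
    using that keys_diff[of "frag_of a" "frag_of b"] by auto
  have keys_diff'': "Poly_Mapping.keys (frag_of a - frag_of b - frag_of c) \<subseteq> M \<times> N"
    if "a \<in> M \<times> N" "b \<in> M \<times> N" "c \<in> M \<times> N" for a b c
    using that keys_diff'[of a b] keys_diff[of "frag_of a - frag_of b" "frag_of c"] by auto
  from base M N show ?case
    by (elim insertE UnE CollectE exE conjE) (simp_all add: keys_diff' keys_diff'')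
qed

text \<open>As \<open>M\<close> and \<open>N\<close> are closed under the operations involved, the
  relations are supported in \<open>M \<times> N\<close>. So every representative is, in particular
  the one picked by \<open>sweedler\<close>, even though the definition of \<open>tensor\<close>
  only promises one.\<close>

lemma keys_some:
  assumes "\<And>m m'. m \<in> M \<Longrightarrow> m' \<in> M \<Longrightarrow> m + m' \<in> M" "\<And>m s. m \<in> M \<Longrightarrow> s \<in> S \<Longrightarrow> ra m s \<in> M"
    and "\<And>n n'. n \<in> N \<Longrightarrow> n' \<in> N \<Longrightarrow> n + n' \<in> N" "\<And>n s. n \<in> N \<Longrightarrow> s \<in> S \<Longrightarrow> la s n \<in> N"
    and "x \<in> tensor M S N ra la"
  shows "Poly_Mapping.keys (SOME p. p \<in> x) \<subseteq> M \<times> N"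
proof -
  from assms(5) obtain p where p: "x = p +o tensor_null M S N ra la" "Poly_Mapping.keys p \<subseteq> M \<times> N"
    by (auto simp: tensor_def)
  have "p + 0 \<in> x"
    unfolding p(1) elt_set_plus_def using is_subgroup_tensor_null[unfolded is_subgroup_def] by blast
  then have "(SOME q. q \<in> x) \<in> x" by (rule someI)
  then obtain k where "k \<in> tensor_null M S N ra la" "(SOME q. q \<in> x) = p + k"
    unfolding p(1) by (auto simp: elt_set_plus_def)
  moreover from this have "Poly_Mapping.keys k \<subseteq> M \<times> N"
    using keys_tensor_null[of M S ra N la] assms(1-4) by blast
  ultimately show ?thesis
    using p(2) keys_add[of p k] by auto
qed

lemma tensor_add:
  assumes "x \<in> tensor M S N ra la" "y \<in> tensor M S N ra la"
  shows "x + y \<in> tensor M S N ra la"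
proof -
  from assms obtain p q where "x = p +o tensor_null M S N ra la" "Poly_Mapping.keys p \<subseteq> M \<times> N"
    "y = q +o tensor_null M S N ra la" "Poly_Mapping.keys q \<subseteq> M \<times> N"
    by (auto simp: tensor_def)
  moreover from this have "Poly_Mapping.keys (p + q) \<subseteq> M \<times> N"
    using keys_add[of p q] by auto
  ultimately show ?thesis
    by (simp add: coset_add coset_in_tensor)
qed

section \<open>Balanced maps on threefold tensor products\<close>

definition balanced3 ::
  "'s set \<Rightarrow> ('m::ab_group_add \<Rightarrow> 's \<Rightarrow> 'm) \<Rightarrow> ('s \<Rightarrow> 'n::ab_group_add \<Rightarrow> 'n)
    \<Rightarrow> 'u set \<Rightarrow> ('n \<Rightarrow> 'u \<Rightarrow> 'n) \<Rightarrow> ('u \<Rightarrow> 'p::ab_group_add \<Rightarrow> 'p)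
    \<Rightarrow> ('m \<Rightarrow> 'n \<Rightarrow> 'p \<Rightarrow> 'g::ab_group_add) \<Rightarrow> bool" where
  "balanced3 S ra la S' ra' la' \<tau> \<longleftrightarrow>
     (\<forall>p. balanced S ra la (\<lambda>m n. \<tau> m n p)) \<and> (\<forall>m. balanced S' ra' la' (\<tau> m))"

lemma balanced3I:
  assumes "\<And>n p. additive (\<lambda>m. \<tau> m n p)" "\<And>m p. additive (\<lambda>n. \<tau> m n p)" "\<And>m n. additive (\<tau> m n)"
    and "\<And>m s n p. s \<in> S \<Longrightarrow> \<tau> (ra m s) n p = \<tau> m (la s n) p"
    and "\<And>m s n p. s \<in> S' \<Longrightarrow> \<tau> m (ra' n s) p = \<tau> m n (la' s p)"
  shows "balanced3 S ra la S' ra' la' \<tau>"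
  unfolding balanced3_def using assms by (auto intro!: balancedI)

lemma frag_sum_tensor3_null:
  assumes \<tau>: "balanced3 S ra la S' ra' la' \<tau>" and "p \<in> tensor3_null S ra la S' ra' la'"
  shows "frag_sum (\<lambda>(m, n, p). \<tau> m n p) p = 0"
proof (rule frag_sum_group_closure[OF _ assms(2)[unfolded tensor3_null_def]], elim UnE CollectE exE conjE)
qed (use \<tau> in \<open>simp_all add: additive.diff[OF additive_frag_sum] balanced_on_def balanced3_def\<close>)

lemma frag_sum_coset3:
  assumes "p +o tensor3_null S ra la S' ra' la' = q +o tensor3_null S ra la S' ra' la'"
    and \<tau>: "balanced3 S ra la S' ra' la' \<tau>"
  shows "frag_sum (\<lambda>(m, n, p). \<tau> m n p) p = frag_sum (\<lambda>(m, n, p). \<tau> m n p) q"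
proof -
  have "p - q \<in> tensor3_null S ra la S' ra' la'"
    using assms(1) by (simp only: coset_eq_iff[OF is_subgroup_tensor3_null])
  from frag_sum_tensor3_null[OF \<tau> this] show ?thesis
    by (simp only: additive.diff[OF additive_frag_sum] right_minus_eq)
qed

lemma sweedler3_elim:
  assumes "sweedler x (\<lambda>a b. sweedler (f a b) (g a b)) +o tensor3_null S ra la S' ra' la'
      = sweedler y (\<lambda>a b. sweedler (f' a b) (g' a b)) +o tensor3_null S ra la S' ra' la'"
    and \<tau>: "balanced3 S ra la S' ra' la' \<tau>"
  shows "sweedler x (\<lambda>a b. sweedler (f a b) (\<lambda>c d. frag_sum (\<lambda>(m, n, p). \<tau> m n p) (g a b c d)))
    = sweedler y (\<lambda>a b. sweedler (f' a b) (\<lambda>c d. frag_sum (\<lambda>(m, n, p). \<tau> m n p) (g' a b c d)))"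
  using frag_sum_coset3[OF assms] by (simp only: sweedler_hom[OF additive_frag_sum])

text \<open>The coset map into \<open>quotients\<close> is itself an admissible test map, and it
  detects equality of cosets.\<close>

lemma coset3_eqI:
  fixes p q :: "('m::ab_group_add \<times> 'n::ab_group_add \<times> 'p::ab_group_add) \<Rightarrow>\<^sub>0 int"
  assumes "\<And>\<tau> :: 'm \<Rightarrow> 'n \<Rightarrow> 'p \<Rightarrow> (('m \<times> 'n \<times> 'p) \<Rightarrow>\<^sub>0 int) quotients.
      balanced3 S ra la S' ra' la' \<tau>
    \<Longrightarrow> frag_sum (\<lambda>(m, n, p). \<tau> m n p) p = frag_sum (\<lambda>(m, n, p). \<tau> m n p) q"
  shows "p +o tensor3_null S ra la S' ra' la' = q +o tensor3_null S ra la S' ra' la'"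
proof -
  let ?K = "tensor3_null S ra la S' ra' la'"
  let ?\<tau> = "\<lambda>m n p. cls ?K (frag_of (m, n, p))"
  have cls_add: "cls ?K a = cls ?K b + cls ?K c" if "a - b - c \<in> ?K" for a b c
    using that by (simp add: additive.add[OF additive_cls, symmetric] cls_eq_iff diff_diff_eq)
  have "balanced3 S ra la S' ra' la' ?\<tau>"
  proof (rule balanced3I; unfold_locales?)
    fix m m' n n' p p'
    have "frag_of (m + m', n, p) - frag_of (m, n, p) - frag_of (m', n, p) \<in> ?K"
      unfolding tensor3_null_def
      by (rule group_closure.base, rule insertI2, rule UnI1, rule UnI1, rule UnI1, rule UnI1) blast
    then show "cls ?K (frag_of (m + m', n, p)) = cls ?K (frag_of (m, n, p)) + cls ?K (frag_of (m', n, p))"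
      by (rule cls_add)
    have "frag_of (m, n + n', p) - frag_of (m, n, p) - frag_of (m, n', p) \<in> ?K"
      unfolding tensor3_null_def
      by (rule group_closure.base, rule insertI2, rule UnI1, rule UnI1, rule UnI1, rule UnI2) blast
    then show "cls ?K (frag_of (m, n + n', p)) = cls ?K (frag_of (m, n, p)) + cls ?K (frag_of (m, n', p))"
      by (rule cls_add)
    have "frag_of (m, n, p + p') - frag_of (m, n, p) - frag_of (m, n, p') \<in> ?K"
      unfolding tensor3_null_def
      by (rule group_closure.base, rule insertI2, rule UnI1, rule UnI1, rule UnI2) blast
    then show "cls ?K (frag_of (m, n, p + p')) = cls ?K (frag_of (m, n, p)) + cls ?K (frag_of (m, n, p'))"
      by (rule cls_add)
  next
    fix m n p s assume s: "s \<in> S"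
    have "frag_of (ra m s, n, p) - frag_of (m, la s n, p) \<in> ?K"
      unfolding tensor3_null_def
      by (rule group_closure.base, rule insertI2, rule UnI1, rule UnI2) (use s in blast)
    then show "cls ?K (frag_of (ra m s, n, p)) = cls ?K (frag_of (m, la s n, p))"
      by (simp add: cls_eq_iff)
  next
    fix m n p s assume s: "s \<in> S'"
    have "frag_of (m, ra' n s, p) - frag_of (m, n, la' s p) \<in> ?K"
      unfolding tensor3_null_def
      by (rule group_closure.base, rule insertI2, rule UnI2) (use s in blast)
    then show "cls ?K (frag_of (m, ra' n s, p)) = cls ?K (frag_of (m, n, la' s p))"
      by (simp add: cls_eq_iff)
  qed
  from assms[OF this] have "cls ?K p = cls ?K q"
    by (simp add: case_prod_unfold frag_sum_hom[OF additive_cls, symmetric] frag_sum_frag_of)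
  then show ?thesis
    by (simp add: cls_eq_iff coset_eq_iff)
qed

section \<open>Universal properties of the structure maps\<close>

text \<open>Proofs of balancing leave additivity goals for nested sums; these rules decompose them
  structurally.\<close>

named_theorems additive_intros

lemma additive_id [additive_intros]: "additive (\<lambda>x. x)"
  by unfold_locales simp

lemma additive_times [additive_intros]: "additive ((*) c)" for c :: "'a::ring"
  by unfold_locales (simp add: algebra_simps)

lemma sweedler_cong: "(\<And>m n. f m n = g m n) \<Longrightarrow> sweedler x f = sweedler x g"
  by presburger

lemma additive_compose: "additive g \<Longrightarrow> additive f \<Longrightarrow> additive (\<lambda>x. g (f x))"
  by (simp add: additive_def)

lemma additive_mult_left [additive_intros]: "additive f \<Longrightarrow> additive (\<lambda>x. f x * c)"
  and additive_mult_right [additive_intros]: "additive f \<Longrightarrow> additive (\<lambda>x. c * f x)"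
  for f :: "'a::ab_group_add \<Rightarrow> 'b::ring"
  by (simp_all add: additive_def algebra_simps)

declare additive_sweedler [additive_intros]

lemma sweedler_mult_left: "c * sweedler x \<phi> = sweedler x (\<lambda>m n. c * \<phi> m n)"
  and sweedler_mult_right: "sweedler x \<phi> * c = sweedler x (\<lambda>m n. \<phi> m n * c)"
  for c :: "'b::ring"
  by (rule sweedler_hom[of "\<lambda>y. c * y"] sweedler_hom[of "\<lambda>y. y * c"]; intro additive_intros)+

lemma balanced_additive1: "balanced S ra la \<beta> \<Longrightarrow> additive f \<Longrightarrow> additive (\<lambda>x. \<beta> (f x) n)"
  and balanced_additive2: "balanced S ra la \<beta> \<Longrightarrow> additive g \<Longrightarrow> additive (\<lambda>x. \<beta> m (g x))"
  using balanced_additive[of S ra la \<beta>] by (auto simp: additive_def)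

lemma balanced3_additive1: "balanced3 S ra la S' ra' la' \<tau> \<Longrightarrow> additive f \<Longrightarrow> additive (\<lambda>x. \<tau> (f x) n p)"
  and balanced3_additive2: "balanced3 S ra la S' ra' la' \<tau> \<Longrightarrow> additive g \<Longrightarrow> additive (\<lambda>x. \<tau> m (g x) p)"
  and balanced3_additive3: "balanced3 S ra la S' ra' la' \<tau> \<Longrightarrow> additive k \<Longrightarrow> additive (\<lambda>x. \<tau> m n (k x))"
  by (auto simp: balanced3_def balanced_on_def additive_def)

lemma balanced3_eq1: "balanced3 S ra la S' ra' la' \<tau> \<Longrightarrow> s \<in> S \<Longrightarrow> \<tau> (ra m s) n p = \<tau> m (la s n) p"
  and balanced3_eq2: "balanced3 S ra la S' ra' la' \<tau> \<Longrightarrow> s' \<in> S' \<Longrightarrow> \<tau> m (ra' n s') p = \<tau> m n (la' s' p)"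
  by (simp_all add: balanced3_def balanced_on_def)

context coring
begin

lemma additive_comult:
  assumes "balanced UNIV ra la \<beta>" "additive f"
  shows "additive (\<lambda>x. sweedler (\<Delta> (f x)) \<beta>)"
  by unfold_locales
    (simp add: additive.add[OF assms(2)] comult_add sweedler_plus[OF comult_in comult_in assms(1)])

lemma comult_left:
  "balanced UNIV ra la \<beta> \<Longrightarrow> sweedler (\<Delta> (la s c)) \<beta> = sweedler (\<Delta> c) (\<lambda>c1 c2. \<beta> (la s c1) c2)"
  using sweedler_of_sweedler[OF comult_bilinear[of s c 1], of \<beta>] by (simp add: right_one)

lemma comult_right:
  "balanced UNIV ra la \<beta> \<Longrightarrow> sweedler (\<Delta> (ra c s)) \<beta> = sweedler (\<Delta> c) (\<lambda>c1 c2. \<beta> c1 (ra c2 s))"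
  using sweedler_of_sweedler[OF comult_bilinear[of 1 c s], of \<beta>] by (simp add: left_one)

lemma coassoc':
  "balanced3 UNIV ra la UNIV ra la \<tau> \<Longrightarrow>
    sweedler (\<Delta> c) (\<lambda>c1 c2. sweedler (\<Delta> c1) (\<lambda>c11 c12. \<tau> c11 c12 c2))
    = sweedler (\<Delta> c) (\<lambda>c1 c2. sweedler (\<Delta> c2) (\<lambda>c21 c22. \<tau> c1 c21 c22))"
  using sweedler3_elim[OF coassoc[of c], of \<tau>] by simp

lemma additive_counit: "additive \<epsilon>"
  by unfold_locales (rule counit_add)

lemma counit_la: "\<epsilon> (la s c) = s * \<epsilon> c" and counit_ra: "\<epsilon> (ra c s) = \<epsilon> c * s"
  using counit_bilinear[of s c 1] counit_bilinear[of 1 c s] by (simp_all add: right_one left_one)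

end

context right_comodule
begin

lemma additive_coact:
  assumes "balanced UNIV raM la \<beta>" "additive f"
  shows "additive (\<lambda>x. sweedler (\<rho> (f x)) \<beta>)"
  by unfold_locales
    (simp add: additive.add[OF assms(2)] coact_add sweedler_plus[OF coact_in coact_in assms(1)])

lemma coact_right:
  "balanced UNIV raM la \<beta> \<Longrightarrow> sweedler (\<rho> (raM m s)) \<beta> = sweedler (\<rho> m) (\<lambda>m0 m1. \<beta> m0 (ra m1 s))"
  using sweedler_of_sweedler[OF coact_linear[of m s], of \<beta>] by simp

lemma coact_coassoc':
  "balanced3 UNIV raM la UNIV ra la \<tau> \<Longrightarrow>
    sweedler (\<rho> m) (\<lambda>m0 m1. sweedler (\<rho> m0) (\<lambda>m00 m01. \<tau> m00 m01 m1))
    = sweedler (\<rho> m) (\<lambda>m0 m1. sweedler (\<Delta> m1) (\<lambda>c1 c2. \<tau> m0 c1 c2))"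
  using sweedler3_elim[OF coact_coassoc[of m], of \<tau>] by simp

end

context left_bialgebroid
begin

abbreviation "balL \<equiv> balanced UNIV (\<lambda>h l. tL l * h) (\<lambda>l h. sL l * h)"

lemma sL_mult: "sL (a * b) = sL a * sL b" and sL_one [simp]: "sL 1 = 1" and additive_sL: "additive sL"
  and tL_mult: "tL (a * b) = tL b * tL a" and tL_one [simp]: "tL 1 = 1" and additive_tL: "additive tL"
  using sL_map tL_map by (simp_all add: algebra_map_def anti_algebra_map_def k_linear_def)

lemmas additive_\<gamma>L [additive_intros] = L.additive_comult
lemmas additive_sL' [additive_intros] = additive_compose[OF additive_sL]
lemmas additive_tL' [additive_intros] = additive_compose[OF additive_tL]
lemmas additive_\<pi>L [additive_intros] = additive_compose[OF L.additive_counit]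

lemma \<pi>L_sL_left: "\<pi>L (sL l * h) = l * \<pi>L h" and \<pi>L_tL_left: "\<pi>L (tL l * h) = \<pi>L h * l"
  by (rule L.counit_la L.counit_ra)+

lemma \<pi>L_sL_id [simp]: "\<pi>L (sL l) = l" and \<pi>L_tL_id [simp]: "\<pi>L (tL l) = l"
  using \<pi>L_sL_left[of l 1] \<pi>L_tL_left[of l 1] \<pi>L_one by simp_all

lemma \<pi>L_right: "\<pi>L (h * sL l) = \<pi>L (h * tL l)"
  using \<pi>L_sL[of h "sL l"] \<pi>L_tL[of h "sL l"] by simp

lemma \<gamma>L_takeuchi':
  "balL \<beta> \<Longrightarrow> sweedler (\<gamma>L h) (\<lambda>x y. \<beta> (x * tL l) y) = sweedler (\<gamma>L h) (\<lambda>x y. \<beta> x (y * sL l))"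
  using sweedler2_elim[OF \<gamma>L_takeuchi, of \<beta>] by simp

lemma \<gamma>L_one': "balL \<beta> \<Longrightarrow> sweedler (\<gamma>L 1) \<beta> = \<beta> 1 1"
  by (rule sweedler_pure[OF \<gamma>L_one])

lemma \<gamma>L_mult':
  "balL \<beta> \<Longrightarrow> sweedler (\<gamma>L (h * h')) \<beta> =
    sweedler (\<gamma>L h) (\<lambda>x y. sweedler (\<gamma>L h') (\<lambda>x' y'. \<beta> (x * x') (y * y')))"
  using sweedler_of_sweedler[OF \<gamma>L_mult, of \<beta> h h'] by (simp add: sweedler_hom[OF additive_frag_sum])

lemma balL_eq: "balL \<beta> \<Longrightarrow> \<beta> (tL l * x) y = \<beta> x (sL l * y)"
  by (simp add: balanced_on_def)

lemma balL_right:
  assumes \<beta>: "balL \<beta>"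
  shows "balL (\<lambda>x y. \<beta> (x * a) (y * b))"
  by (rule balancedI; (intro balanced_additive1[OF \<beta>] balanced_additive2[OF \<beta>] additive_intros)?)
    (simp add: balL_eq[OF \<beta>] mult.assoc)

text \<open>The Takeuchi condition makes the product well defined: a scalar standing between the
  factors \<open>x\<close> and \<open>x'\<close> crosses the tensor sign only under the sum over
  \<open>\<gamma>L h\<close>.\<close>

lemma balL_mult:
  assumes \<beta>: "balL \<beta>"
  shows "balL (\<lambda>x' y'. sweedler (\<gamma>L h) (\<lambda>x y. \<beta> (x * x') (y * y')))"
proof (rule balancedI)
  show "sweedler (\<gamma>L h) (\<lambda>x y. \<beta> (x * (tL l * x')) (y * y')) = sweedler (\<gamma>L h) (\<lambda>x y. \<beta> (x * x') (y * (sL l * y')))"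
    for x' l y'
    using \<gamma>L_takeuchi'[OF balL_right[OF \<beta>, of x' y'], of h l] by (simp add: mult.assoc)
qed (intro balanced_additive1[OF \<beta>] balanced_additive2[OF \<beta>] additive_intros)+

lemma \<gamma>L_sL_left: "balL \<beta> \<Longrightarrow> sweedler (\<gamma>L (sL l * h)) \<beta> = sweedler (\<gamma>L h) (\<lambda>x y. \<beta> (sL l * x) y)"
  and \<gamma>L_tL_left: "balL \<beta> \<Longrightarrow> sweedler (\<gamma>L (tL l * h)) \<beta> = sweedler (\<gamma>L h) (\<lambda>x y. \<beta> x (tL l * y))"
  by (rule L.comult_left L.comult_right; assumption)+

lemma balL_left:
  assumes \<beta>: "balL \<beta>"
  shows "balL (\<lambda>x y. \<beta> (sL l * x) (tL l' * y))"
  by (rule balancedI; (intro balanced_additive1[OF \<beta>] balanced_additive2[OF \<beta>] additive_intros)?)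
    (metis balL_eq[OF \<beta>] mult.assoc sL_tL_commute)

lemma \<gamma>L_sL: "balL \<beta> \<Longrightarrow> sweedler (\<gamma>L (sL l)) \<beta> = \<beta> (sL l) 1"
  using \<gamma>L_sL_left[of \<beta> l 1] \<gamma>L_one'[OF balL_left[of \<beta> l 1]] by simp

lemma \<gamma>L_tL: "balL \<beta> \<Longrightarrow> sweedler (\<gamma>L (tL l)) \<beta> = \<beta> 1 (tL l)"
  using \<gamma>L_tL_left[of \<beta> l 1] \<gamma>L_one'[OF balL_left[of \<beta> 1 l]] by simp

text \<open>For fixed \<open>x\<close>, \<open>y\<close> the summand over \<open>h'\<close> in
  \<open>\<gamma>L_mult'\<close> need not be balanced. With the order exchanged, both sums run over
  balanced functions and either can be evaluated.\<close>

lemma \<gamma>L_mult_swap: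
  "balL \<beta> \<Longrightarrow> sweedler (\<gamma>L (h * h')) \<beta> =
    sweedler (\<gamma>L h') (\<lambda>x' y'. sweedler (\<gamma>L h) (\<lambda>x y. \<beta> (x * x') (y * y')))"
  by (subst \<gamma>L_mult', assumption) (rule sweedler_swap)

lemma \<gamma>L_sL_right: "balL \<beta> \<Longrightarrow> sweedler (\<gamma>L (h * sL l)) \<beta> = sweedler (\<gamma>L h) (\<lambda>x y. \<beta> (x * sL l) y)"
  using \<gamma>L_sL[OF balL_mult[of \<beta> h], of l] by (simp add: \<gamma>L_mult_swap)

lemma \<gamma>L_tL_right: "balL \<beta> \<Longrightarrow> sweedler (\<gamma>L (h * tL l)) \<beta> = sweedler (\<gamma>L h) (\<lambda>x y. \<beta> x (y * tL l))"
  using \<gamma>L_tL[OF balL_mult[of \<beta> h], of l] by (simp add: \<gamma>L_mult_swap)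

end

context right_bialgebroid
begin

abbreviation "balR \<equiv> balanced UNIV (\<lambda>h r. h * sR r) (\<lambda>r h. h * tR r)"

lemma sR_mult: "sR (a * b) = sR a * sR b" and sR_one [simp]: "sR 1 = 1" and additive_sR: "additive sR"
  and tR_mult: "tR (a * b) = tR b * tR a" and tR_one [simp]: "tR 1 = 1" and additive_tR: "additive tR"
  using sR_map tR_map by (simp_all add: algebra_map_def anti_algebra_map_def k_linear_def)

lemmas additive_\<gamma>R [additive_intros] = R.additive_comult
lemmas additive_sR' [additive_intros] = additive_compose[OF additive_sR]
lemmas additive_tR' [additive_intros] = additive_compose[OF additive_tR]
lemmas additive_\<pi>R [additive_intros] = additive_compose[OF R.additive_counit]

lemma \<pi>R_tR_right: "\<pi>R (h * tR r) = r * \<pi>R h" and \<pi>R_sR_right: "\<pi>R (h * sR r) = \<pi>R h * r"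
  by (rule R.counit_la R.counit_ra)+

lemma \<pi>R_sR_id [simp]: "\<pi>R (sR r) = r"
  using \<pi>R_sR_right[of 1 r] \<pi>R_one by simp

lemma \<gamma>R_takeuchi':
  "balR \<beta> \<Longrightarrow> sweedler (\<gamma>R h) (\<lambda>x y. \<beta> (sR r * x) y) = sweedler (\<gamma>R h) (\<lambda>x y. \<beta> x (tR r * y))"
  using sweedler2_elim[OF \<gamma>R_takeuchi, of \<beta>] by simp

lemma \<gamma>R_one': "balR \<beta> \<Longrightarrow> sweedler (\<gamma>R 1) \<beta> = \<beta> 1 1"
  by (rule sweedler_pure[OF \<gamma>R_one])

lemma \<gamma>R_mult':
  "balR \<beta> \<Longrightarrow> sweedler (\<gamma>R (h * h')) \<beta> =
    sweedler (\<gamma>R h) (\<lambda>x y. sweedler (\<gamma>R h') (\<lambda>x' y'. \<beta> (x * x') (y * y')))"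
  using sweedler_of_sweedler[OF \<gamma>R_mult, of \<beta> h h'] by (simp add: sweedler_hom[OF additive_frag_sum])

lemma balR_eq: "balR \<beta> \<Longrightarrow> \<beta> (x * sR r) y = \<beta> x (y * tR r)"
  by (simp add: balanced_on_def)

lemma balR_left:
  assumes \<beta>: "balR \<beta>"
  shows "balR (\<lambda>x y. \<beta> (a * x) (b * y))"
  by (rule balancedI; (intro balanced_additive1[OF \<beta>] balanced_additive2[OF \<beta>] additive_intros)?)
    (simp add: balR_eq[OF \<beta>] mult.assoc[symmetric])

lemma balR_mult:
  assumes \<beta>: "balR \<beta>"
  shows "balR (\<lambda>x y. sweedler (\<gamma>R h') (\<lambda>x' y'. \<beta> (x * x') (y * y')))"
proof (rule balancedI)
  show "sweedler (\<gamma>R h') (\<lambda>x' y'. \<beta> (x * sR r * x') (y * y')) = sweedler (\<gamma>R h') (\<lambda>x' y'. \<beta> (x * x') (y * tR r * y'))"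
    for x r y
    using \<gamma>R_takeuchi'[OF balR_left[OF \<beta>, of x y], of h' r] by (simp add: mult.assoc)
qed (intro balanced_additive1[OF \<beta>] balanced_additive2[OF \<beta>] additive_intros)+

lemma \<gamma>R_tR_right: "balR \<beta> \<Longrightarrow> sweedler (\<gamma>R (h * tR r)) \<beta> = sweedler (\<gamma>R h) (\<lambda>x y. \<beta> (x * tR r) y)"
  and \<gamma>R_sR_right: "balR \<beta> \<Longrightarrow> sweedler (\<gamma>R (h * sR r)) \<beta> = sweedler (\<gamma>R h) (\<lambda>x y. \<beta> x (y * sR r))"
  by (rule R.comult_left R.comult_right; assumption)+

lemma balR_right:
  assumes \<beta>: "balR \<beta>"
  shows "balR (\<lambda>x y. \<beta> (x * tR r) (y * sR r'))"
  by (rule balancedI; (intro balanced_additive1[OF \<beta>] balanced_additive2[OF \<beta>] additive_intros)?)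
    (metis balR_eq[OF \<beta>] mult.assoc sR_tR_commute)

lemma \<gamma>R_tR: "balR \<beta> \<Longrightarrow> sweedler (\<gamma>R (tR r)) \<beta> = \<beta> (tR r) 1"
  using \<gamma>R_tR_right[of \<beta> 1 r] \<gamma>R_one'[OF balR_right[of \<beta> r 1]] by simp

lemma \<gamma>R_sR: "balR \<beta> \<Longrightarrow> sweedler (\<gamma>R (sR r)) \<beta> = \<beta> 1 (sR r)"
  using \<gamma>R_sR_right[of \<beta> 1 r] \<gamma>R_one'[OF balR_right[of \<beta> 1 r]] by simp

lemma \<gamma>R_tR_left: "balR \<beta> \<Longrightarrow> sweedler (\<gamma>R (tR r * h)) \<beta> = sweedler (\<gamma>R h) (\<lambda>x y. \<beta> (tR r * x) y)"
  using \<gamma>R_tR[OF balR_mult[of \<beta> h], of r] by (simp add: \<gamma>R_mult')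

lemma \<gamma>R_sR_left: "balR \<beta> \<Longrightarrow> sweedler (\<gamma>R (sR r * h)) \<beta> = sweedler (\<gamma>R h) (\<lambda>x y. \<beta> x (sR r * y))"
  using \<gamma>R_sR[OF balR_mult[of \<beta> h], of r] by (simp add: \<gamma>R_mult')

end

section \<open>The antipode\<close>

context hopf_algebroid
begin

text \<open>By the axioms linking the two bialgebroids, \<open>tR r\<close> is a value of
  \<open>sL\<close> and \<open>sR r\<close> a value of \<open>tL\<close>, so the rules for the base
  \<open>L\<close> apply.\<close>

lemma \<gamma>L_tR_right: "balL \<beta> \<Longrightarrow> sweedler (\<gamma>L (h * tR r)) \<beta> = sweedler (\<gamma>L h) (\<lambda>x y. \<beta> (x * tR r) y)"
  and \<gamma>L_sR_right: "balL \<beta> \<Longrightarrow> sweedler (\<gamma>L (h * sR r)) \<beta> = sweedler (\<gamma>L h) (\<lambda>x y. \<beta> x (y * sR r))"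
  using \<gamma>L_sL_right[of \<beta> h "\<pi>L (tR r)"] \<gamma>L_tL_right[of \<beta> h "\<pi>L (sR r)"]
  by (simp_all add: sL_\<pi>L_tR tL_\<pi>L_sR)

lemma \<gamma>R_sL_left: "balR \<beta> \<Longrightarrow> sweedler (\<gamma>R (sL l * h)) \<beta> = sweedler (\<gamma>R h) (\<lambda>x y. \<beta> (sL l * x) y)"
  and \<gamma>R_tL_left: "balR \<beta> \<Longrightarrow> sweedler (\<gamma>R (tL l * h)) \<beta> = sweedler (\<gamma>R h) (\<lambda>x y. \<beta> x (tL l * y))"
  and \<gamma>R_tL_right: "balR \<beta> \<Longrightarrow> sweedler (\<gamma>R (h * tL l)) \<beta> = sweedler (\<gamma>R h) (\<lambda>x y. \<beta> x (y * tL l))"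
  using \<gamma>R_tR_left[of \<beta> "\<pi>R (sL l)" h]
    \<gamma>R_sR_left[of \<beta> "\<pi>R (tL l)" h] \<gamma>R_sR_right[of \<beta> h "\<pi>R (tL l)"]
  by (simp_all add: sR_\<pi>R_tL tR_\<pi>R_sL)

lemma mixed_LR:
  "balanced3 UNIV (\<lambda>h l. tL l * h) (\<lambda>l h. sL l * h) UNIV (\<lambda>h r. h * sR r) (\<lambda>r h. h * tR r) \<tau> \<Longrightarrow>
    sweedler (\<gamma>R h) (\<lambda>x y. sweedler (\<gamma>L x) (\<lambda>x1 x2. \<tau> x1 x2 y))
    = sweedler (\<gamma>L h) (\<lambda>x y. sweedler (\<gamma>R y) (\<lambda>y1 y2. \<tau> x y1 y2))"
  using sweedler3_elim[OF mixed_coassoc_LR[of h], of \<tau>] by simp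

lemma mixed_RL:
  "balanced3 UNIV (\<lambda>h r. h * sR r) (\<lambda>r h. h * tR r) UNIV (\<lambda>h l. tL l * h) (\<lambda>l h. sL l * h) \<tau> \<Longrightarrow>
    sweedler (\<gamma>L h) (\<lambda>x y. sweedler (\<gamma>R x) (\<lambda>x1 x2. \<tau> x1 x2 y))
    = sweedler (\<gamma>R h) (\<lambda>x y. sweedler (\<gamma>L y) (\<lambda>y1 y2. \<tau> x y1 y2))"
  using sweedler3_elim[OF mixed_coassoc_RL[of h], of \<tau>] by simp

lemma additive_S: "additive S"
  using S_k_linear by (simp add: k_linear_def)

lemmas additive_S' [additive_intros] = additive_compose[OF additive_S]

lemma S_tL_left: "S (tL l * h) = S h * sL l" and S_tR_right: "S (h * tR r) = sR r * S h"
  and S_tR_left: "S (tR r * h) = S h * sR r" and S_tL_right: "S (h * tL l) = sL l * S h"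
  using S_tL_tR[of l h 1] S_tL_tR[of 1 h r] S_tR_tL[of r h 1] S_tR_tL[of 1 h l] by simp_all

lemma S_one: "S 1 = 1"
proof -
  have "balL (\<lambda>x y. S x * y)"
    by (rule balancedI; (intro additive_intros)?) (simp add: S_tL_left mult.assoc)
  from \<gamma>L_one'[OF this] antipode_L[of 1] show ?thesis
    by (simp add: \<pi>R_one)
qed

text \<open>This says that \<open>(g, h) \<mapsto> S h * S g\<close> is a right convolution inverse
  of the multiplication. The sum over \<open>h\<close> collapses to \<open>sL (\<pi>L h)\<close>,
  which is absorbed into the argument of the outer antipode as \<open>tL (\<pi>L h)\<close>.\<close>

lemma antipode_R_mult:
  "sweedler (\<gamma>R g) (\<lambda>g1 g2. sweedler (\<gamma>R h) (\<lambda>h1 h2. g1 * h1 * S h2 * S g2)) = sL (\<pi>L (g * h))"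
proof -
  have bal: "balR (\<lambda>x y. x * S y)"
    by (rule balancedI; (intro additive_intros)?) (simp add: S_tR_right mult.assoc)
  have "sweedler (\<gamma>R h) (\<lambda>h1 h2. g1 * h1 * S h2 * S g2) = g1 * S (g2 * tL (\<pi>L h))" for g1 g2
  proof -
    have "sweedler (\<gamma>R h) (\<lambda>h1 h2. g1 * h1 * S h2 * S g2) = g1 * sweedler (\<gamma>R h) (\<lambda>h1 h2. h1 * S h2) * S g2"
      by (simp add: sweedler_mult_left sweedler_mult_right mult.assoc)
    then show ?thesis
      by (simp add: antipode_R S_tL_right mult.assoc)
  qed
  then have "sweedler (\<gamma>R g) (\<lambda>g1 g2. sweedler (\<gamma>R h) (\<lambda>h1 h2. g1 * h1 * S h2 * S g2))
    = sweedler (\<gamma>R (g * tL (\<pi>L h))) (\<lambda>x y. x * S y)"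
    by (simp add: \<gamma>R_tL_right[OF bal])
  then show ?thesis
    by (simp add: antipode_R \<pi>L_tL)
qed

text \<open>The Takeuchi condition moves \<open>sR r\<close> to the second leg as
  \<open>tR r\<close>, where \<open>S\<close> sends it to a right factor \<open>sR r\<close>. The
  left-hand side is the form in which \<open>antipode_L\<close> leaves the sums in
  \<open>S_mult\<close>.\<close>

lemma S_counit: "sweedler (\<gamma>R h) (\<lambda>h1 h2. sR (\<pi>R (sR r * h1)) * S h2) = S h * sR r"
proof -
  have bal: "balR (\<lambda>x y. sR (\<pi>R x) * S y)"
    by (rule balancedI; (intro additive_intros)?) (simp add: S_tR_right \<pi>R_sR_right sR_mult mult.assoc)
  have "sweedler (\<gamma>R h) (\<lambda>h1 h2. sR (\<pi>R (sR r * h1)) * S h2)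
    = sweedler (\<gamma>R h) (\<lambda>h1 h2. S (tR r * (h2 * tR (\<pi>R h1))))"
    using \<gamma>R_takeuchi'[OF bal, of h r] by (simp add: S_tR_right mult.assoc[symmetric])
  also have "\<dots> = S (tR r * sweedler (\<gamma>R h) (\<lambda>h1 h2. h2 * tR (\<pi>R h1)))"
    by (simp add: sweedler_hom[OF additive_S] sweedler_mult_left)
  finally show ?thesis
    by (simp add: R.counit_left S_tR_left)
qed

text \<open>
  Both sides are convolution inverse to the multiplication \<open>(g, h) \<mapsto> g h\<close>; the proof evaluates
  \<open>S(g\<^sub>1 h\<^sub>1) g\<^sub>2 h\<^sub>2 S(h\<^sub>3) S(g\<^sub>3)\<close> in two ways.
\<close>

lemma S_mult: "S (g * h) = S h * S g"
proof -
  have bal1: "balL (\<lambda>x y. S x * sL (\<pi>L y))"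
    by (rule balancedI; (intro additive_intros)?) (simp add: S_tL_left \<pi>L_sL_left sL_mult mult.assoc)
  have balS: "balL (\<lambda>x y. S x * y)"
    by (rule balancedI; (intro additive_intros)?) (simp add: S_tL_left mult.assoc)
  let ?\<sigma> = "\<lambda>u v w x y z. S (u * x) * v * y * S z * S w"
  have "S (g * h) = S (sweedler (\<gamma>L (g * h)) (\<lambda>x y. tL (\<pi>L y) * x))"
    by (simp add: L.counit_right)
  also have "\<dots> = sweedler (\<gamma>L (g * h)) (\<lambda>x y. S x * sL (\<pi>L y))"
    by (simp add: sweedler_hom[OF additive_S] S_tL_left)
  also have "\<dots> = sweedler (\<gamma>L g) (\<lambda>x y. sweedler (\<gamma>L h) (\<lambda>x' y'. S (x * x') * sL (\<pi>L (y * y'))))"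
    by (rule \<gamma>L_mult'[OF bal1])
  also have "\<dots> = sweedler (\<gamma>L g) (\<lambda>x y. sweedler (\<gamma>L h) (\<lambda>x' y'.
      sweedler (\<gamma>R y) (\<lambda>y1 y2. sweedler (\<gamma>R y') (\<lambda>y1' y2'. ?\<sigma> x y1 y2 x' y1' y2'))))"
    by (simp add: antipode_R_mult[symmetric] sweedler_mult_left mult.assoc)
  also have "\<dots> = sweedler (\<gamma>L g) (\<lambda>x y. sweedler (\<gamma>R y) (\<lambda>y1 y2.
      sweedler (\<gamma>L h) (\<lambda>x' y'. sweedler (\<gamma>R y') (\<lambda>y1' y2'. ?\<sigma> x y1 y2 x' y1' y2'))))"
    by (rule sweedler_cong, rule sweedler_swap)
  also have "\<dots> = sweedler (\<gamma>R g) (\<lambda>x y. sweedler (\<gamma>L x) (\<lambda>x1 x2.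
      sweedler (\<gamma>L h) (\<lambda>x' y'. sweedler (\<gamma>R y') (\<lambda>y1' y2'. ?\<sigma> x1 x2 y x' y1' y2'))))"
  proof (rule mixed_LR[symmetric], rule balanced3I; (intro additive_intros)?)
    fix u v w l
    show "sweedler (\<gamma>L h) (\<lambda>x' y'. sweedler (\<gamma>R y') (\<lambda>y1' y2'. ?\<sigma> (tL l * u) v w x' y1' y2'))
      = sweedler (\<gamma>L h) (\<lambda>x' y'. sweedler (\<gamma>R y') (\<lambda>y1' y2'. ?\<sigma> u (sL l * v) w x' y1' y2'))"
      by (simp add: mult.assoc S_tL_left)
  next
    fix u v w r
    \<comment> \<open>Here \<open>sR r\<close> precedes \<open>y1'\<close> while
      \<open>S (w * tR r)\<close> places it after \<open>S y2'\<close>. The two agree only under the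
      sum over \<open>\<gamma>R y'\<close>, by its Takeuchi condition.\<close>
    have bal: "balR (\<lambda>a b. S (u * x') * v * a * S b * S w)" for x'
      by (rule balancedI; (intro additive_intros)?) (simp add: S_tR_right mult.assoc)
    show "sweedler (\<gamma>L h) (\<lambda>x' y'. sweedler (\<gamma>R y') (\<lambda>y1' y2'. ?\<sigma> u (v * sR r) w x' y1' y2'))
      = sweedler (\<gamma>L h) (\<lambda>x' y'. sweedler (\<gamma>R y') (\<lambda>y1' y2'. ?\<sigma> u v (w * tR r) x' y1' y2'))"
      using \<gamma>R_takeuchi'[OF bal, where r = r] by (simp add: mult.assoc S_tR_left S_tR_right)
  qed
  also have "\<dots> = sweedler (\<gamma>R g) (\<lambda>x y. sweedler (\<gamma>L h) (\<lambda>x' y'.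
      sweedler (\<gamma>L x) (\<lambda>x1 x2. sweedler (\<gamma>R y') (\<lambda>y1' y2'. ?\<sigma> x1 x2 y x' y1' y2'))))"
    by (rule sweedler_cong, rule sweedler_swap)
  also have "\<dots> = sweedler (\<gamma>R g) (\<lambda>x y. sweedler (\<gamma>L h) (\<lambda>x' y'.
      sweedler (\<gamma>R y') (\<lambda>y1' y2'. sweedler (\<gamma>L x) (\<lambda>x1 x2. ?\<sigma> x1 x2 y x' y1' y2'))))"
    by (rule sweedler_cong, rule sweedler_cong, rule sweedler_swap)
  also have "\<dots> = sweedler (\<gamma>R g) (\<lambda>x y. sweedler (\<gamma>R h) (\<lambda>x' y'.
      sweedler (\<gamma>L x') (\<lambda>x1' x2'. sweedler (\<gamma>L x) (\<lambda>x1 x2. ?\<sigma> x1 x2 y x1' x2' y'))))"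
  proof (rule sweedler_cong, rule mixed_LR[symmetric], rule balanced3I; (intro additive_intros)?)
    fix g1 g2 x y z l
    have bal: "balL (\<lambda>a b. S (a * x) * b * y * S z * S g2)"
      by (rule balancedI; (intro additive_intros)?) (simp add: S_tL_left mult.assoc)
    show "sweedler (\<gamma>L g1) (\<lambda>a b. ?\<sigma> a b g2 (tL l * x) y z) = sweedler (\<gamma>L g1) (\<lambda>a b. ?\<sigma> a b g2 x (sL l * y) z)"
      using \<gamma>L_takeuchi'[OF bal, where l = l] by (simp add: mult.assoc)
  qed (simp add: S_tR_right mult.assoc)
  also have "\<dots> = sweedler (\<gamma>R g) (\<lambda>x y. sweedler (\<gamma>R h) (\<lambda>x' y'.
      sweedler (\<gamma>L (x * x')) (\<lambda>u v. S u * v) * S y' * S y))"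
    by (simp add: \<gamma>L_mult_swap[OF balS] sweedler_mult_right mult.assoc)
  \<comment> \<open>Rewriting \<open>\<pi>R (x * x')\<close> as
    \<open>\<pi>R (sR (\<pi>R x) * x')\<close> makes \<open>S_counit\<close> applicable with
    \<open>r = \<pi>R x\<close>; the case \<open>r = 1\<close> then finishes the sum over
    \<open>g\<close>.\<close>
  also have "\<dots> = sweedler (\<gamma>R g) (\<lambda>x y. S h * sR (\<pi>R x) * S y)"
  proof (rule sweedler_cong)
    fix x y
    show "sweedler (\<gamma>R h) (\<lambda>x' y'. sweedler (\<gamma>L (x * x')) (\<lambda>u v. S u * v) * S y' * S y)
      = S h * sR (\<pi>R x) * S y"
      by (simp add: antipode_L S_counit[symmetric] \<pi>R_sR sweedler_mult_right)
  qed
  also have "\<dots> = S h * S g"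
    using S_counit[of g 1] by (simp add: mult.assoc sweedler_mult_left[symmetric])
  finally show ?thesis .
qed

end

section \<open>Comodule algebras and coinvariants\<close>

lemma sweedler_right_comodule_map:
  assumes "right_comodule_map la raM \<rho>M raN \<rho>N f" "balanced UNIV raN la \<beta>"
  shows "sweedler (\<rho>N (f m)) \<beta> = sweedler (\<rho>M m) (\<lambda>x y. \<beta> (f x) y)"
proof -
  from assms(1) have "\<rho>N (f m) = sweedler (\<rho>M m) (\<lambda>x y. frag_of (f x, y)) +o tensor_null UNIV UNIV UNIV raN la"
    by (simp add: right_comodule_map_def)
  from sweedler_of_sweedler[OF this assms(2)] show ?thesis by simp
qed

context right_comodule_algebra
begin

abbreviation "balAR \<equiv> balanced UNIV (\<lambda>a r. a * \<eta>R r) (\<lambda>r h. h * tR r)"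
abbreviation "balAL \<equiv> balanced UNIV (\<lambda>a l. \<eta>R (\<pi>R (tL l)) * a) (\<lambda>l h. sL l * h)"

lemma \<eta>R_mult: "\<eta>R (a * b) = \<eta>R a * \<eta>R b" and \<eta>R_one [simp]: "\<eta>R 1 = 1" and additive_\<eta>R: "additive \<eta>R"
  using \<eta>R_map by (simp_all add: algebra_map_def k_linear_def)

lemmas additive_\<eta>R' [additive_intros] = additive_compose[OF additive_\<eta>R]
lemmas additive_\<rho>R [additive_intros] = onR.additive_coact
lemmas additive_\<rho>L [additive_intros] = onL.additive_coact

text \<open>\<open>\<pi>R \<circ> tL\<close> is an anti-isomorphism from \<open>L\<close> to
  \<open>R\<close>, with inverse \<open>\<pi>L \<circ> sR\<close>. It turns the right
  \<open>L\<close>-action on \<open>A\<close> into left multiplication through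
  \<open>\<eta>R\<close>.\<close>

lemma \<pi>R_tL_mult: "\<pi>R (tL (a * b)) = \<pi>R (tL b) * \<pi>R (tL a)"
  by (metis sR_\<pi>R_tL tL_mult sR_mult \<pi>R_sR_id)

lemma sL_\<pi>L_sR_\<pi>R_tL: "sL (\<pi>L (sR (\<pi>R (tL l)))) = sL l"
  by (simp add: sR_\<pi>R_tL)

lemma balAR_eq: "balAR \<beta> \<Longrightarrow> \<beta> (a * \<eta>R r) h = \<beta> a (h * tR r)"
  by (simp add: balanced_on_def)

lemma balAL_eq: "balAL \<beta> \<Longrightarrow> \<beta> (\<eta>R (\<pi>R (tL l)) * a) h = \<beta> a (sL l * h)"
  by (simp add: balanced_on_def)

lemma \<rho>R_\<eta>R_right: "balAR \<beta> \<Longrightarrow> sweedler (\<rho>R (a * \<eta>R r)) \<beta> = sweedler (\<rho>R a) (\<lambda>x y. \<beta> x (y * sR r))"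
  by (rule onR.coact_right)

lemma \<rho>R_tL_left: "balAR \<beta> \<Longrightarrow> sweedler (\<rho>R (\<eta>R (\<pi>R (tL l)) * a)) \<beta> = sweedler (\<rho>R a) (\<lambda>x y. \<beta> x (tL l * y))"
  using sweedler_of_sweedler[OF \<rho>R_L_linear[of l a], of \<beta>] by simp

lemma \<rho>L_\<eta>R_right: "balAL \<beta> \<Longrightarrow> sweedler (\<rho>L (a * \<eta>R r)) \<beta> = sweedler (\<rho>L a) (\<lambda>x y. \<beta> x (y * sR r))"
  using sweedler_of_sweedler[OF \<rho>L_R_linear[of a r], of \<beta>] by simp

lemma \<rho>R_one': "balAR \<beta> \<Longrightarrow> sweedler (\<rho>R 1) \<beta> = \<beta> 1 1"
  by (rule sweedler_pure[OF \<rho>R_one])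

lemma \<rho>L_one': "balAL \<beta> \<Longrightarrow> sweedler (\<rho>L 1) \<beta> = \<beta> 1 1"
  by (rule sweedler_pure[OF \<rho>L_one])

lemma \<rho>R_mult':
  "balAR \<beta> \<Longrightarrow> sweedler (\<rho>R (a * a')) \<beta> =
    sweedler (\<rho>R a) (\<lambda>x y. sweedler (\<rho>R a') (\<lambda>x' y'. \<beta> (x * x') (y * y')))"
  using sweedler_of_sweedler[OF \<rho>R_mult, of \<beta> a a'] by (simp add: sweedler_hom[OF additive_frag_sum])

lemma \<rho>L_mult':
  "balAL \<beta> \<Longrightarrow> sweedler (\<rho>L (a * a')) \<beta> =
    sweedler (\<rho>L a) (\<lambda>x y. sweedler (\<rho>L a') (\<lambda>x' y'. \<beta> (x * x') (y * y')))"
  using sweedler_of_sweedler[OF \<rho>L_mult, of \<beta> a a'] by (simp add: sweedler_hom[OF additive_frag_sum])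

lemma mixed_coact_RL:
  "balanced3 UNIV (\<lambda>a r. a * \<eta>R r) (\<lambda>r h. h * tR r) UNIV (\<lambda>h l. tL l * h) (\<lambda>l h. sL l * h) \<tau> \<Longrightarrow>
    sweedler (\<rho>L a) (\<lambda>x y. sweedler (\<rho>R x) (\<lambda>x1 x2. \<tau> x1 x2 y))
    = sweedler (\<rho>R a) (\<lambda>x y. sweedler (\<gamma>L y) (\<lambda>y1 y2. \<tau> x y1 y2))"
  using sweedler3_elim[OF \<rho>_mixed_RL[of a], of \<tau>] by simp

lemma mixed_coact_LR:
  "balanced3 UNIV (\<lambda>a l. \<eta>R (\<pi>R (tL l)) * a) (\<lambda>l h. sL l * h) UNIV (\<lambda>h r. h * sR r) (\<lambda>r h. h * tR r) \<tau> \<Longrightarrow>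
    sweedler (\<rho>R a) (\<lambda>x y. sweedler (\<rho>L x) (\<lambda>x1 x2. \<tau> x1 x2 y))
    = sweedler (\<rho>L a) (\<lambda>x y. sweedler (\<gamma>R y) (\<lambda>y1 y2. \<tau> x y1 y2))"
  using sweedler3_elim[OF \<rho>_mixed_LR[of a], of \<tau>] by simp

text \<open>The left \<open>R\<close>-action is itself expressed by the coaction, so coassociativity
  carries it to the \<open>H\<close>-leg, where the counit turns it into
  \<open>tR r\<close>.\<close>

lemma \<rho>R_takeuchi:
  assumes \<beta>: "balAR \<beta>"
  shows "sweedler (\<rho>R a) (\<lambda>x y. \<beta> (\<eta>R r * x) y) = sweedler (\<rho>R a) (\<lambda>x y. \<beta> x (tR r * y))"
proof -
  let ?\<tau> = "\<lambda>x c d. \<beta> x (d * tR (\<pi>R (sR r * c)))"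
  have \<tau>: "balanced3 UNIV (\<lambda>a r. a * \<eta>R r) (\<lambda>r h. h * tR r) UNIV (\<lambda>h r. h * sR r) (\<lambda>r h. h * tR r) ?\<tau>"
    by (rule balanced3I; (intro balanced_additive1[OF \<beta>] balanced_additive2[OF \<beta>] additive_intros)?)
      (simp_all add: balAR_eq[OF \<beta>] \<pi>R_tR_right \<pi>R_sR_right tR_mult flip: mult.assoc)
  have bal: "balR (\<lambda>x y. y * tR (\<pi>R x))"
    by (rule balancedI; (intro additive_intros)?) (simp add: \<pi>R_sR_right tR_mult mult.assoc)
  have counit: "sweedler (\<gamma>R y) (\<lambda>c d. d * tR (\<pi>R (sR r * c))) = tR r * y" for y
    using \<gamma>R_takeuchi'[OF bal, of y r] R.counit_left[of y]
    by (simp add: mult.assoc sweedler_mult_left[symmetric])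
  have "sweedler (\<rho>R a) (\<lambda>x y. \<beta> (\<eta>R r * x) y)
    = sweedler (\<rho>R a) (\<lambda>x y. sweedler (\<rho>R x) (\<lambda>x1 x2. \<beta> (x1 * \<eta>R (\<pi>R (sR r * x2))) y))"
    by (simp add: left_R_action[symmetric] sweedler_hom[OF balanced_additive(1)[OF \<beta>]])
  also have "\<dots> = sweedler (\<rho>R a) (\<lambda>x y. sweedler (\<rho>R x) (\<lambda>x1 x2. ?\<tau> x1 x2 y))"
    by (simp add: balAR_eq[OF \<beta>])
  also have "\<dots> = sweedler (\<rho>R a) (\<lambda>x y. sweedler (\<gamma>R y) (\<lambda>c d. ?\<tau> x c d))"
    by (rule onR.coact_coassoc'[OF \<tau>])
  also have "\<dots> = sweedler (\<rho>R a) (\<lambda>x y. \<beta> x (tR r * y))"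
    by (simp add: sweedler_hom[OF balanced_additive(2)[OF \<beta>], symmetric] counit)
  finally show ?thesis .
qed

text \<open>The counit of \<open>\<rho>L\<close> is applied to \<open>a * \<eta>R r\<close>. For
  \<open>\<rho>L_takeuchi\<close> this formula takes the place that \<open>left_R_action\<close> has
  for \<open>\<rho>R\<close>.\<close>

lemma mult_\<eta>R: "a * \<eta>R r = sweedler (\<rho>L a) (\<lambda>x y. \<eta>R (\<pi>R (tL (\<pi>L (y * sL (\<pi>L (sR r)))))) * x)"
proof -
  have bal: "balAL (\<lambda>x y. \<eta>R (\<pi>R (tL (\<pi>L y))) * x)"
    by (rule balancedI; (intro additive_intros)?)
      (simp add: \<pi>L_sL_left \<pi>R_tL_mult \<eta>R_mult mult.assoc)
  have "a * \<eta>R r = sweedler (\<rho>L (a * \<eta>R r)) (\<lambda>x y. \<eta>R (\<pi>R (tL (\<pi>L y))) * x)"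
    by (simp add: onL.coact_counit)
  then show ?thesis
    by (simp add: \<rho>L_\<eta>R_right[OF bal] \<pi>L_right tL_\<pi>L_sR)
qed

lemma \<rho>L_takeuchi:
  assumes \<beta>: "balAL \<beta>"
  shows "sweedler (\<rho>L a) (\<lambda>x y. \<beta> (x * \<eta>R r) y) = sweedler (\<rho>L a) (\<lambda>x y. \<beta> x (y * sL (\<pi>L (sR r))))"
proof -
  define l where "l = \<pi>L (sR r)"
  let ?\<tau> = "\<lambda>x c d. \<beta> x (sL (\<pi>L (c * sL l)) * d)"
  have \<tau>: "balanced3 UNIV (\<lambda>a l. \<eta>R (\<pi>R (tL l)) * a) (\<lambda>l h. sL l * h) UNIV (\<lambda>h l. tL l * h) (\<lambda>l h. sL l * h) ?\<tau>"
    by (rule balanced3I; (intro balanced_additive1[OF \<beta>] balanced_additive2[OF \<beta>] additive_intros)?)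
      (simp_all add: balAL_eq[OF \<beta>] \<pi>L_sL_left \<pi>L_tL_left sL_mult mult.assoc)
  have bal: "balL (\<lambda>x y. sL (\<pi>L x) * y)"
    by (rule balancedI; (intro additive_intros)?) (simp add: \<pi>L_tL_left sL_mult mult.assoc)
  have counit: "sweedler (\<gamma>L y) (\<lambda>c d. sL (\<pi>L (c * sL l)) * d) = y * sL l" for y
    using \<gamma>L_takeuchi'[OF bal, of y l] L.counit_left[of y]
    by (simp add: \<pi>L_right mult.assoc[symmetric] sweedler_mult_right[symmetric])
  have "sweedler (\<rho>L a) (\<lambda>x y. \<beta> (x * \<eta>R r) y)
    = sweedler (\<rho>L a) (\<lambda>x y. sweedler (\<rho>L x) (\<lambda>x1 x2. \<beta> (\<eta>R (\<pi>R (tL (\<pi>L (x2 * sL l)))) * x1) y))"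
    by (simp add: mult_\<eta>R l_def sweedler_hom[OF balanced_additive(1)[OF \<beta>]])
  also have "\<dots> = sweedler (\<rho>L a) (\<lambda>x y. sweedler (\<rho>L x) (\<lambda>x1 x2. ?\<tau> x1 x2 y))"
    by (simp add: balAL_eq[OF \<beta>])
  also have "\<dots> = sweedler (\<rho>L a) (\<lambda>x y. sweedler (\<gamma>L y) (\<lambda>c d. ?\<tau> x c d))"
    by (rule onL.coact_coassoc'[OF \<tau>])
  also have "\<dots> = sweedler (\<rho>L a) (\<lambda>x y. \<beta> x (y * sL l))"
    by (simp add: sweedler_hom[OF balanced_additive(2)[OF \<beta>], symmetric] counit)
  finally show ?thesis by (simp add: l_def)
qed

lemma balAR_left:
  assumes \<beta>: "balAR \<beta>"
  shows "balAR (\<lambda>x y. \<beta> (a * x) (h * y))"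
  by (rule balancedI; (intro balanced_additive1[OF \<beta>] balanced_additive2[OF \<beta>] additive_intros)?)
    (simp add: balAR_eq[OF \<beta>] mult.assoc[symmetric])

lemma balAR_mult:
  assumes \<beta>: "balAR \<beta>"
  shows "balAR (\<lambda>x y. sweedler (\<rho>R a) (\<lambda>x' y'. \<beta> (x * x') (y * y')))"
proof (rule balancedI)
  show "sweedler (\<rho>R a) (\<lambda>x' y'. \<beta> (x * \<eta>R r * x') (y * y')) = sweedler (\<rho>R a) (\<lambda>x' y'. \<beta> (x * x') (y * tR r * y'))"
    for x r y
    using \<rho>R_takeuchi[OF balAR_left[OF \<beta>, of x y], of a r] by (simp add: mult.assoc)
qed (intro balanced_additive1[OF \<beta>] balanced_additive2[OF \<beta>] additive_intros)+

lemma balAL_right: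
  assumes \<beta>: "balAL \<beta>"
  shows "balAL (\<lambda>x y. \<beta> (x * a) (y * h))"
  by (rule balancedI; (intro balanced_additive1[OF \<beta>] balanced_additive2[OF \<beta>] additive_intros)?)
    (simp add: balAL_eq[OF \<beta>] mult.assoc)

lemma balAL_mult:
  assumes \<beta>: "balAL \<beta>"
  shows "balAL (\<lambda>x' y'. sweedler (\<rho>L a) (\<lambda>x y. \<beta> (x * x') (y * y')))"
proof (rule balancedI)
  show "sweedler (\<rho>L a) (\<lambda>x y. \<beta> (x * (\<eta>R (\<pi>R (tL l)) * x')) (y * y'))
      = sweedler (\<rho>L a) (\<lambda>x y. \<beta> (x * x') (y * (sL l * y')))"
    for x' l y'
    using \<rho>L_takeuchi[OF balAL_right[OF \<beta>, of x' y'], of a "\<pi>R (tL l)"]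
    by (simp add: mult.assoc sL_\<pi>L_sR_\<pi>R_tL)
qed (intro balanced_additive1[OF \<beta>] balanced_additive2[OF \<beta>] additive_intros)+

section \<open>Coinvariant elements\<close>

definition coinvariant :: "'a \<Rightarrow> bool" where
  "coinvariant b \<longleftrightarrow> \<rho>R b = frag_of (b, 1) +o tensor_null UNIV UNIV UNIV (\<lambda>a r. a * \<eta>R r) (\<lambda>r h. h * tR r)"

lemma \<rho>R_coinvariant: "coinvariant b \<Longrightarrow> balAR \<beta> \<Longrightarrow> sweedler (\<rho>R b) \<beta> = \<beta> b 1"
  unfolding coinvariant_def by (rule sweedler_pure)

lemma coinvariantI:
  fixes b :: 'a
  assumes "\<And>\<beta> :: 'a \<Rightarrow> 'h \<Rightarrow> (('a \<times> 'h) \<Rightarrow>\<^sub>0 int) quotients. balAR \<beta> \<Longrightarrow> sweedler (\<rho>R b) \<beta> = \<beta> b 1"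
  shows "coinvariant b"
  unfolding coinvariant_def
proof (rule tensor_eqI)
  let ?N = "tensor_null UNIV UNIV UNIV (\<lambda>a r. a * \<eta>R r) (\<lambda>r h. h * tR r)"
  let ?p = "pure_tensor UNIV UNIV UNIV (\<lambda>a r. a * \<eta>R r) (\<lambda>r h. h * tR r)"
  show "sweedler (\<rho>R b) ?p = sweedler (frag_of (b, 1) +o ?N) ?p"
    by (simp add: assms[OF balanced_pure_tensor] sweedler_pure[OF refl balanced_pure_tensor])
qed (simp_all add: onR.coact_in coset_in_tensor)

text \<open>The left action of \<open>R\<close> is read off from \<open>\<rho>R\<close>; on
  \<open>b \<otimes> 1\<close> the formula \<open>left_R_action\<close> yields right multiplication
  by \<open>\<eta>R r\<close>.\<close>

lemma coinvariant_commute: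
  assumes "coinvariant b"
  shows "b * \<eta>R r = \<eta>R r * b"
proof -
  have "balAR (\<lambda>x y. x * \<eta>R (\<pi>R (sR r * y)))"
    by (rule balancedI; (intro additive_intros)?)
      (simp add: \<pi>R_tR_right \<eta>R_mult flip: mult.assoc)
  from \<rho>R_coinvariant[OF assms this] left_R_action[of b r] show ?thesis
    by simp
qed

text \<open>
  The map \<open>A \<otimes>\<^sub>R H \<rightarrow> A \<otimes>\<^sub>L H\<close>, \<open>a \<otimes> h \<mapsto> a\<^sub>[\<^sub>0\<^sub>] \<otimes> a\<^sub>[\<^sub>1\<^sub>] S(h)\<close> takes \<open>\<rho>R b\<close> to \<open>b \<otimes> 1\<close>
  and \<open>b \<otimes> 1\<close> to \<open>\<rho>L b\<close>.
\<close>

lemma \<rho>L_coinvariant: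
  assumes b: "coinvariant b" and \<beta>: "balAL \<beta>"
  shows "sweedler (\<rho>L b) \<beta> = \<beta> b 1"
proof -
  let ?\<tau> = "\<lambda>x y z. \<beta> x (y * S z)"
  have bal: "balAL (\<lambda>x y. \<beta> x (y * c))" for c
    using balAL_right[OF \<beta>, of 1 c] by simp
  have \<tau>: "balanced3 UNIV (\<lambda>a l. \<eta>R (\<pi>R (tL l)) * a) (\<lambda>l h. sL l * h) UNIV (\<lambda>h r. h * sR r) (\<lambda>r h. h * tR r) ?\<tau>"
    by (rule balanced3I; (intro balanced_additive1[OF \<beta>] balanced_additive2[OF \<beta>] additive_intros)?)
      (simp_all add: balAL_eq[OF \<beta>] S_tR_right mult.assoc)
  have "balAR (\<lambda>b0 b1. sweedler (\<rho>L b0) (\<lambda>x y. ?\<tau> x y b1))"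
    by (rule balancedI; (intro balanced_additive2[OF \<beta>] bal additive_intros)?)
      (simp add: \<rho>L_\<eta>R_right[OF bal] S_tR_right mult.assoc)
  from \<rho>R_coinvariant[OF b this]
  have "sweedler (\<rho>L b) \<beta> = sweedler (\<rho>R b) (\<lambda>b0 b1. sweedler (\<rho>L b0) (\<lambda>x y. ?\<tau> x y b1))"
    by (simp add: S_one)
  also have "\<dots> = sweedler (\<rho>L b) (\<lambda>x y. sweedler (\<gamma>R y) (\<lambda>y1 y2. ?\<tau> x y1 y2))"
    by (rule mixed_coact_LR[OF \<tau>])
  also have "\<dots> = sweedler (\<rho>L b) (\<lambda>x y. \<beta> (\<eta>R (\<pi>R (tL (\<pi>L y))) * x) 1)"
    by (simp add: sweedler_hom[OF balanced_additive(2)[OF \<beta>], symmetric] antipode_R balAL_eq[OF \<beta>])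
  also have "\<dots> = \<beta> b 1"
    by (simp add: sweedler_hom[OF balanced_additive(1)[OF \<beta>], symmetric] onL.coact_counit)
  finally show ?thesis .
qed

lemma \<rho>R_mult_coinvariant_left:
  assumes "coinvariant b" and \<beta>: "balAR \<beta>"
  shows "sweedler (\<rho>R (b * a)) \<beta> = sweedler (\<rho>R a) (\<lambda>x y. \<beta> (b * x) y)"
  using \<rho>R_coinvariant[OF assms(1) balAR_mult[OF \<beta>]] by (simp add: \<rho>R_mult'[OF \<beta>])

lemma \<rho>R_mult_coinvariant_right:
  assumes "coinvariant b" and \<beta>: "balAR \<beta>"
  shows "sweedler (\<rho>R (a * b)) \<beta> = sweedler (\<rho>R a) (\<lambda>x y. \<beta> (x * b) y)"
  using \<rho>R_coinvariant[OF assms(1) balAR_left[OF \<beta>]] by (simp add: \<rho>R_mult'[OF \<beta>])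

lemma \<rho>L_mult_swap:
  "balAL \<beta> \<Longrightarrow> sweedler (\<rho>L (a * a')) \<beta> =
    sweedler (\<rho>L a') (\<lambda>x' y'. sweedler (\<rho>L a) (\<lambda>x y. \<beta> (x * x') (y * y')))"
  by (subst \<rho>L_mult', assumption) (rule sweedler_swap)

lemma \<rho>L_mult_coinvariant_right:
  assumes "coinvariant b" and \<beta>: "balAL \<beta>"
  shows "sweedler (\<rho>L (a * b)) \<beta> = sweedler (\<rho>L a) (\<lambda>x y. \<beta> (x * b) y)"
  using \<rho>L_coinvariant[OF assms(1) balAL_mult[OF \<beta>, of a]] by (simp add: \<rho>L_mult_swap[OF \<beta>])

end

section \<open>The convolution inverse of a cleaving map\<close>

text \<open>Here \<open>j\<close> and \<open>jc\<close> are fixed and \<open>B\<close> appears only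
  through coinvariance. The locale can thus also be instantiated with \<open>H\<close> itself, the
  identity and \<open>S\<close>.\<close>

locale cleaving_pair =
  right_comodule_algebra kH kL sL tL \<gamma>L \<pi>L kR sR tR \<gamma>R \<pi>R S kA \<eta>R \<rho>R \<rho>L
  for kH :: "'k::{comm_ring,comm_monoid_mult} \<Rightarrow> 'h::{ring,monoid_mult} \<Rightarrow> 'h"
    and kL :: "'k \<Rightarrow> 'l::{ring,monoid_mult} \<Rightarrow> 'l"
    and sL :: "'l \<Rightarrow> 'h" and tL :: "'l \<Rightarrow> 'h"
    and \<gamma>L :: "'h \<Rightarrow> ('h, 'h) tensor" and \<pi>L :: "'h \<Rightarrow> 'l"
    and kR :: "'k \<Rightarrow> 'r::{ring,monoid_mult} \<Rightarrow> 'r"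
    and sR :: "'r \<Rightarrow> 'h" and tR :: "'r \<Rightarrow> 'h"
    and \<gamma>R :: "'h \<Rightarrow> ('h, 'h) tensor" and \<pi>R :: "'h \<Rightarrow> 'r"
    and S :: "'h \<Rightarrow> 'h"
    and kA :: "'k \<Rightarrow> 'a::{ring,monoid_mult} \<Rightarrow> 'a"
    and \<eta>R :: "'r \<Rightarrow> 'a"
    and \<rho>R :: "'a \<Rightarrow> ('a, 'h) tensor" and \<rho>L :: "'a \<Rightarrow> ('a, 'h) tensor" +
  fixes \<eta>L :: "'l \<Rightarrow> 'a" and j jc :: "'h \<Rightarrow> 'a"
  assumes \<eta>L_map: "algebra_map kL kA \<eta>L"
    and \<eta>L_coinvariant: "coinvariant (\<eta>L l)"
    and j_sL_left: "j (sL l * h) = \<eta>L l * j h"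
    and j_colinear_R: "right_comodule_map (\<lambda>r h. h * tR r) (\<lambda>h r. h * sR r) \<gamma>R (\<lambda>a r. a * \<eta>R r) \<rho>R j"
    and j_colinear_L:
      "right_comodule_map (\<lambda>l h. sL l * h) (\<lambda>h l. tL l * h) \<gamma>L (\<lambda>a l. \<eta>R (\<pi>R (tL l)) * a) \<rho>L j"
    and jc_k_linear: "k_linear kH kA jc"
    and jc_tL_tR: "jc (tL l * h * tR r) = \<eta>R r * jc h * \<eta>L l"
    and conv_R: "sweedler (\<gamma>R h) (\<lambda>h1 h2. j h1 * jc h2) = \<eta>L (\<pi>L h)"
    and conv_L: "sweedler (\<gamma>L h) (\<lambda>h1 h2. jc h1 * j h2) = \<eta>R (\<pi>R h)"
begin

lemma \<eta>L_one [simp]: "\<eta>L 1 = 1"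
  using \<eta>L_map by (simp add: algebra_map_def)

lemma additive_j: "additive j" and additive_jc: "additive jc"
  using j_colinear_R jc_k_linear by (simp_all add: right_comodule_map_def k_linear_def)

lemmas additive_j' [additive_intros] = additive_j additive_compose[OF additive_j]
lemmas additive_jc' [additive_intros] = additive_jc additive_compose[OF additive_jc]

lemma j_sR_right: "j (h * sR r) = j h * \<eta>R r" and j_tL_left: "j (tL l * h) = \<eta>R (\<pi>R (tL l)) * j h"
  using j_colinear_R j_colinear_L by (simp_all add: right_comodule_map_def)

lemma j_sR_left: "j (sR r * h) = \<eta>R r * j h"
  using j_tL_left[of "\<pi>L (sR r)" h] by (simp add: tL_\<pi>L_sR)

lemma jc_tL_left: "jc (tL l * h) = jc h * \<eta>L l" and jc_tR_right: "jc (h * tR r) = \<eta>R r * jc h"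
  using jc_tL_tR[of l h 1] jc_tL_tR[of 1 h r] by simp_all

lemma \<rho>R_j: "balAR \<beta> \<Longrightarrow> sweedler (\<rho>R (j h)) \<beta> = sweedler (\<gamma>R h) (\<lambda>x y. \<beta> (j x) y)"
  and \<rho>L_j: "balAL \<beta> \<Longrightarrow> sweedler (\<rho>L (j h)) \<beta> = sweedler (\<gamma>L h) (\<lambda>x y. \<beta> (j x) y)"
  by (rule sweedler_right_comodule_map[OF j_colinear_R] sweedler_right_comodule_map[OF j_colinear_L]; assumption)+

text \<open>Mixed coassociativity brings the arguments of \<open>jc\<close> and \<open>j\<close>
  together as legs of one \<open>\<gamma>L\<close>. Their product \<open>\<eta>R (\<pi>R x)\<close>
  then crosses to the remaining leg by balancing and is removed by the counit.\<close>

lemma conv_cancel: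
  assumes add: "\<And>h. additive (\<lambda>a. \<Omega> a h)" "\<And>a. additive (\<Omega> a)"
    and bal: "\<And>a h r. \<Omega> a (h * tR r) = \<Omega> (a * \<eta>R r) h"
  shows "sweedler (\<gamma>L h) (\<lambda>x y. sweedler (\<gamma>R y) (\<lambda>y1 y2. \<Omega> (jc x * j y1) y2)) = \<Omega> 1 h"
proof -
  note additive_\<Omega> = additive_compose[OF add(1)] additive_compose[OF add(2)]
  have "sweedler (\<gamma>L h) (\<lambda>x y. sweedler (\<gamma>R y) (\<lambda>y1 y2. \<Omega> (jc x * j y1) y2))
    = sweedler (\<gamma>R h) (\<lambda>x y. sweedler (\<gamma>L x) (\<lambda>x1 x2. \<Omega> (jc x1 * j x2) y))"
    by (rule mixed_LR[symmetric], rule balanced3I; (intro additive_\<Omega> add additive_intros)?)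
      (simp_all add: bal jc_tL_left j_sL_left j_sR_right mult.assoc)
  also have "\<dots> = sweedler (\<gamma>R h) (\<lambda>x y. \<Omega> 1 (y * tR (\<pi>R x)))"
    by (simp add: sweedler_hom[OF add(1), symmetric] conv_L bal)
  also have "\<dots> = \<Omega> 1 h"
    by (simp add: sweedler_hom[OF add(2), symmetric] R.counit_left)
  finally show ?thesis .
qed

text \<open>The mirror image, with the spectator leg on the left; it cancels factors on the
  right-hand side of a connection.\<close>

lemma conv_cancel':
  assumes add: "\<And>a. additive (\<lambda>h. \<Omega> h a)" "\<And>h. additive (\<Omega> h)"
    and bal: "\<And>a h r. \<Omega> (h * sR r) a = \<Omega> h (\<eta>R r * a)"
  shows "sweedler (\<gamma>L h) (\<lambda>x y. sweedler (\<gamma>R x) (\<lambda>x1 x2. \<Omega> x1 (jc x2 * j y))) = \<Omega> h 1"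
proof -
  note additive_\<Omega> = additive_compose[OF add(1)] additive_compose[OF add(2)]
  have "sweedler (\<gamma>L h) (\<lambda>x y. sweedler (\<gamma>R x) (\<lambda>x1 x2. \<Omega> x1 (jc x2 * j y)))
    = sweedler (\<gamma>R h) (\<lambda>x y. sweedler (\<gamma>L y) (\<lambda>y1 y2. \<Omega> x (jc y1 * j y2)))"
    by (rule mixed_RL, rule balanced3I; (intro additive_\<Omega> add additive_intros)?)
      (simp_all add: bal jc_tL_left jc_tR_right j_sL_left mult.assoc)
  also have "\<dots> = sweedler (\<gamma>R h) (\<lambda>x y. \<Omega> (x * sR (\<pi>R y)) 1)"
    by (simp add: sweedler_hom[OF add(2), symmetric] conv_L bal)
  also have "\<dots> = \<Omega> h 1"
    by (simp add: sweedler_hom[OF add(1), symmetric] R.counit_right)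
  finally show ?thesis .
qed

text \<open>It creates a factor \<open>\<eta>L (\<pi>L y)\<close>, which \<open>conv_R\<close>
  expands into \<open>j\<close> and \<open>jc\<close>: the opening move of the uniqueness arguments
  below.\<close>

lemma jc_counit: "sweedler (\<gamma>L h) (\<lambda>x y. jc x * \<eta>L (\<pi>L y)) = jc h"
  using L.counit_right[of h] sweedler_hom[OF additive_jc, of "\<gamma>L h" "\<lambda>x y. tL (\<pi>L y) * x"]
  by (simp add: jc_tL_left)

text \<open>The axioms for \<open>jc\<close> control \<open>tR\<close> only on the right. Expanding
  \<open>\<eta>L (\<pi>L y)\<close>, which commutes with \<open>\<eta>R r\<close> by coinvariance,
  exposes a factor \<open>j\<close> taking in \<open>sR r\<close>; Takeuchi passes it on to
  \<open>jc\<close> as \<open>tR r\<close>.\<close>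

lemma jc_tR_left: "jc (tR r * h) = jc h * \<eta>R r"
proof -
  have bal: "balR (\<lambda>x y. a * j x * jc y)" for a
    by (rule balancedI; (intro additive_intros)?) (simp add: j_sR_right jc_tR_right mult.assoc)
  have "jc h * \<eta>R r = sweedler (\<gamma>L h) (\<lambda>x y. jc x * \<eta>L (\<pi>L y) * \<eta>R r)"
    by (simp only: sweedler_mult_right[symmetric] jc_counit)
  also have "\<dots> = sweedler (\<gamma>L h) (\<lambda>x y. jc x * (\<eta>R r * sweedler (\<gamma>R y) (\<lambda>y1 y2. j y1 * jc y2)))"
    by (simp add: mult.assoc coinvariant_commute[OF \<eta>L_coinvariant] conv_R)
  also have "\<dots> = sweedler (\<gamma>L h) (\<lambda>x y. sweedler (\<gamma>R y) (\<lambda>y1 y2. jc x * j (sR r * y1) * jc y2))"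
    by (simp add: sweedler_mult_left j_sR_left mult.assoc)
  also have "\<dots> = sweedler (\<gamma>L h) (\<lambda>x y. sweedler (\<gamma>R y) (\<lambda>y1 y2. jc x * j y1 * jc (tR r * y2)))"
    by (simp only: \<gamma>R_takeuchi'[OF bal])
  also have "\<dots> = 1 * jc (tR r * h)"
    by (rule conv_cancel; (intro additive_intros)?) (simp add: jc_tR_right mult.assoc[symmetric])
  finally show ?thesis by simp
qed

lemma jc_sL_left: "jc (sL l * h) = jc h * \<eta>R (\<pi>R (sL l))"
  using jc_tR_left[of "\<pi>R (sL l)" h] by (simp add: tR_\<pi>R_sL)

section \<open>The coactions evaluated on \<open>jc\<close>\<close>

lemma balL_jc_S:
  assumes \<beta>: "balAR \<beta>"
  shows "balL (\<lambda>u v. \<beta> (a * jc v) (g * S u))"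
  by (rule balancedI; (intro balanced_additive1[OF \<beta>] balanced_additive2[OF \<beta>] additive_intros)?)
    (simp add: jc_sL_left S_tL_left mult.assoc[symmetric] balAR_eq[OF \<beta>] tR_\<pi>R_sL)

text \<open>The candidate \<open>jc h\<^sub>2 \<otimes> S h\<^sub>1\<close> for the coaction on
  \<open>jc h\<close> obeys the Takeuchi condition, so other elements of A \<otimes> H over
  \<open>R\<close> may be multiplied by it from the right.\<close>

lemma balAR_jc_S:
  assumes \<beta>: "balAR \<beta>"
  shows "balAR (\<lambda>a g. sweedler (\<gamma>L h) (\<lambda>u v. \<beta> (a * jc v) (g * S u)))"
proof (rule balancedI)
  fix a r g
  have "\<beta> (a * jc (v * tR r)) (g * S u) = \<beta> (a * \<eta>R r * jc v) (g * S u)"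
    "\<beta> (a * jc v) (g * S (u * tL (\<pi>L (tR r)))) = \<beta> (a * jc v) (g * tR r * S u)" for u v
    by (simp_all add: jc_tR_right S_tL_right sL_\<pi>L_tR mult.assoc)
  then show "sweedler (\<gamma>L h) (\<lambda>u v. \<beta> (a * \<eta>R r * jc v) (g * S u))
      = sweedler (\<gamma>L h) (\<lambda>u v. \<beta> (a * jc v) (g * tR r * S u))"
    using \<gamma>L_takeuchi'[OF balL_jc_S[OF \<beta>, of a g], of h "\<pi>L (tR r)"] by (simp add: sL_\<pi>L_tR)
qed (intro balanced_additive1[OF \<beta>] balanced_additive2[OF \<beta>] additive_intros)+

lemma jc_S_tR_right:
  assumes \<beta>: "balAR \<beta>"
  shows "sweedler (\<gamma>L (h * tR r)) (\<lambda>u v. \<beta> (a * jc v) (g * S u))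
    = sweedler (\<gamma>L h) (\<lambda>u v. \<beta> (a * jc v) (g * sR r * S u))"
  by (simp add: \<gamma>L_tR_right[OF balL_jc_S[OF \<beta>]] S_tR_right mult.assoc)

text \<open>By mixed coassociativity \<open>q\<close> and \<open>u\<close> become legs of one
  \<open>\<gamma>R\<close>, so \<open>q * S u\<close> collapses to a value of \<open>sL\<close>.
  This crosses the tensor sign into the argument of \<open>jc\<close> and is absorbed by the
  counit.\<close>

lemma jc_S_cancel:
  assumes \<beta>: "balAR \<beta>"
  shows "sweedler (\<gamma>R h) (\<lambda>q z. sweedler (\<gamma>L z) (\<lambda>u v. \<beta> (a * jc v) (g * q * S u))) = \<beta> (a * jc h) g"
proof -
  have "sweedler (\<gamma>R h) (\<lambda>q z. sweedler (\<gamma>L z) (\<lambda>u v. \<beta> (a * jc v) (g * q * S u)))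
    = sweedler (\<gamma>L h) (\<lambda>x v. sweedler (\<gamma>R x) (\<lambda>q u. \<beta> (a * jc v) (g * q * S u)))"
    by (rule mixed_RL[symmetric], rule balanced3I;
        (intro balanced_additive1[OF \<beta>] balanced_additive2[OF \<beta>] additive_intros)?)
      (simp_all add: S_tR_right balL_eq[OF balL_jc_S[OF \<beta>]] flip: mult.assoc)
  also have "\<dots> = sweedler (\<gamma>L h) (\<lambda>x v. \<beta> (a * jc v) (g * sL (\<pi>L x)))"
    by (simp add: mult.assoc sweedler_mult_left[symmetric]
        sweedler_hom[OF balanced_additive2[OF \<beta> additive_times], symmetric] antipode_R)
  also have "\<dots> = sweedler (\<gamma>L h) (\<lambda>x v. \<beta> (a * jc (sL (\<pi>L x) * v)) g)"
    by (simp add: jc_sL_left balAR_eq[OF \<beta>] tR_\<pi>R_sL flip: mult.assoc)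
  also have "\<dots> = \<beta> (a * jc h) g"
  proof -
    have "additive (\<lambda>h. \<beta> (a * jc h) g)"
      by (intro balanced_additive1[OF \<beta>] additive_intros)
    from sweedler_hom[OF this, of "\<gamma>L h" "\<lambda>x v. sL (\<pi>L x) * v"] show ?thesis
      by (simp add: L.counit_left)
  qed
  finally show ?thesis .
qed

text \<open>The candidate for \<open>\<rho>R \<circ> jc\<close> is a right convolution inverse of
  \<open>\<rho>R \<circ> j\<close>. The factor \<open>a\<close> is carried along so that
  \<open>jc x\<close> can be put there.\<close>

lemma \<rho>R_j_jc_S:
  assumes \<beta>: "balAR \<beta>"
  shows "sweedler (\<gamma>R g) (\<lambda>g1 g2. sweedler (\<rho>R (a * j g1)) (\<lambda>a0 a1. sweedler (\<gamma>L g2) (\<lambda>u v. \<beta> (a0 * jc v) (a1 * S u))))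
    = sweedler (\<rho>R (a * \<eta>L (\<pi>L g))) \<beta>"
proof -
  let ?\<beta> = "\<lambda>h a0 a1. sweedler (\<gamma>L h) (\<lambda>u v. \<beta> (a0 * jc v) (a1 * S u))"
  note bal = balAR_jc_S[OF \<beta>]
  note add = balanced_additive1[OF \<beta>] balanced_additive2[OF \<beta>] balL_jc_S[OF \<beta>]
  have inner: "sweedler (\<gamma>R g) (\<lambda>g1 g2. sweedler (\<gamma>R g1) (\<lambda>p q. ?\<beta> g2 (x * j p) (y * q)))
    = \<beta> (x * \<eta>L (\<pi>L g)) y" for x y
  proof -
    have "sweedler (\<gamma>R g) (\<lambda>g1 g2. sweedler (\<gamma>R g1) (\<lambda>p q. ?\<beta> g2 (x * j p) (y * q)))
      = sweedler (\<gamma>R g) (\<lambda>p c. sweedler (\<gamma>R c) (\<lambda>q z. ?\<beta> z (x * j p) (y * q)))"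
    proof (rule R.coassoc', rule balanced3I; (intro add additive_intros)?)
      show "?\<beta> n (x * j (m * sR s)) (y * q) = ?\<beta> n (x * j m) (y * (q * tR s))" for m s q n
        by (simp add: j_sR_right balAR_eq[OF bal] flip: mult.assoc)
      show "?\<beta> n (x * j p) (y * (m * sR s)) = ?\<beta> (n * tR s) (x * j p) (y * m)" for p m s n
        by (simp add: jc_S_tR_right[OF \<beta>] flip: mult.assoc)
    qed
    also have "\<dots> = sweedler (\<gamma>R g) (\<lambda>p c. \<beta> (x * j p * jc c) y)"
      by (simp only: jc_S_cancel[OF \<beta>])
    also have "\<dots> = \<beta> (x * \<eta>L (\<pi>L g)) y"
      by (simp add: mult.assoc sweedler_hom[OF balanced_additive1[OF \<beta> additive_times], symmetric] conv_R)
    finally show ?thesis .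
  qed
  have "sweedler (\<gamma>R g) (\<lambda>g1 g2. sweedler (\<rho>R (a * j g1)) (?\<beta> g2))
    = sweedler (\<gamma>R g) (\<lambda>g1 g2. sweedler (\<rho>R a) (\<lambda>x y. sweedler (\<gamma>R g1) (\<lambda>p q. ?\<beta> g2 (x * j p) (y * q))))"
    by (simp only: \<rho>R_mult'[OF bal] \<rho>R_j[OF balAR_left[OF bal]])
  also have "\<dots> = sweedler (\<rho>R a) (\<lambda>x y. \<beta> (x * \<eta>L (\<pi>L g)) y)"
    by (subst sweedler_swap) (simp only: inner)
  also have "\<dots> = sweedler (\<rho>R (a * \<eta>L (\<pi>L g))) \<beta>"
    by (rule \<rho>R_mult_coinvariant_right[OF \<eta>L_coinvariant \<beta>, symmetric])
  finally show ?thesis .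
qed

text \<open>Uniqueness of inverses: \<open>\<rho>R (jc x) * \<rho>R (j y1)\<close> times the
  candidate at \<open>y2\<close> is evaluated by cancelling its last two factors, then its first
  two.\<close>

lemma \<rho>R_jc:
  assumes \<beta>: "balAR \<beta>"
  shows "sweedler (\<rho>R (jc h)) \<beta> = sweedler (\<gamma>L h) (\<lambda>x y. \<beta> (jc y) (S x))"
proof -
  let ?\<Omega> = "\<lambda>a h. sweedler (\<rho>R a) (\<lambda>a0 a1. sweedler (\<gamma>L h) (\<lambda>u v. \<beta> (a0 * jc v) (a1 * S u)))"
  note bal = balAR_jc_S[OF \<beta>]
  have "sweedler (\<rho>R (jc h)) \<beta> = sweedler (\<gamma>L h) (\<lambda>x y. sweedler (\<rho>R (jc x * \<eta>L (\<pi>L y))) \<beta>)"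
    using sweedler_hom[OF additive_\<rho>R[OF \<beta> additive_id], of "\<gamma>L h" "\<lambda>x y. jc x * \<eta>L (\<pi>L y)"]
    by (simp add: jc_counit)
  also have "\<dots> = sweedler (\<gamma>L h) (\<lambda>x y. sweedler (\<gamma>R y) (\<lambda>y1 y2. ?\<Omega> (jc x * j y1) y2))"
    by (simp only: \<rho>R_j_jc_S[OF \<beta>])
  also have "\<dots> = ?\<Omega> 1 h"
    by (rule conv_cancel; (intro bal balL_jc_S[OF \<beta>] additive_intros)?)
      (simp add: jc_S_tR_right[OF \<beta>] \<rho>R_\<eta>R_right[OF bal])
  also have "\<dots> = sweedler (\<gamma>L h) (\<lambda>x y. \<beta> (jc y) (S x))"
    by (simp add: \<rho>R_one'[OF bal])
  finally show ?thesis .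
qed

text \<open>The counterpart of \<open>\<rho>R_j_jc_S\<close> for \<open>\<rho>L\<close>: first
  \<open>q * S u\<close> collapses by \<open>antipode_R\<close>, then \<open>j\<close> against
  \<open>jc\<close> by \<open>conv_R\<close>. The sum over \<open>\<rho>L a\<close> is kept inside
  because the other sums are balanced only through its Takeuchi condition.\<close>

lemma j_S_coassoc:
  assumes \<beta>: "balAL \<beta>"
  shows "sweedler (\<gamma>R g) (\<lambda>w z. sweedler (\<gamma>R z) (\<lambda>u v. sweedler (\<gamma>L w) (\<lambda>p q.
      sweedler (\<rho>L a) (\<lambda>x y. \<beta> (x * j p * jc v) (y * q * S u)))))
    = sweedler (\<rho>L a) (\<lambda>x y. \<beta> (x * \<eta>L (\<pi>L g)) y)"
proof -
  let ?\<psi> = "\<lambda>w u v. sweedler (\<gamma>L w) (\<lambda>p q. sweedler (\<rho>L a) (\<lambda>x y. \<beta> (x * j p * jc v) (y * q * S u)))"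
  note add = balanced_additive1[OF \<beta>] balanced_additive2[OF \<beta>]
  have balL: "balL (\<lambda>p q. sweedler (\<rho>L a) (\<lambda>x y. \<beta> (x * j p * c) (y * q * d)))" for c d
  proof (rule balancedI; (intro add additive_intros)?)
    show "sweedler (\<rho>L a) (\<lambda>x y. \<beta> (x * j (tL l * p) * c) (y * q * d))
        = sweedler (\<rho>L a) (\<lambda>x y. \<beta> (x * j p * c) (y * (sL l * q) * d))" for p l q
      using \<rho>L_takeuchi[OF balAL_right[OF \<beta>, of "j p * c" "q * d"], of a "\<pi>R (tL l)"]
      by (simp add: j_tL_left mult.assoc sL_\<pi>L_sR_\<pi>R_tL)
  qed
  have "sweedler (\<gamma>R g) (\<lambda>w z. sweedler (\<gamma>R z) (?\<psi> w)) = sweedler (\<gamma>R g) (\<lambda>x v. sweedler (\<gamma>R x) (\<lambda>w u. ?\<psi> w u v))"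
  proof (rule R.coassoc'[symmetric], rule balanced3I; (intro add balL additive_intros)?)
    show "?\<psi> (w * sR s) u v = ?\<psi> w (u * tR s) v" for w s u v
      by (simp add: \<gamma>L_sR_right[OF balL] S_tR_right flip: mult.assoc)
    show "?\<psi> w (u * sR s) v = ?\<psi> w u (v * tR s)" for w u s v
    proof -
      have "tL (\<pi>L (sR s)) = sR s" by (rule tL_\<pi>L_sR)
      then show ?thesis
        using \<gamma>L_takeuchi'[OF balL[of "jc v" "S u"], of w "\<pi>L (sR s)"] S_tL_right[of u "\<pi>L (sR s)"]
        by (simp add: jc_tR_right j_sR_right mult.assoc)
    qed
  qed
  also have "\<dots> = sweedler (\<gamma>R g) (\<lambda>x v. sweedler (\<rho>L a) (\<lambda>a0 a1. \<beta> (a0 * (j x * jc v)) a1))"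
  proof (rule sweedler_cong)
    fix x v
    have "sweedler (\<gamma>R x) (\<lambda>w u. ?\<psi> w u v) = sweedler (\<gamma>L x) (\<lambda>p y. sweedler (\<gamma>R y) (\<lambda>q u.
        sweedler (\<rho>L a) (\<lambda>a0 a1. \<beta> (a0 * j p * jc v) (a1 * q * S u))))"
      by (rule mixed_LR, rule balanced3I; (intro add additive_intros)?)
        (simp_all add: balL_eq[OF balL] S_tR_right flip: mult.assoc)
    also have "\<dots> = sweedler (\<gamma>L x) (\<lambda>p y. sweedler (\<rho>L a) (\<lambda>a0 a1.
        sweedler (\<gamma>R y) (\<lambda>q u. \<beta> (a0 * j p * jc v) (a1 * q * S u))))"
      by (rule sweedler_cong, rule sweedler_swap)
    also have "\<dots> = sweedler (\<gamma>L x) (\<lambda>p y. sweedler (\<rho>L a) (\<lambda>a0 a1. \<beta> (a0 * j p * jc v) (a1 * sL (\<pi>L y))))"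
      by (simp add: mult.assoc sweedler_hom[OF balanced_additive2[OF \<beta> additive_times], symmetric] antipode_R)
    also have "\<dots> = sweedler (\<gamma>L x) (\<lambda>p y. sweedler (\<rho>L a) (\<lambda>a0 a1. \<beta> (a0 * j (tL (\<pi>L y) * p) * jc v) a1))"
    proof (rule sweedler_cong)
      fix p y
      show "sweedler (\<rho>L a) (\<lambda>a0 a1. \<beta> (a0 * j p * jc v) (a1 * sL (\<pi>L y)))
        = sweedler (\<rho>L a) (\<lambda>a0 a1. \<beta> (a0 * j (tL (\<pi>L y) * p) * jc v) a1)"
        using \<rho>L_takeuchi[OF balAL_right[OF \<beta>, of "j p * jc v" 1], of a "\<pi>R (tL (\<pi>L y))"]
        by (simp add: j_tL_left mult.assoc sL_\<pi>L_sR_\<pi>R_tL)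
    qed
    also have "\<dots> = sweedler (\<rho>L a) (\<lambda>a0 a1. \<beta> (a0 * j (sweedler (\<gamma>L x) (\<lambda>p y. tL (\<pi>L y) * p)) * jc v) a1)"
      by (subst sweedler_swap, rule sweedler_cong) (simp add: sweedler_hom[OF additive_j] sweedler_mult_left sweedler_mult_right
          sweedler_hom[OF balanced_additive(1)[OF \<beta>]])
    finally show "sweedler (\<gamma>R x) (\<lambda>w u. ?\<psi> w u v) = sweedler (\<rho>L a) (\<lambda>a0 a1. \<beta> (a0 * (j x * jc v)) a1)"
      by (simp add: L.counit_right mult.assoc)
  qed
  also have "\<dots> = sweedler (\<rho>L a) (\<lambda>a0 a1. sweedler (\<gamma>R g) (\<lambda>x v. \<beta> (a0 * (j x * jc v)) a1))"
    by (rule sweedler_swap)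
  also have "\<dots> = sweedler (\<rho>L a) (\<lambda>x y. \<beta> (x * \<eta>L (\<pi>L g)) y)"
    by (simp add: sweedler_hom[OF balanced_additive1[OF \<beta> additive_times], symmetric] conv_R)
  finally show ?thesis .
qed

text \<open>\<open>S (u * sR r)\<close> puts a value of \<open>sL\<close> between \<open>y\<close>
  and \<open>S u\<close>. It can cross the tensor sign only under the sum over
  \<open>\<rho>L a\<close>, by \<open>\<rho>L_takeuchi\<close>.\<close>

lemma balR_jc_S:
  assumes \<beta>: "balAL \<beta>"
  shows "balR (\<lambda>u v. sweedler (\<rho>L a) (\<lambda>x y. \<beta> (x * jc v) (y * S u)))"
proof (rule balancedI)
  fix u v r
  have "sR r = tL (\<pi>L (sR r))" by (simp add: tL_\<pi>L_sR)
  then have "S (u * sR r) = sL (\<pi>L (sR r)) * S u"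
    using S_tL_right[of u "\<pi>L (sR r)"] by simp
  then show "sweedler (\<rho>L a) (\<lambda>x y. \<beta> (x * jc v) (y * S (u * sR r)))
      = sweedler (\<rho>L a) (\<lambda>x y. \<beta> (x * jc (v * tR r)) (y * S u))"
    using \<rho>L_takeuchi[OF balAL_right[OF \<beta>, of "jc v" "S u"], of a r]
    by (simp add: jc_tR_right mult.assoc)
qed (intro balanced_additive1[OF \<beta>] balanced_additive2[OF \<beta>] additive_intros)+

lemma \<rho>L_jc:
  assumes \<beta>: "balAL \<beta>"
  shows "sweedler (\<rho>L (jc h)) \<beta> = sweedler (\<gamma>R h) (\<lambda>x y. \<beta> (jc y) (S x))"
proof -
  let ?\<Omega> = "\<lambda>a h. sweedler (\<gamma>R h) (\<lambda>u v. sweedler (\<rho>L a) (\<lambda>x y. \<beta> (x * jc v) (y * S u)))"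
  have step: "sweedler (\<gamma>R g) (\<lambda>w z. ?\<Omega> (a * j w) z) = sweedler (\<rho>L (a * \<eta>L (\<pi>L g))) \<beta>" for a g
  proof -
    have "sweedler (\<rho>L (a * j w)) (\<lambda>x y. \<beta> (x * jc v) (y * S u))
      = sweedler (\<gamma>L w) (\<lambda>p q. sweedler (\<rho>L a) (\<lambda>x y. \<beta> (x * j p * jc v) (y * q * S u)))" for w u v
      by (simp only: \<rho>L_mult_swap[OF balAL_right[OF \<beta>]] \<rho>L_j[OF balAL_mult[OF balAL_right[OF \<beta>]]])
    then show ?thesis
      by (simp only: j_S_coassoc[OF \<beta>] \<rho>L_mult_coinvariant_right[OF \<eta>L_coinvariant \<beta>])
  qed
  have "sweedler (\<rho>L (jc h)) \<beta> = sweedler (\<gamma>L h) (\<lambda>x y. sweedler (\<rho>L (jc x * \<eta>L (\<pi>L y))) \<beta>)"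
    using sweedler_hom[OF additive_\<rho>L[OF \<beta> additive_id], of "\<gamma>L h" "\<lambda>x y. jc x * \<eta>L (\<pi>L y)"]
    by (simp add: jc_counit)
  also have "\<dots> = sweedler (\<gamma>L h) (\<lambda>x y. sweedler (\<gamma>R y) (\<lambda>y1 y2. ?\<Omega> (jc x * j y1) y2))"
    by (simp only: step)
  also have "\<dots> = ?\<Omega> 1 h"
  proof (rule conv_cancel; (intro balAL_right[OF \<beta>] balR_jc_S[OF \<beta>] additive_intros)?)
    show "?\<Omega> a (h * tR r) = ?\<Omega> (a * \<eta>R r) h" for a h r
      by (simp add: \<gamma>R_tR_right[OF balR_jc_S[OF \<beta>]] \<rho>L_\<eta>R_right[OF balAL_right[OF \<beta>]] S_tR_right mult.assoc)
  qed
  also have "\<dots> = sweedler (\<gamma>R h) (\<lambda>x y. \<beta> (jc y) (S x))"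
    by (simp add: \<rho>L_one'[OF balAL_right[OF \<beta>]])
  finally show ?thesis .
qed

lemma coinvariant_j_one: "coinvariant (j 1)"
proof (rule coinvariantI)
  fix \<beta> :: "'a \<Rightarrow> 'h \<Rightarrow> (('a \<times> 'h) \<Rightarrow>\<^sub>0 int) quotients" assume \<beta>: "balAR \<beta>"
  have "balR (\<lambda>x y. \<beta> (j x) y)"
    by (rule balancedI; (intro balanced_additive1[OF \<beta>] balanced_additive2[OF \<beta>] additive_intros)?)
      (simp add: j_sR_right balAR_eq[OF \<beta>])
  then show "sweedler (\<rho>R (j 1)) \<beta> = \<beta> (j 1) 1"
    by (simp add: \<rho>R_j[OF \<beta>] \<gamma>R_one')
qed

lemma coinvariant_jc_one: "coinvariant (jc 1)"
proof (rule coinvariantI)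
  fix \<beta> :: "'a \<Rightarrow> 'h \<Rightarrow> (('a \<times> 'h) \<Rightarrow>\<^sub>0 int) quotients" assume \<beta>: "balAR \<beta>"
  show "sweedler (\<rho>R (jc 1)) \<beta> = \<beta> (jc 1) 1"
    using \<gamma>L_one'[OF balL_jc_S[OF \<beta>, of 1 1]] by (simp add: \<rho>R_jc[OF \<beta>] S_one)
qed

lemma balL_jc_j: "balL (\<lambda>x y. jc x * j y)"
  by (rule balancedI; (intro additive_intros)?) (simp add: j_sL_left jc_tL_left mult.assoc)

lemma jc_one_j_one: "jc 1 * j 1 = 1"
  using conv_L[of 1] \<gamma>L_one'[OF balL_jc_j] by (simp add: \<pi>R_one)

end

section \<open>The Hopf algebroid as a comodule algebra over itself, and the coproduct of the
  antipode\<close>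

context hopf_algebroid
begin

lemma regular_comodule_algebra:
  "right_comodule_algebra kH kL sL tL \<gamma>L \<pi>L kR sR tR \<gamma>R \<pi>R S kH sR \<gamma>R \<gamma>L"
proof -
  let ?NR = "tensor_null UNIV UNIV UNIV (\<lambda>h r. h * sR r) (\<lambda>r h. h * tR r)"
  let ?NL = "tensor_null UNIV UNIV UNIV (\<lambda>h l. tL l * h) (\<lambda>l h. sL l * h)"
  have \<gamma>R_sR: "\<gamma>R (h * sR r) = sweedler (\<gamma>R h) (\<lambda>x y. frag_of (x, y * sR r)) +o ?NR" for h r
    using R.comult_bilinear[of h r 1] by simp
  have \<gamma>L_tL: "\<gamma>L (tL l * h) = sweedler (\<gamma>L h) (\<lambda>x y. frag_of (x, tL l * y)) +o ?NL" for h l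
    using L.comult_bilinear[of 1 l h] by simp
  have \<gamma>R_tL: "\<gamma>R (tL l * h) = sweedler (\<gamma>R h) (\<lambda>x y. frag_of (x, tL l * y)) +o ?NR" for h l
    by (rule tensor_eq_cosetI[OF R.comult_in])
      (simp_all add: sweedler_hom[OF additive_frag_sum] \<gamma>R_tL_left)
  have \<gamma>L_sR: "\<gamma>L (h * sR r) = sweedler (\<gamma>L h) (\<lambda>x y. frag_of (x, y * sR r)) +o ?NL" for h r
    by (rule tensor_eq_cosetI[OF L.comult_in])
      (simp_all add: sweedler_hom[OF additive_frag_sum] \<gamma>L_sR_right)
  have bal: "balR (\<lambda>x y. x * sR (\<pi>R y))"
    by (rule balancedI; (intro additive_intros)?) (simp add: \<pi>R_tR_right sR_mult mult.assoc)
  \<comment> \<open>The left action of \<open>R\<close> on \<open>H\<close> is left multiplication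
    by \<open>sR r\<close>, because \<open>\<gamma>R\<close> sends this factor to the second
    leg.\<close>
  have counit: "sweedler (\<gamma>R h) (\<lambda>x y. x * sR (\<pi>R (sR r * y))) = sR r * h" for h r
    using R.counit_right[of "sR r * h"] by (simp add: \<gamma>R_sR_left[OF bal])
  show ?thesis
    by unfold_locales
      (simp_all only: sR_\<pi>R_tL,
        (rule R.comult_in R.comult_add \<gamma>R_sR R.coassoc R.counit_right L.right_add L.right_add_scalar
          L.right_mult L.right_one L.comult_in L.comult_add \<gamma>L_tL L.coassoc L.counit_right \<gamma>R_tL \<gamma>L_sR
          mixed_coassoc_RL[symmetric] mixed_coassoc_LR[symmetric]
          sR_map counit \<gamma>R_one \<gamma>R_mult \<gamma>L_one \<gamma>L_mult)+)
qed

lemma regular_cleaving_pair: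
  "cleaving_pair kH kL sL tL \<gamma>L \<pi>L kR sR tR \<gamma>R \<pi>R S kH sR \<gamma>R \<gamma>L sL (\<lambda>h. h) S"
proof -
  interpret regular: right_comodule_algebra kH kL sL tL \<gamma>L \<pi>L kR sR tR \<gamma>R \<pi>R S kH sR \<gamma>R \<gamma>L
    by (rule regular_comodule_algebra)
  have coinv: "regular.coinvariant (sL l)" for l
    by (rule regular.coinvariantI) (use \<gamma>R_tR[of _ "\<pi>R (sL l)"] in \<open>simp add: tR_\<pi>R_sL\<close>)
  \<comment> \<open>This and the next equation are the colinearity of the identity map in the form
    demanded by \<open>right_comodule_map\<close>.\<close>
  have "\<gamma>R h = sweedler (\<gamma>R h) (\<lambda>x y. frag_of (x, y)) +o tensor_null UNIV UNIV UNIV (\<lambda>h r. h * sR r) (\<lambda>r h. h * tR r)"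
    for h
    by (rule tensor_eq_cosetI[OF R.comult_in]) (simp_all add: sweedler_hom[OF additive_frag_sum])
  moreover have "\<gamma>L h = sweedler (\<gamma>L h) (\<lambda>x y. frag_of (x, y)) +o tensor_null UNIV UNIV UNIV (\<lambda>h l. tL l * h) (\<lambda>l h. sL l * h)"
    for h
    by (rule tensor_eq_cosetI[OF L.comult_in]) (simp_all add: sweedler_hom[OF additive_frag_sum])
  ultimately show ?thesis
    by unfold_locales
      (simp_all add: sL_map coinv right_comodule_map_def sR_\<pi>R_tL S_k_linear antipode_L antipode_R
        S_tL_left S_tR_right additive_id mult.assoc)
qed

lemma \<gamma>L_S: "balL \<beta> \<Longrightarrow> sweedler (\<gamma>L (S h)) \<beta> = sweedler (\<gamma>R h) (\<lambda>x y. \<beta> (S y) (S x))"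
  using cleaving_pair.\<rho>L_jc[OF regular_cleaving_pair] by (simp add: sR_\<pi>R_tL)

end

locale bijective_cleaving_pair =
  cleaving_pair kH kL sL tL \<gamma>L \<pi>L kR sR tR \<gamma>R \<pi>R S kA \<eta>R \<rho>R \<rho>L \<eta>L j jc
  for kH :: "'k::{comm_ring,comm_monoid_mult} \<Rightarrow> 'h::{ring,monoid_mult} \<Rightarrow> 'h"
    and kL :: "'k \<Rightarrow> 'l::{ring,monoid_mult} \<Rightarrow> 'l"
    and sL :: "'l \<Rightarrow> 'h" and tL :: "'l \<Rightarrow> 'h"
    and \<gamma>L :: "'h \<Rightarrow> ('h, 'h) tensor" and \<pi>L :: "'h \<Rightarrow> 'l"
    and kR :: "'k \<Rightarrow> 'r::{ring,monoid_mult} \<Rightarrow> 'r"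
    and sR :: "'r \<Rightarrow> 'h" and tR :: "'r \<Rightarrow> 'h"
    and \<gamma>R :: "'h \<Rightarrow> ('h, 'h) tensor" and \<pi>R :: "'h \<Rightarrow> 'r"
    and S :: "'h \<Rightarrow> 'h"
    and kA :: "'k \<Rightarrow> 'a::{ring,monoid_mult} \<Rightarrow> 'a"
    and \<eta>R :: "'r \<Rightarrow> 'a"
    and \<rho>R :: "'a \<Rightarrow> ('a, 'h) tensor" and \<rho>L :: "'a \<Rightarrow> ('a, 'h) tensor"
    and \<eta>L :: "'l \<Rightarrow> 'a" and j jc :: "'h \<Rightarrow> 'a" +
  assumes bij_S: "bij S"
begin

lemma S_inv [simp]: "S (inv S h) = h" and inv_S [simp]: "inv S (S h) = h"
  using bij_S by (simp_all add: bij_is_surj surj_f_inv_f bij_is_inj)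

lemma inv_S_eqI: "S x = h \<Longrightarrow> inv S h = x"
  by auto

lemma additive_inv_S: "additive (inv S)"
  by unfold_locales (rule inv_S_eqI, simp add: additive.add[OF additive_S])

lemmas additive_inv_S' [additive_intros] = additive_inv_S additive_compose[OF additive_inv_S]

lemma inv_S_one [simp]: "inv S 1 = 1"
  by (rule inv_S_eqI) (rule S_one)

lemma inv_S_tL_left: "inv S (tL l * h) = inv S h * tR (\<pi>R (tL l))"
  by (rule inv_S_eqI) (simp add: S_tR_right sR_\<pi>R_tL)

lemma inv_S_sL_left: "inv S (sL l * h) = inv S h * tL l"
  by (rule inv_S_eqI) (simp add: S_tL_right)

text \<open>This is \<open>\<gamma>L_S\<close> at \<open>inv S h\<close>, read from right to
  left.\<close>

lemma \<gamma>R_inv_S: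
  assumes \<beta>: "balR \<beta>"
  shows "sweedler (\<gamma>R (inv S h)) \<beta> = sweedler (\<gamma>L h) (\<lambda>x y. \<beta> (inv S y) (inv S x))"
proof -
  have "balL (\<lambda>x y. \<beta> (inv S y) (inv S x))"
    by (rule balancedI; (intro balanced_additive1[OF \<beta>] balanced_additive2[OF \<beta>] additive_intros)?)
      (simp add: inv_S_tL_left inv_S_sL_left balR_eq[OF \<beta>, symmetric] sR_\<pi>R_tL)
  from \<gamma>L_S[OF this, of "inv S h"] show ?thesis by simp
qed

text \<open>Applying \<open>S\<close>, which is anti-multiplicative by \<open>S_mult\<close>, turns
  the claim into \<open>antipode_L\<close>; injectivity of \<open>S\<close> then gives the
  result.\<close>

lemma inv_S_antipode: "sweedler (\<gamma>L h) (\<lambda>x y. inv S y * x) = tR (\<pi>R h)"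
proof -
  have "S (sweedler (\<gamma>L h) (\<lambda>x y. inv S y * x)) = sR (\<pi>R h)"
    by (simp add: sweedler_hom[OF additive_S] S_mult antipode_L)
  moreover have "S (tR (\<pi>R h)) = sR (\<pi>R h)"
    using S_tR_left[of "\<pi>R h" 1] by (simp add: S_one)
  ultimately show ?thesis
    by (metis inv_S)
qed

text \<open>
  \<open>E\<close> and \<open>F\<close> are retractions onto the coinvariants of \<open>b \<mapsto> b j(1)\<close> and \<open>b \<mapsto> jc(1) b\<close>;
  \<open>F\<close> is built from the left coaction \<open>a \<mapsto> S\<inverse>(a\<^sub>[\<^sub>1\<^sub>]) \<otimes> a\<^sub>[\<^sub>0\<^sub>]\<close>.
\<close>

definition E :: "'a \<Rightarrow> 'a" where
  "E a = sweedler (\<rho>R a) (\<lambda>x y. x * jc y)"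

definition F :: "'a \<Rightarrow> 'a" where
  "F a = sweedler (\<rho>L a) (\<lambda>x y. j (inv S y) * x)"

lemma balAR_E: "balAR (\<lambda>x y. x * jc y)"
  by (rule balancedI; (intro additive_intros)?) (simp add: jc_tR_right mult.assoc)

lemma balAL_F: "balAL (\<lambda>x y. j (inv S y) * x)"
  by (rule balancedI; (intro additive_intros)?)
    (simp add: inv_S_sL_left mult.assoc[symmetric] j_sR_right[symmetric] sR_\<pi>R_tL)

lemma additive_E: "additive E" and additive_F: "additive F"
  unfolding E_def F_def by (intro additive_intros balAR_E balAL_F)+

lemmas additive_E' [additive_intros] = additive_E additive_compose[OF additive_E]
lemmas additive_F' [additive_intros] = additive_F additive_compose[OF additive_F]

text \<open>Coassociativity places the leg \<open>q\<close> of \<open>\<rho>R\<close> next to the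
  factor \<open>S u\<close> coming from \<open>\<rho>R (jc y)\<close>, and
  \<open>jc_S_cancel\<close> removes both.\<close>

lemma coinvariant_E: "coinvariant (E a)"
proof (rule coinvariantI)
  fix \<beta> :: "'a \<Rightarrow> 'h \<Rightarrow> (('a \<times> 'h) \<Rightarrow>\<^sub>0 int) quotients" assume \<beta>: "balAR \<beta>"
  note add = balanced_additive1[OF \<beta>] balanced_additive2[OF \<beta>]
  have "sweedler (\<rho>R (E a)) \<beta> = sweedler (\<rho>R a) (\<lambda>x y. sweedler (\<rho>R (x * jc y)) \<beta>)"
    unfolding E_def by (rule sweedler_hom[OF additive_\<rho>R[OF \<beta> additive_id]])
  also have "\<dots> = sweedler (\<rho>R a) (\<lambda>x y. sweedler (\<rho>R x) (\<lambda>x0 x1. sweedler (\<gamma>L y) (\<lambda>u v. \<beta> (x0 * jc v) (x1 * S u))))"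
    by (simp only: \<rho>R_mult'[OF \<beta>] \<rho>R_jc[OF balAR_left[OF \<beta>]])
  also have "\<dots> = sweedler (\<rho>R a) (\<lambda>x y. sweedler (\<gamma>R y) (\<lambda>q z. sweedler (\<gamma>L z) (\<lambda>u v. \<beta> (x * jc v) (1 * q * S u))))"
    by (simp only: mult_1, rule onR.coact_coassoc', rule balanced3I;
        (intro add balL_jc_S[OF \<beta>] additive_intros)?)
      (simp_all add: balAR_eq[OF balAR_jc_S[OF \<beta>]] jc_S_tR_right[OF \<beta>])
  also have "\<dots> = sweedler (\<rho>R a) (\<lambda>x y. \<beta> (x * jc y) 1)"
    by (simp only: jc_S_cancel[OF \<beta>])
  also have "\<dots> = \<beta> (E a) 1"
    unfolding E_def by (rule sweedler_hom[OF balanced_additive(1)[OF \<beta>], symmetric])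
  finally show "sweedler (\<rho>R (E a)) \<beta> = \<beta> (E a) 1" .
qed

text \<open>\<open>inv S\<close> reverses the coproduct, so \<open>\<rho>R\<close> produces a second
  leg \<open>inv S u * y\<close>. Once coassociativity and the mixed comodule axiom make
  \<open>y\<close> and \<open>u\<close> legs of one \<open>\<gamma>L\<close>,
  \<open>inv_S_antipode\<close> reduces it to \<open>tR (\<pi>R h)\<close>, which the counit of
  \<open>\<rho>R\<close> absorbs.\<close>

lemma coinvariant_F: "coinvariant (F a)"
proof (rule coinvariantI)
  fix \<beta> :: "'a \<Rightarrow> 'h \<Rightarrow> (('a \<times> 'h) \<Rightarrow>\<^sub>0 int) quotients" assume \<beta>: "balAR \<beta>"
  note add = balanced_additive1[OF \<beta>] balanced_additive2[OF \<beta>]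
  let ?\<tau> = "\<lambda>m u v. sweedler (\<rho>R m) (\<lambda>x y. \<beta> (j (inv S v) * x) (inv S u * y))"
  have balR: "balR (\<lambda>p q. sweedler (\<rho>R m) (\<lambda>x y. \<beta> (j p * x) (q * y)))" for m
    by (rule balancedI; (intro add additive_intros)?)
      (simp add: j_sR_right balAR_eq[OF balAR_mult[OF \<beta>]])
  have "sweedler (\<rho>R (F a)) \<beta> = sweedler (\<rho>L a) (\<lambda>x y. sweedler (\<rho>R (j (inv S y) * x)) \<beta>)"
    unfolding F_def by (rule sweedler_hom[OF additive_\<rho>R[OF \<beta> additive_id]])
  also have "\<dots> = sweedler (\<rho>L a) (\<lambda>m y. sweedler (\<gamma>L y) (\<lambda>u v. ?\<tau> m u v))"
    by (simp only: \<rho>R_mult'[OF \<beta>] \<rho>R_j[OF balAR_mult[OF \<beta>]] \<gamma>R_inv_S[OF balR])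
  also have "\<dots> = sweedler (\<rho>L a) (\<lambda>m v. sweedler (\<rho>L m) (\<lambda>m0 u. ?\<tau> m0 u v))"
  proof (rule onL.coact_coassoc'[symmetric], rule balanced3I; (intro add balAR_left[OF \<beta>] additive_intros)?)
    show "?\<tau> (\<eta>R (\<pi>R (tL l)) * m) u v = ?\<tau> m (sL l * u) v" for m l u v
      by (simp add: \<rho>R_tL_left[OF balAR_left[OF \<beta>]] inv_S_sL_left mult.assoc)
    show "?\<tau> m (tL l * u) v = ?\<tau> m u (sL l * v)" for m u l v
      using \<rho>R_takeuchi[OF balAR_left[OF \<beta>, of "j (inv S v)" "inv S u"], of m "\<pi>R (tL l)"]
        j_sR_right[of "inv S v" "\<pi>R (tL l)"]
      by (simp add: inv_S_tL_left inv_S_sL_left mult.assoc sR_\<pi>R_tL)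
  qed
  also have "\<dots> = sweedler (\<rho>L a) (\<lambda>m v. \<beta> (j (inv S v) * m) 1)"
  proof (rule sweedler_cong)
    fix m v
    have "sweedler (\<rho>L m) (\<lambda>m0 u. ?\<tau> m0 u v)
      = sweedler (\<rho>R m) (\<lambda>x h. sweedler (\<gamma>L h) (\<lambda>y u. \<beta> (j (inv S v) * x) (inv S u * y)))"
      by (rule mixed_coact_RL, rule balanced3I; (intro add additive_intros)?)
        (simp_all add: balAR_eq[OF balAR_left[OF \<beta>]] inv_S_sL_left mult.assoc)
    also have "\<dots> = sweedler (\<rho>R m) (\<lambda>x h. \<beta> (j (inv S v) * (x * \<eta>R (\<pi>R h))) 1)"
      using balAR_eq[OF \<beta>, of _ _ 1]
      by (simp add: sweedler_hom[OF balanced_additive(2)[OF \<beta>], symmetric] inv_S_antipode mult.assoc[symmetric])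
    also have "\<dots> = \<beta> (j (inv S v) * m) 1"
      by (simp add: sweedler_hom[OF balanced_additive1[OF \<beta> additive_times], symmetric] onR.coact_counit)
    finally show "sweedler (\<rho>L m) (\<lambda>m0 u. ?\<tau> m0 u v) = \<beta> (j (inv S v) * m) 1" .
  qed
  also have "\<dots> = \<beta> (F a) 1"
    unfolding F_def by (rule sweedler_hom[OF balanced_additive(1)[OF \<beta>], symmetric])
  finally show "sweedler (\<rho>R (F a)) \<beta> = \<beta> (F a) 1" .
qed

lemma E_mult_left: "coinvariant b \<Longrightarrow> E (b * a) = b * E a"
  unfolding E_def by (simp add: \<rho>R_mult_coinvariant_left[OF _ balAR_E] sweedler_mult_left mult.assoc)

lemma F_mult_right: "coinvariant b \<Longrightarrow> F (a * b) = F a * b"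
  unfolding F_def by (simp add: \<rho>L_mult_coinvariant_right[OF _ balAL_F] sweedler_mult_right mult.assoc)

lemma E_j: "E (j h) = \<eta>L (\<pi>L h)"
  unfolding E_def by (simp add: \<rho>R_j[OF balAR_E] conv_R)

lemma F_jc: "F (jc h) = \<eta>L (\<pi>L h)"
  unfolding F_def by (simp add: \<rho>L_jc[OF balAL_F] conv_R)

lemma E_coinvariant: "coinvariant b \<Longrightarrow> E b = b * jc 1"
  unfolding E_def by (rule \<rho>R_coinvariant[OF _ balAR_E])

lemma F_coinvariant: "coinvariant b \<Longrightarrow> F b = j 1 * b"
  unfolding F_def by (simp add: \<rho>L_coinvariant[OF _ balAL_F])

end

section \<open>Strong connections of cleft extensions\<close>

locale cleft_pair_over =
  bijective_cleaving_pair kH kL sL tL \<gamma>L \<pi>L kR sR tR \<gamma>R \<pi>R S kA \<eta>R \<rho>R \<rho>L \<eta>L j jc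
  for kH :: "'k::{comm_ring,comm_monoid_mult} \<Rightarrow> 'h::{ring,monoid_mult} \<Rightarrow> 'h"
    and kL :: "'k \<Rightarrow> 'l::{ring,monoid_mult} \<Rightarrow> 'l"
    and sL :: "'l \<Rightarrow> 'h" and tL :: "'l \<Rightarrow> 'h"
    and \<gamma>L :: "'h \<Rightarrow> ('h, 'h) tensor" and \<pi>L :: "'h \<Rightarrow> 'l"
    and kR :: "'k \<Rightarrow> 'r::{ring,monoid_mult} \<Rightarrow> 'r"
    and sR :: "'r \<Rightarrow> 'h" and tR :: "'r \<Rightarrow> 'h"
    and \<gamma>R :: "'h \<Rightarrow> ('h, 'h) tensor" and \<pi>R :: "'h \<Rightarrow> 'r"
    and S :: "'h \<Rightarrow> 'h"
    and kA :: "'k \<Rightarrow> 'a::{ring,monoid_mult} \<Rightarrow> 'a"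
    and \<eta>R :: "'r \<Rightarrow> 'a"
    and \<rho>R :: "'a \<Rightarrow> ('a, 'h) tensor" and \<rho>L :: "'a \<Rightarrow> ('a, 'h) tensor"
    and \<eta>L :: "'l \<Rightarrow> 'a" and j jc :: "'h \<Rightarrow> 'a" +
  fixes T :: "'a set"
  assumes T_coinvariant: "t \<in> T \<Longrightarrow> coinvariant t"
begin

abbreviation "B \<equiv> Collect coinvariant"
abbreviation "balT \<equiv> balanced T (*) (*)"
abbreviation "balHA \<equiv> balanced UNIV (\<lambda>h r. h * sR r) (\<lambda>r a. \<eta>R r * a)"
abbreviation "is_strong_connection \<equiv> strong_connection sR tR \<gamma>R S \<eta>R \<rho>R \<rho>L T"
abbreviation "is_LL_section f \<equiv> LL_bilinear sL tL \<eta>L B T f \<and> (\<forall>h. tensor_mult (f h) = \<eta>L (\<pi>L h))"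

lemma coinvariant_add: "coinvariant b \<Longrightarrow> coinvariant b' \<Longrightarrow> coinvariant (b + b')"
  by (rule coinvariantI)
    (simp add: additive.add[OF additive_\<rho>R[OF _ additive_id]] \<rho>R_coinvariant additive.add[OF balanced_additive(1)])

lemma coinvariant_mult:
  assumes "coinvariant b" "coinvariant b'"
  shows "coinvariant (b * b')"
proof (rule coinvariantI)
  fix \<beta> :: "'a \<Rightarrow> 'h \<Rightarrow> (('a \<times> 'h) \<Rightarrow>\<^sub>0 int) quotients" assume \<beta>: "balAR \<beta>"
  have "balAR (\<lambda>x y. \<beta> (b * x) y)"
    using balAR_left[OF \<beta>, of b 1] by simp
  then show "sweedler (\<rho>R (b * b')) \<beta> = \<beta> (b * b') 1"
    by (simp add: \<rho>R_mult_coinvariant_left[OF assms(1) \<beta>] \<rho>R_coinvariant[OF assms(2)])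
qed

lemma balT_eq: "balT \<beta> \<Longrightarrow> t \<in> T \<Longrightarrow> \<beta> (a * t) a' = \<beta> a (t * a')"
  by (simp add: balanced_on_def)

lemma balT_on_B: "balT \<beta> \<Longrightarrow> balanced_on B T B (*) (*) \<beta>"
  by (rule balanced_on_subset[OF _ subset_UNIV subset_UNIV])

lemma balT_mult:
  assumes \<beta>: "balT \<beta>"
  shows "balT (\<lambda>a a'. \<beta> (c * a) (a' * d))"
  by (rule balancedI; (intro balanced_additive1[OF \<beta>] balanced_additive2[OF \<beta>] additive_intros)?)
    (simp add: balT_eq[OF \<beta>] flip: mult.assoc)

lemma balT_FE:
  assumes \<beta>: "balT \<beta>"
  shows "balT (\<lambda>a a'. \<beta> (F a) (E a'))"
  by (rule balancedI; (intro balanced_additive1[OF \<beta>] balanced_additive2[OF \<beta>] additive_intros)?)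
    (simp add: F_mult_right E_mult_left T_coinvariant balT_eq[OF \<beta>])

text \<open>The chosen representative is supported in \<open>B \<times> B\<close>, so summands need
  to agree only on coinvariants, and no balancing of them is required.\<close>

lemma sweedler_B_cong:
  assumes "x \<in> tensor B T B (*) (*)" and "\<And>b b'. coinvariant b \<Longrightarrow> coinvariant b' \<Longrightarrow> \<phi> b b' = \<psi> b b'"
  shows "sweedler x \<phi> = sweedler x \<psi>"
proof -
  have "Poly_Mapping.keys (SOME p. p \<in> x) \<subseteq> B \<times> B"
    by (rule keys_some[OF _ _ _ _ assms(1)]) (simp_all add: coinvariant_add coinvariant_mult T_coinvariant)
  then show ?thesis
    unfolding sweedler_def by (intro frag_sum_cong) (use assms(2) in auto)
qed

lemma keys_sweedler_B:
  assumes "x \<in> tensor B T B (*) (*)"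
    and "\<And>b b'. coinvariant b \<Longrightarrow> coinvariant b' \<Longrightarrow> Poly_Mapping.keys (g b b') \<subseteq> X"
  shows "Poly_Mapping.keys (sweedler x g) \<subseteq> X"
proof -
  have "sweedler x g = sweedler x (\<lambda>b b'. if coinvariant b \<and> coinvariant b' then g b b' else 0)"
    by (rule sweedler_B_cong[OF assms(1)]) simp
  then show ?thesis
    using keys_sweedler[of "\<lambda>b b'. if coinvariant b \<and> coinvariant b' then g b b' else 0" X x] assms(2)
    by auto
qed

lemma A_tensor_eqI:
  fixes x y :: "('a, 'a) tensor"
  assumes "x \<in> tensor UNIV T UNIV (*) (*)" "y \<in> tensor UNIV T UNIV (*) (*)"
    and "\<And>\<beta> :: 'a \<Rightarrow> 'a \<Rightarrow> (('a \<times> 'a) \<Rightarrow>\<^sub>0 int) quotients. balT \<beta> \<Longrightarrow> sweedler x \<beta> = sweedler y \<beta>"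
  shows "x = y"
  by (rule tensor_eqI[OF assms(1,2)]) (rule assms(3)[OF balanced_pure_tensor])

text \<open>
  The map \<open>B \<otimes>\<^sub>T B \<rightarrow> A \<otimes>\<^sub>T A\<close> induced by the inclusion is injective,
  as \<open>jc(1) F \<otimes> E j(1)\<close> is a left inverse.
\<close>

lemma B_tensor_eqI:
  fixes x y :: "('a, 'a) tensor"
  assumes x: "x \<in> tensor B T B (*) (*)" and y: "y \<in> tensor B T B (*) (*)"
    and eq: "\<And>\<beta> :: 'a \<Rightarrow> 'a \<Rightarrow> (('a \<times> 'a) \<Rightarrow>\<^sub>0 int) quotients. balT \<beta> \<Longrightarrow> sweedler x \<beta> = sweedler y \<beta>"
  shows "x = y"
proof (rule tensor_eqI[OF x y])
  let ?p = "pure_tensor B T B (*) (*) :: 'a \<Rightarrow> 'a \<Rightarrow> _"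
  let ?q = "\<lambda>a a'. ?p (jc 1 * F a) (E a' * j 1)"
  note p = balanced_pure_tensor[of B T B "(*)" "(*)", unfolded balanced_on_def, simplified]
  have cancel: "jc 1 * (j 1 * b) = b" "b * jc 1 * j 1 = b" for b
    by (simp add: jc_one_j_one flip: mult.assoc) (simp add: jc_one_j_one mult.assoc)
  note B_simps = coinvariant_mult coinvariant_j_one coinvariant_jc_one coinvariant_E coinvariant_F
  have "balT ?q"
  proof (rule balancedI)
    fix a a' t assume t: "t \<in> T"
    show "?q (a * t) a' = ?q a (t * a')"
      using t p by (simp add: F_mult_right E_mult_left T_coinvariant B_simps flip: mult.assoc)
  qed (unfold_locales, simp add: additive.add[OF additive_F] additive.add[OF additive_E] distrib_left distrib_right B_simps p)+
  then have "sweedler x ?q = sweedler y ?q"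
    by (rule eq)
  moreover have "sweedler z ?p = sweedler z ?q" if "z \<in> tensor B T B (*) (*)" for z
    by (rule sweedler_B_cong[OF that])
      (simp add: F_coinvariant E_coinvariant cancel)
  ultimately show "sweedler x ?p = sweedler y ?p"
    using x y by simp
qed

definition section_of :: "('h \<Rightarrow> ('a, 'a) tensor) \<Rightarrow> 'h \<Rightarrow> ('a, 'a) tensor" where
  "section_of l h = sweedler (l h) (\<lambda>a a'. frag_of (F a, E a')) +o tensor_null B T B (*) (*)"

definition connection_of :: "('h \<Rightarrow> ('a, 'a) tensor) \<Rightarrow> 'h \<Rightarrow> ('a, 'a) tensor" where
  "connection_of f h =
    sweedler (\<gamma>L h) (\<lambda>x y. sweedler (\<gamma>L y) (\<lambda>u v. sweedler (f u) (\<lambda>b b'. frag_of (jc x * b, b' * j v))))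
      +o tensor_null UNIV T UNIV (*) (*)"

lemma section_of_in: "section_of l h \<in> tensor B T B (*) (*)"
  unfolding section_of_def
  by (intro coset_in_tensor keys_sweedler) (simp add: coinvariant_E coinvariant_F)

lemma connection_of_in: "connection_of f h \<in> tensor UNIV T UNIV (*) (*)"
  unfolding connection_of_def by (intro coset_in_tensor) simp

lemma sweedler_section_of:
  "balT \<beta> \<Longrightarrow> sweedler (section_of l h) \<beta> = sweedler (l h) (\<lambda>a a'. \<beta> (F a) (E a'))"
  using sweedler_of_sweedler[OF section_of_def balT_on_B, of \<beta>] by simp

lemma sweedler_connection_of:
  "balT \<beta> \<Longrightarrow> sweedler (connection_of f h) \<beta> =
    sweedler (\<gamma>L h) (\<lambda>x y. sweedler (\<gamma>L y) (\<lambda>u v. sweedler (f u) (\<lambda>b b'. \<beta> (jc x * b) (b' * j v))))"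
  using sweedler_of_sweedler[OF connection_of_def, of \<beta>] by (simp add: sweedler_hom[OF additive_frag_sum])

lemma sweedler_left_coaction:
  "balHA \<beta> \<Longrightarrow> sweedler (left_coaction sR S \<eta>R \<rho>L a) \<beta> = sweedler (\<rho>L a) (\<lambda>x y. \<beta> (inv S y) x)"
  using sweedler_of_sweedler[OF left_coaction_def, where \<beta> = \<beta>] by simp

lemma sweedler_lifted_can:
  "balAR \<beta> \<Longrightarrow> sweedler (lifted_can tR \<eta>R \<rho>R z) \<beta>
    = sweedler z (\<lambda>a a'. sweedler (\<rho>R a') (\<lambda>x y. \<beta> (a * x) y))"
  using sweedler_of_sweedler[OF lifted_can_def, where \<beta> = \<beta>] by (simp add: sweedler_hom[OF additive_frag_sum])

section \<open>Strong connections and their convolution with \<open>j\<close> and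
  \<open>jc\<close>\<close>

lemma strong_connection_in: "is_strong_connection l \<Longrightarrow> l h \<in> tensor UNIV T UNIV (*) (*)"
  by (simp add: strong_connection_def)

lemma additive_strong_connection:
  assumes l: "is_strong_connection l" and "balT \<beta>" "additive f"
  shows "additive (\<lambda>x. sweedler (l (f x)) \<beta>)"
  using l by unfold_locales
    (simp add: additive.add[OF assms(3)] sweedler_plus[OF strong_connection_in[OF l] strong_connection_in[OF l] assms(2)]
      strong_connection_def)

lemma strong_connection_tR:
  assumes "is_strong_connection l" "balT \<beta>"
  shows "sweedler (l (h * tR r)) \<beta> = sweedler (l h) (\<lambda>a a'. \<beta> (\<eta>R r * a) a')"
  using sweedler_of_sweedler[of "l (h * tR r)" "l h", OF _ assms(2)] assms(1)
  by (simp add: strong_connection_def)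

lemma strong_connection_sR:
  assumes "is_strong_connection l" "balT \<beta>"
  shows "sweedler (l (h * sR r)) \<beta> = sweedler (l h) (\<lambda>a a'. \<beta> a (a' * \<eta>R r))"
  using sweedler_of_sweedler[of "l (h * sR r)" "l h", OF _ assms(2)] assms(1)
  by (simp add: strong_connection_def)

lemma strong_connection_left:
  assumes l: "is_strong_connection l"
    and \<tau>: "balanced3 UNIV (\<lambda>h r. h * sR r) (\<lambda>r a. \<eta>R r * a) T (*) (*) \<tau>"
  shows "sweedler (l h) (\<lambda>a a'. sweedler (\<rho>L a) (\<lambda>x y. \<tau> (inv S y) x a'))
    = sweedler (\<gamma>R h) (\<lambda>h1 h2. sweedler (l h2) (\<lambda>a a'. \<tau> h1 a a'))"
proof -
  have "sweedler (l h) (\<lambda>a a'. sweedler (left_coaction sR S \<eta>R \<rho>L a) (\<lambda>g a0. \<tau> g a0 a'))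
    = sweedler (\<gamma>R h) (\<lambda>h1 h2. sweedler (l h2) (\<lambda>a a'. \<tau> h1 a a'))"
    using sweedler3_elim[of "l h", OF _ \<tau>, of _ "\<lambda>a a' g a0. frag_of (g, a0, a')" "\<gamma>R h"
        "\<lambda>h1 h2. l h2" "\<lambda>h1 h2 a a'. frag_of (h1, a, a')"] l
    by (simp add: strong_connection_def)
  moreover have "balHA (\<lambda>g a0. \<tau> g a0 a')" for a'
    using \<tau> by (simp add: balanced3_def)
  ultimately show ?thesis
    by (simp add: sweedler_left_coaction)
qed

lemma strong_connection_right:
  assumes l: "is_strong_connection l"
    and \<tau>: "balanced3 T (*) (*) UNIV (\<lambda>a r. a * \<eta>R r) (\<lambda>r h. h * tR r) \<tau>"
  shows "sweedler (l h) (\<lambda>a a'. sweedler (\<rho>R a') (\<lambda>x y. \<tau> a x y))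
    = sweedler (\<gamma>R h) (\<lambda>h1 h2. sweedler (l h1) (\<lambda>a a'. \<tau> a a' h2))"
  using sweedler3_elim[of "l h", OF _ \<tau>, of "\<lambda>a a'. \<rho>R a'" "\<lambda>a a' x y. frag_of (a, x, y)" "\<gamma>R h"
      "\<lambda>h1 h2. l h1" "\<lambda>h1 h2 a a'. frag_of (a, a', h2)"] l
  by (simp add: strong_connection_def)

text \<open>Apply the counit \<open>\<pi>R\<close> to the \<open>H\<close>-leg of the canonical map
  condition; the counit of \<open>\<rho>R\<close> restores \<open>a'\<close>.\<close>

lemma strong_connection_mult:
  assumes l: "is_strong_connection l"
  shows "sweedler (l h) (*) = \<eta>R (\<pi>R h)"
proof -
  have bal: "balAR (\<lambda>x y. x * \<eta>R (\<pi>R y))"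
    by (rule balancedI; (intro additive_intros)?) (simp add: \<pi>R_tR_right \<eta>R_mult mult.assoc)
  have "lifted_can tR \<eta>R \<rho>R (l h)
    = frag_of (1, h) +o tensor_null UNIV UNIV UNIV (\<lambda>a r. a * \<eta>R r) (\<lambda>r h. h * tR r)"
    using l by (simp add: strong_connection_def)
  from sweedler_pure[OF this bal] sweedler_lifted_can[OF bal, of "l h"]
  have "sweedler (l h) (\<lambda>a a'. sweedler (\<rho>R a') (\<lambda>x y. a * x * \<eta>R (\<pi>R y))) = \<eta>R (\<pi>R h)"
    by simp
  then show ?thesis
    by (simp add: mult.assoc sweedler_mult_left[symmetric] onR.coact_counit)
qed

text \<open>Convolution over \<open>R\<close> is well defined: \<open>sR r\<close> leaves
  \<open>l\<close> as a right factor \<open>\<eta>R r\<close>, and \<open>tR r\<close> leaves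
  \<open>jc\<close> as a left one. The outer factors \<open>c\<close>, \<open>d\<close> make room
  for the cancelling \<open>jc\<close> and \<open>j\<close> in
  \<open>connection_of_section_of\<close>.\<close>

lemma balR_strong_connection_jc:
  assumes l: "is_strong_connection l" and \<beta>: "balT \<beta>"
  shows "balR (\<lambda>u v. sweedler (l u) (\<lambda>a a'. \<beta> (c * a) (a' * (jc v * d))))"
  by (rule balancedI;
      (intro additive_strong_connection[OF l] balT_mult[OF \<beta>] balanced_additive1[OF \<beta>] balanced_additive2[OF \<beta>]
        additive_intros)?)
    (simp add: strong_connection_sR[OF l balT_mult[OF \<beta>]] jc_tR_right mult.assoc)

lemma balR_j_strong_connection:
  assumes l: "is_strong_connection l" and \<beta>: "balT \<beta>"
  shows "balR (\<lambda>u v. sweedler (l v) (\<lambda>a a'. \<beta> (c * (j u * a)) (a' * d)))"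
proof (rule balancedI)
  have bal: "balT (\<lambda>a a'. \<beta> (c * (g * a)) (a' * d))" for g
    using balT_mult[OF \<beta>, of "c * g" d] by (simp add: mult.assoc)
  show "sweedler (l v) (\<lambda>a a'. \<beta> (c * (j (u * sR r) * a)) (a' * d))
    = sweedler (l (v * tR r)) (\<lambda>a a'. \<beta> (c * (j u * a)) (a' * d))" for u r v
    by (simp add: strong_connection_tR[OF l bal] j_sR_right mult.assoc)
  show "additive (\<lambda>v. sweedler (l v) (\<lambda>a a'. \<beta> (c * (j u * a)) (a' * d)))" for u
    by (intro additive_strong_connection[OF l bal] additive_intros)
qed (intro balanced_additive1[OF \<beta>] additive_intros)

lemma balR_j_strong_connection_jc:
  assumes l: "is_strong_connection l" and \<beta>: "balT \<beta>"
  shows "balR (\<lambda>x y. sweedler (\<gamma>R y) (\<lambda>u v. sweedler (l u) (\<lambda>a a'. \<beta> (j x * a) (a' * jc v))))"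
proof (rule balancedI)
  have bal: "balR (\<lambda>u v. sweedler (l u) (\<lambda>a a'. \<beta> (g * a) (a' * jc v)))" for g
    using balR_strong_connection_jc[OF l \<beta>, of g 1] by simp
  show "sweedler (\<gamma>R y) (\<lambda>u v. sweedler (l u) (\<lambda>a a'. \<beta> (j (x * sR r) * a) (a' * jc v)))
    = sweedler (\<gamma>R (y * tR r)) (\<lambda>u v. sweedler (l u) (\<lambda>a a'. \<beta> (j x * a) (a' * jc v)))" for x r y
    by (simp add: \<gamma>R_tR_right[OF bal] strong_connection_tR[OF l balT_mult[OF \<beta>]] j_sR_right mult.assoc)
  show "additive (\<lambda>y. sweedler (\<gamma>R y) (\<lambda>u v. sweedler (l u) (\<lambda>a a'. \<beta> (j x * a) (a' * jc v))))" for x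
    by (intro bal additive_intros)
qed (intro balanced_additive1[OF \<beta>] additive_intros)

text \<open>Left colinearity converts the coaction hidden in \<open>F\<close> into a first leg of
  \<open>h\<close>, right colinearity the one in \<open>E\<close> into a last leg. The result is the
  convolution form, whereas the definition by \<open>F\<close> and \<open>E\<close> shows membership
  in B \<otimes> B.\<close>

lemma sweedler_section_of_strong_connection:
  assumes l: "is_strong_connection l" and \<beta>: "balT \<beta>"
  shows "sweedler (section_of l h) \<beta> =
    sweedler (\<gamma>R h) (\<lambda>x y. sweedler (\<gamma>R y) (\<lambda>u v. sweedler (l u) (\<lambda>a a'. \<beta> (j x * a) (a' * jc v))))"
proof -
  note add = balanced_additive1[OF \<beta>] balanced_additive2[OF \<beta>]
  have "sweedler (section_of l h) \<beta>
    = sweedler (l h) (\<lambda>a a'. sweedler (\<rho>L a) (\<lambda>x y. \<beta> (j (inv S y) * x) (E a')))"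
    by (simp add: sweedler_section_of[OF \<beta>] F_def sweedler_hom[OF balanced_additive(1)[OF \<beta>]])
  also have "\<dots> = sweedler (\<gamma>R h) (\<lambda>x y. sweedler (l y) (\<lambda>a a'. \<beta> (j x * a) (E a')))"
    by (rule strong_connection_left[OF l], rule balanced3I; (intro add additive_intros)?)
      (simp_all add: j_sR_right E_mult_left T_coinvariant balT_eq[OF \<beta>] flip: mult.assoc)
  also have "\<dots> = sweedler (\<gamma>R h) (\<lambda>x y. sweedler (l y) (\<lambda>a a'. sweedler (\<rho>R a') (\<lambda>p q. \<beta> (j x * a) (p * jc q))))"
    by (simp add: E_def sweedler_hom[OF balanced_additive(2)[OF \<beta>]])
  also have "\<dots> = sweedler (\<gamma>R h) (\<lambda>x y. sweedler (\<gamma>R y) (\<lambda>u v. sweedler (l u) (\<lambda>a a'. \<beta> (j x * a) (a' * jc v))))"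
    by (rule sweedler_cong, rule strong_connection_right[OF l], rule balanced3I; (intro add additive_intros)?)
      (simp_all add: jc_tR_right balT_eq[OF \<beta>] flip: mult.assoc)
  finally show ?thesis .
qed

text \<open>In the convolution form \<open>sL k\<close> stays with the first leg and leaves through
  \<open>j\<close>, while \<open>tL k'\<close> travels to the last leg and leaves through
  \<open>jc\<close>.\<close>

lemma section_of_LL_bilinear:
  assumes l: "is_strong_connection l"
  shows "LL_bilinear sL tL \<eta>L B T (section_of l)"
  unfolding LL_bilinear_def
proof (intro conjI allI)
  show "section_of l h \<in> tensor B T B (*) (*)" for h
    by (rule section_of_in)
  show "section_of l (h + h') = section_of l h + section_of l h'" for h h'
  proof (rule B_tensor_eqI)
    fix \<beta> :: "'a \<Rightarrow> 'a \<Rightarrow> (('a \<times> 'a) \<Rightarrow>\<^sub>0 int) quotients" assume \<beta>: "balT \<beta>"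
    show "sweedler (section_of l (h + h')) \<beta> = sweedler (section_of l h + section_of l h') \<beta>"
      by (simp add: sweedler_plus[OF section_of_in section_of_in balT_on_B[OF \<beta>]] sweedler_section_of[OF \<beta>]
          additive.add[OF additive_strong_connection[OF l balT_FE[OF \<beta>] additive_id]])
  qed (intro section_of_in tensor_add)+
  show "section_of l (sL k * tL k' * h)
    = sweedler (section_of l h) (\<lambda>b b'. frag_of (\<eta>L k * b, b' * \<eta>L k')) +o tensor_null B T B (*) (*)" for k k' h
  proof (rule B_tensor_eqI)
    fix \<beta> :: "'a \<Rightarrow> 'a \<Rightarrow> (('a \<times> 'a) \<Rightarrow>\<^sub>0 int) quotients" assume \<beta>: "balT \<beta>"
    have bal: "balR (\<lambda>u v. sweedler (l u) (\<lambda>a a'. \<beta> (g * a) (a' * jc v)))" for g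
      using balR_strong_connection_jc[OF l \<beta>, of g 1] by simp
    have bal'': "balR (\<lambda>u v. sweedler (l u) (\<lambda>a a'. \<beta> (\<eta>L k * (g * a)) (a' * jc v)))" for g
      using bal[of "\<eta>L k * g"] by (simp add: mult.assoc)
    have bal': "balR (\<lambda>x y. sweedler (\<gamma>R y) (\<lambda>u v. sweedler (l u) (\<lambda>a a'. \<beta> (\<eta>L k * (j x * a)) (a' * jc v))))"
      using balR_left[OF balR_j_strong_connection_jc[OF l \<beta>], of 1 "sL k"] by (simp add: j_sL_left mult.assoc)
    have "sweedler (section_of l (sL k * (tL k' * h))) \<beta>
      = sweedler (section_of l h) (\<lambda>b b'. \<beta> (\<eta>L k * b) (b' * \<eta>L k'))"
      by (simp add: sweedler_section_of_strong_connection[OF l] \<beta> balT_mult[OF \<beta>]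
          \<gamma>R_sL_left[OF balR_j_strong_connection_jc[OF l \<beta>]] \<gamma>R_tL_left[OF bal'] \<gamma>R_tL_left[OF bal'']
          j_sL_left jc_tL_left mult.assoc)
    then show "sweedler (section_of l (sL k * tL k' * h)) \<beta>
      = sweedler (sweedler (section_of l h) (\<lambda>b b'. frag_of (\<eta>L k * b, b' * \<eta>L k')) +o tensor_null B T B (*) (*)) \<beta>"
      by (simp add: sweedler_of_sweedler[OF refl balT_on_B[OF \<beta>]] mult.assoc)
  qed (rule section_of_in, rule coset_in_tensor, rule keys_sweedler_B[OF section_of_in],
      simp add: coinvariant_mult \<eta>L_coinvariant)
qed

text \<open>Multiplying out the connection leaves \<open>\<eta>R (\<pi>R u)\<close>, which
  \<open>jc\<close> absorbs through the counit; then \<open>j\<close> and \<open>jc\<close> convolve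
  to \<open>\<eta>L \<circ> \<pi>L\<close>.\<close>

lemma section_of_mult:
  assumes l: "is_strong_connection l"
  shows "tensor_mult (section_of l h) = \<eta>L (\<pi>L h)"
proof -
  have "balT (*)"
    by (rule balancedI; (intro additive_intros)?) (simp add: mult.assoc)
  then have "tensor_mult (section_of l h)
    = sweedler (\<gamma>R h) (\<lambda>x y. sweedler (\<gamma>R y) (\<lambda>u v. j x * sweedler (l u) (*) * jc v))"
    unfolding tensor_mult_def
    by (simp add: sweedler_section_of_strong_connection[OF l] sweedler_mult_left sweedler_mult_right mult.assoc)
  also have "\<dots> = sweedler (\<gamma>R h) (\<lambda>x y. j x * jc (sweedler (\<gamma>R y) (\<lambda>u v. v * tR (\<pi>R u))))"
    by (simp add: strong_connection_mult[OF l] jc_tR_right sweedler_hom[OF additive_jc] sweedler_mult_left mult.assoc)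
  also have "\<dots> = \<eta>L (\<pi>L h)"
    by (simp add: R.counit_left conv_R)
  finally show ?thesis .
qed

section \<open>Strong connections built from bilinear sections\<close>

lemma LL_section_in: "is_LL_section f \<Longrightarrow> f h \<in> tensor B T B (*) (*)"
  by (simp add: LL_bilinear_def)

lemma additive_LL_section:
  assumes f: "is_LL_section f" and "balT \<beta>" "additive g"
  shows "additive (\<lambda>x. sweedler (f (g x)) \<beta>)"
  using f by unfold_locales
    (simp add: additive.add[OF assms(3)] LL_bilinear_def
      sweedler_plus[OF LL_section_in[OF f] LL_section_in[OF f] balT_on_B[OF assms(2)]])

lemma LL_section_bilinear:
  assumes "is_LL_section f" "balT \<beta>"
  shows "sweedler (f (sL k * tL k' * h)) \<beta> = sweedler (f h) (\<lambda>b b'. \<beta> (\<eta>L k * b) (b' * \<eta>L k'))"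
  using sweedler_of_sweedler[of "f (sL k * tL k' * h)" "f h", OF _ balT_on_B[OF assms(2)]] assms(1)
  by (simp add: LL_bilinear_def)

lemma LL_section_sL: "is_LL_section f \<Longrightarrow> balT \<beta> \<Longrightarrow> sweedler (f (sL k * h)) \<beta> = sweedler (f h) (\<lambda>b b'. \<beta> (\<eta>L k * b) b')"
  and LL_section_tL: "is_LL_section f \<Longrightarrow> balT \<beta> \<Longrightarrow> sweedler (f (tL k' * h)) \<beta> = sweedler (f h) (\<lambda>b b'. \<beta> b (b' * \<eta>L k'))"
  using LL_section_bilinear[of f \<beta> k 1 h] LL_section_bilinear[of f \<beta> 1 k' h] by simp_all

lemma LL_section_mult: "is_LL_section f \<Longrightarrow> sweedler (f h) (*) = \<eta>L (\<pi>L h)"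
  by (simp add: tensor_mult_def)

lemma balL_LL_section_j:
  assumes f: "is_LL_section f" and \<beta>: "balT \<beta>"
  shows "balL (\<lambda>u v. sweedler (f u) (\<lambda>b b'. \<beta> (c * b) (b' * j v)))"
  by (rule balancedI;
      (intro additive_LL_section[OF f] balT_mult[OF \<beta>] balanced_additive1[OF \<beta>] balanced_additive2[OF \<beta>]
        additive_intros)?)
    (simp add: LL_section_tL[OF f balT_mult[OF \<beta>]] j_sL_left mult.assoc)

lemma balL_jc_LL_section_j:
  assumes f: "is_LL_section f" and \<beta>: "balT \<beta>"
  shows "balL (\<lambda>x y. sweedler (\<gamma>L y) (\<lambda>u v. sweedler (f u) (\<lambda>b b'. \<beta> (jc x * b) (b' * j v))))"
proof (rule balancedI)
  note bal = balL_LL_section_j[OF f \<beta>]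
  show "sweedler (\<gamma>L y) (\<lambda>u v. sweedler (f u) (\<lambda>b b'. \<beta> (jc (tL k * x) * b) (b' * j v)))
    = sweedler (\<gamma>L (sL k * y)) (\<lambda>u v. sweedler (f u) (\<lambda>b b'. \<beta> (jc x * b) (b' * j v)))" for x k y
    by (simp add: \<gamma>L_sL_left[OF bal] LL_section_sL[OF f balT_mult[OF \<beta>]] jc_tL_left mult.assoc)
  show "additive (\<lambda>y. sweedler (\<gamma>L y) (\<lambda>u v. sweedler (f u) (\<lambda>b b'. \<beta> (jc x * b) (b' * j v))))" for x
    by (intro bal additive_intros)
qed (intro balanced_additive1[OF \<beta>] additive_intros)

text \<open>As \<open>b\<close> is coinvariant, \<open>\<rho>L\<close> acts only on
  \<open>jc x\<close>. The \<open>S\<close> in \<open>\<rho>L_jc\<close> cancels against the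
  \<open>inv S\<close> of the left coaction, so a first leg of \<open>x\<close> splits off, and
  mixed coassociativity makes it a first leg of \<open>h\<close>.\<close>

lemma connection_of_left_colinear:
  assumes f: "is_LL_section f"
    and \<tau>: "balanced3 UNIV (\<lambda>h r. h * sR r) (\<lambda>r a. \<eta>R r * a) T (*) (*) \<tau>"
  shows "sweedler (connection_of f h) (\<lambda>a a'. sweedler (left_coaction sR S \<eta>R \<rho>L a) (\<lambda>g a0. \<tau> g a0 a'))
    = sweedler (\<gamma>R h) (\<lambda>h1 h2. sweedler (connection_of f h2) (\<lambda>a a'. \<tau> h1 a a'))"
proof -
  note add = balanced3_additive1[OF \<tau>] balanced3_additive2[OF \<tau>] balanced3_additive3[OF \<tau>]
  have balHA: "balHA (\<lambda>g a0. \<tau> g a0 a')" and balT: "balT (\<tau> g)" for a' g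
    using \<tau> by (simp_all add: balanced3_def)
  have \<tau>_tL: "\<tau> (g * tL k) a a' = \<tau> g (\<eta>R (\<pi>R (tL k)) * a) a'" for g k a a'
    using balanced3_eq1[OF \<tau> UNIV_I, of g "\<pi>R (tL k)" a a'] by (simp add: sR_\<pi>R_tL)
  have balAL: "balAL (\<lambda>x y. \<tau> (inv S y) (x * b) a')" for a' b
    by (rule balancedI; (intro add additive_intros)?)
      (simp add: inv_S_sL_left \<tau>_tL mult.assoc)
  have "balT (\<lambda>a a'. sweedler (\<rho>L a) (\<lambda>x y. \<tau> (inv S y) x a'))"
    by (rule balancedI; (intro add balAL[of 1, simplified] additive_intros)?)
      (simp add: \<rho>L_mult_coinvariant_right[OF T_coinvariant balAL[of 1, simplified]] balanced3_eq2[OF \<tau>])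
  then have "sweedler (connection_of f h) (\<lambda>a a'. sweedler (left_coaction sR S \<eta>R \<rho>L a) (\<lambda>g a0. \<tau> g a0 a'))
    = sweedler (\<gamma>L h) (\<lambda>x y. sweedler (\<gamma>L y) (\<lambda>u v. sweedler (f u) (\<lambda>b b'.
        sweedler (\<rho>L (jc x * b)) (\<lambda>p q. \<tau> (inv S q) p (b' * j v)))))"
    by (simp add: sweedler_left_coaction[OF balHA] sweedler_connection_of)
  also have "\<dots> = sweedler (\<gamma>L h) (\<lambda>x y. sweedler (\<gamma>L y) (\<lambda>u v. sweedler (f u) (\<lambda>b b'.
        sweedler (\<gamma>R x) (\<lambda>p q. \<tau> p (jc q * b) (b' * j v)))))"
    by (intro sweedler_cong sweedler_B_cong[OF LL_section_in[OF f]])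
      (simp add: \<rho>L_mult_coinvariant_right[OF _ balAL[of 1, simplified]] \<rho>L_jc[OF balAL])
  also have "\<dots> = sweedler (\<gamma>L h) (\<lambda>x y. sweedler (\<gamma>L y) (\<lambda>u v. sweedler (\<gamma>R x) (\<lambda>p q. sweedler (f u) (\<lambda>b b'.
        \<tau> p (jc q * b) (b' * j v)))))"
    by (intro sweedler_cong sweedler_swap)
  also have "\<dots> = sweedler (\<gamma>L h) (\<lambda>x y. sweedler (\<gamma>R x) (\<lambda>p q. sweedler (\<gamma>L y) (\<lambda>u v. sweedler (f u) (\<lambda>b b'.
        \<tau> p (jc q * b) (b' * j v)))))"
    by (rule sweedler_cong, rule sweedler_swap)
  also have "\<dots> = sweedler (\<gamma>R h) (\<lambda>p z. sweedler (\<gamma>L z) (\<lambda>q y. sweedler (\<gamma>L y) (\<lambda>u v. sweedler (f u) (\<lambda>b b'.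
        \<tau> p (jc q * b) (b' * j v)))))"
    by (rule mixed_RL, rule balanced3I; (intro add balL_LL_section_j[OF f balT] additive_intros)?)
      (simp_all add: balL_eq[OF balL_jc_LL_section_j[OF f balT]] balanced3_eq1[OF \<tau>] jc_tR_right mult.assoc)
  also have "\<dots> = sweedler (\<gamma>R h) (\<lambda>h1 h2. sweedler (connection_of f h2) (\<lambda>a a'. \<tau> h1 a a'))"
    by (simp add: sweedler_connection_of[OF balT])
  finally show ?thesis .
qed

text \<open>Common first step for right colinearity and the canonical map: \<open>b'\<close> is
  coinvariant, so \<open>\<rho>R\<close> acts only on \<open>j v\<close>.\<close>

lemma connection_of_coact:
  assumes f: "is_LL_section f"
    and \<tau>: "balanced3 T (*) (*) UNIV (\<lambda>a r. a * \<eta>R r) (\<lambda>r h. h * tR r) \<tau>"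
  shows "sweedler (connection_of f h) (\<lambda>a a'. sweedler (\<rho>R a') (\<lambda>x y. \<tau> a x y))
    = sweedler (\<gamma>L h) (\<lambda>x y. sweedler (\<gamma>L y) (\<lambda>u v. sweedler (\<gamma>R v) (\<lambda>p q. sweedler (f u) (\<lambda>b b'.
        \<tau> (jc x * b) (b' * j p) q))))"
proof -
  note add = balanced3_additive1[OF \<tau>] balanced3_additive2[OF \<tau>] balanced3_additive3[OF \<tau>]
  have balAR: "balAR (\<lambda>x y. \<tau> a (b * x) y)" for a b
    by (rule balancedI; (intro add additive_intros)?)
      (use balanced3_eq2[OF \<tau>] in \<open>simp flip: mult.assoc\<close>)
  have balAR': "balAR (\<tau> a)" for a
    using balAR[of a 1] by simp
  have "balT (\<lambda>a a'. sweedler (\<rho>R a') (\<lambda>x y. \<tau> a x y))"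
    by (rule balancedI; (intro add balAR' additive_intros)?)
      (simp add: \<rho>R_mult_coinvariant_left[OF T_coinvariant balAR'] balanced3_eq1[OF \<tau>])
  then have "sweedler (connection_of f h) (\<lambda>a a'. sweedler (\<rho>R a') (\<lambda>x y. \<tau> a x y))
    = sweedler (\<gamma>L h) (\<lambda>x y. sweedler (\<gamma>L y) (\<lambda>u v. sweedler (f u) (\<lambda>b b'.
        sweedler (\<rho>R (b' * j v)) (\<lambda>p q. \<tau> (jc x * b) p q))))"
    by (simp add: sweedler_connection_of)
  also have "\<dots> = sweedler (\<gamma>L h) (\<lambda>x y. sweedler (\<gamma>L y) (\<lambda>u v. sweedler (f u) (\<lambda>b b'.
        sweedler (\<gamma>R v) (\<lambda>p q. \<tau> (jc x * b) (b' * j p) q))))"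
    by (intro sweedler_cong sweedler_B_cong[OF LL_section_in[OF f]])
      (simp add: \<rho>R_mult_coinvariant_left[OF _ balAR'] \<rho>R_j[OF balAR])
  also have "\<dots> = sweedler (\<gamma>L h) (\<lambda>x y. sweedler (\<gamma>L y) (\<lambda>u v. sweedler (\<gamma>R v) (\<lambda>p q. sweedler (f u) (\<lambda>b b'.
        \<tau> (jc x * b) (b' * j p) q))))"
    by (intro sweedler_cong sweedler_swap)
  finally show ?thesis .
qed

text \<open>Starting from the right-hand side, mixed coassociativity is used twice to move the outer
  \<open>\<gamma>R\<close> past both occurrences of \<open>\<gamma>L\<close> onto the last
  leg.\<close>

lemma connection_of_right_colinear:
  assumes f: "is_LL_section f"
    and \<tau>: "balanced3 T (*) (*) UNIV (\<lambda>a r. a * \<eta>R r) (\<lambda>r h. h * tR r) \<tau>"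
  shows "sweedler (connection_of f h) (\<lambda>a a'. sweedler (\<rho>R a') (\<lambda>x y. \<tau> a x y))
    = sweedler (\<gamma>R h) (\<lambda>h1 h2. sweedler (connection_of f h1) (\<lambda>a a'. \<tau> a a' h2))"
proof -
  note add = balanced3_additive1[OF \<tau>] balanced3_additive2[OF \<tau>] balanced3_additive3[OF \<tau>]
  have balT: "balT (\<lambda>a a'. \<tau> a a' g)" for g
    using \<tau> by (simp add: balanced3_def)
  note balL = balL_LL_section_j[OF f balT] and balL' = balL_jc_LL_section_j[OF f balT]
  note \<tau>_eq = balanced3_eq2[OF \<tau> UNIV_I]
  have "sweedler (\<gamma>R h) (\<lambda>h1 h2. sweedler (connection_of f h1) (\<lambda>a a'. \<tau> a a' h2))
    = sweedler (\<gamma>R h) (\<lambda>z q. sweedler (\<gamma>L z) (\<lambda>x y. sweedler (\<gamma>L y) (\<lambda>u p. sweedler (f u) (\<lambda>b b'.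
        \<tau> (jc x * b) (b' * j p) q))))"
    by (simp add: sweedler_connection_of[OF balT])
  also have "\<dots> = sweedler (\<gamma>L h) (\<lambda>x y. sweedler (\<gamma>R y) (\<lambda>z q. sweedler (\<gamma>L z) (\<lambda>u p. sweedler (f u) (\<lambda>b b'.
        \<tau> (jc x * b) (b' * j p) q))))"
  proof (rule mixed_LR, rule balanced3I; (intro add balL additive_intros)?)
    show "sweedler (\<gamma>L (z * sR r)) (\<lambda>u p. sweedler (f u) (\<lambda>b b'. \<tau> (jc x * b) (b' * j p) q))
      = sweedler (\<gamma>L z) (\<lambda>u p. sweedler (f u) (\<lambda>b b'. \<tau> (jc x * b) (b' * j p) (q * tR r)))" for x z r q
      by (simp add: \<gamma>L_sR_right[OF balL] j_sR_right \<tau>_eq flip: mult.assoc)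
  qed (simp add: balL_eq[OF balL'])
  also have "\<dots> = sweedler (\<gamma>L h) (\<lambda>x y. sweedler (\<gamma>L y) (\<lambda>u v. sweedler (\<gamma>R v) (\<lambda>p q. sweedler (f u) (\<lambda>b b'.
        \<tau> (jc x * b) (b' * j p) q))))"
  proof (rule sweedler_cong, rule mixed_LR, rule balanced3I;
      (intro add additive_LL_section[OF f] balT_mult[OF balT] additive_intros)?)
    show "sweedler (f u) (\<lambda>b b'. \<tau> (jc x * b) (b' * j (p * sR r)) q)
      = sweedler (f u) (\<lambda>b b'. \<tau> (jc x * b) (b' * j p) (q * tR r))" for x u p r q
      by (simp add: j_sR_right \<tau>_eq flip: mult.assoc)
  qed (simp add: balL_eq[OF balL])
  finally show ?thesis
    by (simp add: connection_of_coact[OF f \<tau>])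
qed

text \<open>The product \<open>b * b'\<close> becomes \<open>\<eta>L (\<pi>L u)\<close>, which
  \<open>j\<close> takes in as \<open>sL (\<pi>L u)\<close> and the counit removes. The remaining
  \<open>jc\<close> and \<open>j\<close> cancel by \<open>conv_cancel\<close>.\<close>

lemma connection_of_can:
  assumes f: "is_LL_section f" and \<beta>: "balAR \<beta>"
  shows "sweedler (connection_of f h) (\<lambda>a a'. sweedler (\<rho>R a') (\<lambda>x y. \<beta> (a * x) y)) = \<beta> 1 h"
proof -
  note add = balanced_additive1[OF \<beta>] balanced_additive2[OF \<beta>]
  have \<tau>: "balanced3 T (*) (*) UNIV (\<lambda>a r. a * \<eta>R r) (\<lambda>r h. h * tR r) (\<lambda>a x y. \<beta> (a * x) y)"
    by (rule balanced3I; (intro add additive_intros)?) (simp_all add: balAR_eq[OF \<beta>] flip: mult.assoc)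
  have bal: "balR (\<lambda>p q. \<beta> (c * j p) q)" for c
    by (rule balancedI; (intro add additive_intros)?)
      (simp add: j_sR_right balAR_eq[OF \<beta>] flip: mult.assoc)
  have bal': "balR (\<lambda>p q. \<beta> (c * (\<eta>L k * j p)) q)" for c k
    using bal[of "c * \<eta>L k"] by (simp add: mult.assoc)
  have mult: "sweedler (f u) (\<lambda>b b'. \<beta> (c * b * (b' * d)) q) = \<beta> (c * (\<eta>L (\<pi>L u) * d)) q" for u c d q
  proof -
    have "additive (\<lambda>a. \<beta> (c * (a * d)) q)" by (intro add additive_intros)
    from sweedler_hom[OF this, of "f u" "(*)"] show ?thesis
      by (simp add: LL_section_mult[OF f] mult.assoc)
  qed
  have "sweedler (connection_of f h) (\<lambda>a a'. sweedler (\<rho>R a') (\<lambda>x y. \<beta> (a * x) y))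
    = sweedler (\<gamma>L h) (\<lambda>x y. sweedler (\<gamma>L y) (\<lambda>u v. sweedler (\<gamma>R v) (\<lambda>p q. \<beta> (jc x * j (sL (\<pi>L u) * p)) q)))"
    by (simp add: connection_of_coact[OF f \<tau>] mult j_sL_left)
  also have "\<dots> = sweedler (\<gamma>L h) (\<lambda>x y. sweedler (\<gamma>R (sweedler (\<gamma>L y) (\<lambda>u v. sL (\<pi>L u) * v))) (\<lambda>p q. \<beta> (jc x * j p) q))"
    by (simp add: sweedler_hom[OF additive_\<gamma>R[OF bal additive_id]] \<gamma>R_sL_left[OF bal])
  also have "\<dots> = sweedler (\<gamma>L h) (\<lambda>x y. sweedler (\<gamma>R y) (\<lambda>p q. \<beta> (jc x * j p) q))"
    by (simp add: L.counit_left)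
  also have "\<dots> = \<beta> 1 h"
    by (rule conv_cancel; (intro add additive_intros)?) (simp add: balAR_eq[OF \<beta>])
  finally show ?thesis .
qed

lemma strong_connection_of:
  assumes f: "is_LL_section f"
  shows "is_strong_connection (connection_of f)"
  unfolding strong_connection_def
proof (intro conjI allI)
  show "connection_of f h \<in> tensor UNIV T UNIV (*) (*)" for h
    by (rule connection_of_in)
  show "connection_of f (h + h') = connection_of f h + connection_of f h'" for h h'
  proof (rule A_tensor_eqI)
    fix \<beta> :: "'a \<Rightarrow> 'a \<Rightarrow> (('a \<times> 'a) \<Rightarrow>\<^sub>0 int) quotients" assume \<beta>: "balT \<beta>"
    show "sweedler (connection_of f (h + h')) \<beta> = sweedler (connection_of f h + connection_of f h') \<beta>"
      by (simp add: sweedler_plus[OF connection_of_in connection_of_in \<beta>] sweedler_connection_of[OF \<beta>]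
          additive.add[OF additive_\<gamma>L[OF balL_jc_LL_section_j[OF f \<beta>] additive_id]])
  qed (intro connection_of_in tensor_add)+
  show "connection_of f (h * tR r)
    = sweedler (connection_of f h) (\<lambda>a a'. frag_of (\<eta>R r * a, a')) +o tensor_null UNIV T UNIV (*) (*)" for r h
  proof (rule A_tensor_eqI)
    fix \<beta> :: "'a \<Rightarrow> 'a \<Rightarrow> (('a \<times> 'a) \<Rightarrow>\<^sub>0 int) quotients" assume \<beta>: "balT \<beta>"
    have \<beta>': "balT (\<lambda>a a'. \<beta> (\<eta>R r * a) a')"
      using balT_mult[OF \<beta>, of "\<eta>R r" 1] by simp
    show "sweedler (connection_of f (h * tR r)) \<beta>
      = sweedler (sweedler (connection_of f h) (\<lambda>a a'. frag_of (\<eta>R r * a, a')) +o tensor_null UNIV T UNIV (*) (*)) \<beta>"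
      by (simp add: sweedler_of_sweedler[OF refl \<beta>] sweedler_connection_of[OF \<beta>] sweedler_connection_of[OF \<beta>']
          \<gamma>L_tR_right[OF balL_jc_LL_section_j[OF f \<beta>]] jc_tR_right mult.assoc)
  qed (rule connection_of_in, rule coset_in_tensor, simp)
  show "connection_of f (h * sR r)
    = sweedler (connection_of f h) (\<lambda>a a'. frag_of (a, a' * \<eta>R r)) +o tensor_null UNIV T UNIV (*) (*)" for r h
  proof (rule A_tensor_eqI)
    fix \<beta> :: "'a \<Rightarrow> 'a \<Rightarrow> (('a \<times> 'a) \<Rightarrow>\<^sub>0 int) quotients" assume \<beta>: "balT \<beta>"
    have \<beta>': "balT (\<lambda>a a'. \<beta> a (a' * \<eta>R r))"
      using balT_mult[OF \<beta>, of 1 "\<eta>R r"] by simp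
    show "sweedler (connection_of f (h * sR r)) \<beta>
      = sweedler (sweedler (connection_of f h) (\<lambda>a a'. frag_of (a, a' * \<eta>R r)) +o tensor_null UNIV T UNIV (*) (*)) \<beta>"
      by (simp add: sweedler_of_sweedler[OF refl \<beta>] sweedler_connection_of[OF \<beta>] sweedler_connection_of[OF \<beta>']
          \<gamma>L_sR_right[OF balL_jc_LL_section_j[OF f \<beta>]] \<gamma>L_sR_right[OF balL_LL_section_j[OF f \<beta>]] j_sR_right mult.assoc)
  qed (rule connection_of_in, rule coset_in_tensor, simp)
  show "sweedler (connection_of f h) (\<lambda>a a'. sweedler (left_coaction sR S \<eta>R \<rho>L a) (\<lambda>g a0. frag_of (g, a0, a')))
      +o tensor3_null UNIV (\<lambda>h r. h * sR r) (\<lambda>r a. \<eta>R r * a) T (*) (*)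
    = sweedler (\<gamma>R h) (\<lambda>h1 h2. sweedler (connection_of f h2) (\<lambda>a a'. frag_of (h1, a, a')))
      +o tensor3_null UNIV (\<lambda>h r. h * sR r) (\<lambda>r a. \<eta>R r * a) T (*) (*)" for h
    by (rule coset3_eqI) (simp add: sweedler_hom[OF additive_frag_sum] connection_of_left_colinear[OF f])
  show "sweedler (connection_of f h) (\<lambda>a a'. sweedler (\<rho>R a') (\<lambda>a0 a1. frag_of (a, a0, a1)))
      +o tensor3_null T (*) (*) UNIV (\<lambda>a r. a * \<eta>R r) (\<lambda>r h. h * tR r)
    = sweedler (\<gamma>R h) (\<lambda>h1 h2. sweedler (connection_of f h1) (\<lambda>a a'. frag_of (a, a', h2)))
      +o tensor3_null T (*) (*) UNIV (\<lambda>a r. a * \<eta>R r) (\<lambda>r h. h * tR r)" for h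
    by (rule coset3_eqI) (simp add: sweedler_hom[OF additive_frag_sum] connection_of_right_colinear[OF f])
  show "lifted_can tR \<eta>R \<rho>R (connection_of f h)
    = frag_of (1, h) +o tensor_null UNIV UNIV UNIV (\<lambda>a r. a * \<eta>R r) (\<lambda>r h. h * tR r)" for h
  proof (rule tensor_eq_cosetI)
    show "lifted_can tR \<eta>R \<rho>R (connection_of f h) \<in> tensor UNIV UNIV UNIV (\<lambda>a r. a * \<eta>R r) (\<lambda>r h. h * tR r)"
      unfolding lifted_can_def by (intro coset_in_tensor) simp
  qed (simp_all add: sweedler_lifted_can connection_of_can[OF f])
qed

section \<open>The two constructions are mutually inverse\<close>

lemma section_of_connection_of:
  assumes f: "is_LL_section f"
  shows "section_of (connection_of f) = f"
proof
  fix h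
  show "section_of (connection_of f) h = f h"
  proof (rule B_tensor_eqI[OF section_of_in LL_section_in[OF f]])
    fix \<beta> :: "'a \<Rightarrow> 'a \<Rightarrow> (('a \<times> 'a) \<Rightarrow>\<^sub>0 int) quotients" assume \<beta>: "balT \<beta>"
    note add = additive_LL_section[OF f \<beta>]
    have "sweedler (section_of (connection_of f) h) \<beta>
      = sweedler (\<gamma>L h) (\<lambda>x y. sweedler (\<gamma>L y) (\<lambda>u v. sweedler (f u) (\<lambda>b b'. \<beta> (F (jc x * b)) (E (b' * j v)))))"
      by (simp add: sweedler_section_of[OF \<beta>] sweedler_connection_of[OF balT_FE[OF \<beta>]])
    \<comment> \<open>\<open>F\<close> and \<open>E\<close> turn \<open>jc x\<close> and
      \<open>j v\<close> into \<open>\<eta>L\<close> of counits. Bilinearity of \<open>f\<close>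
      then carries these back into its argument, where the counit axioms restore
      \<open>h\<close>.\<close>
    also have "\<dots> = sweedler (\<gamma>L h) (\<lambda>x y. sweedler (\<gamma>L y) (\<lambda>u v.
        sweedler (f u) (\<lambda>b b'. \<beta> (\<eta>L (\<pi>L x) * b) (b' * \<eta>L (\<pi>L v)))))"
      by (intro sweedler_cong sweedler_B_cong[OF LL_section_in[OF f]])
        (simp add: F_mult_right E_mult_left F_jc E_j)
    also have "\<dots> = sweedler (\<gamma>L h) (\<lambda>x y. sweedler (\<gamma>L y) (\<lambda>u v. sweedler (f (sL (\<pi>L x) * (tL (\<pi>L v) * u))) \<beta>))"
      by (simp add: LL_section_bilinear[OF f \<beta>, symmetric] mult.assoc)
    also have "\<dots> = sweedler (f h) \<beta>"
      by (simp add: sweedler_hom[OF add[OF additive_times], symmetric]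
          sweedler_hom[OF add[OF additive_id], symmetric] L.counit_left L.counit_right)
    finally show "sweedler (section_of (connection_of f) h) \<beta> = sweedler (f h) \<beta>" .
  qed
qed

text \<open>The composite expands to \<open>jc x * j p\<close>, then \<open>l q\<close>, then
  \<open>jc w * j v\<close>. The right pair is cancelled first, by \<open>conv_cancel'\<close>, and
  the left pair by \<open>conv_cancel\<close>.\<close>

lemma connection_of_section_of:
  assumes l: "is_strong_connection l"
  shows "connection_of (section_of l) = l"
proof
  fix h
  show "connection_of (section_of l) h = l h"
  proof (rule A_tensor_eqI[OF connection_of_in strong_connection_in[OF l]])
    fix \<beta> :: "'a \<Rightarrow> 'a \<Rightarrow> (('a \<times> 'a) \<Rightarrow>\<^sub>0 int) quotients" assume \<beta>: "balT \<beta>"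
    note add = balanced_additive1[OF \<beta>] balanced_additive2[OF \<beta>] additive_strong_connection[OF l]
    let ?M = "\<lambda>c p q a. sweedler (l q) (\<lambda>a0 a1. \<beta> (c * (j p * a0)) (a1 * a))"
    note balR = balR_j_strong_connection[OF l \<beta>]
    have cancel: "sweedler (\<gamma>L y) (\<lambda>u v. sweedler (\<gamma>R u) (\<lambda>p z. sweedler (\<gamma>R z) (\<lambda>q w. ?M c p q (jc w * j v))))
      = sweedler (\<gamma>R y) (\<lambda>p q. ?M c p q 1)" for c y
    proof -
      \<comment> \<open>Regrouping makes \<open>w\<close> the second leg of the outer
        \<open>\<gamma>R u\<close>, as \<open>conv_cancel'\<close> requires, with \<open>p\<close>
        and \<open>q\<close> collected in the spectator leg \<open>z\<close>.\<close>
      have "sweedler (\<gamma>R u) (\<lambda>p z. sweedler (\<gamma>R z) (\<lambda>q w. ?M c p q (jc w * j v)))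
        = sweedler (\<gamma>R u) (\<lambda>z w. sweedler (\<gamma>R z) (\<lambda>p q. ?M c p q (jc w * j v)))" for u v
      proof (rule R.coassoc'[symmetric], rule balanced3I)
        show "?M c p (q * sR r) (jc w * j v) = ?M c p q (jc (w * tR r) * j v)" for p q r w
          using balR_eq[OF balR_strong_connection_jc[OF l \<beta>, of "c * j p" "j v"], of q r w] by (simp add: mult.assoc)
        show "additive (\<lambda>q. ?M c p q (jc w * j v))" for p w
          using balanced_additive(2)[OF balR[of c "jc w * j v"], of p] by simp
      qed ((intro add additive_intros) | simp add: balR_eq[OF balR])+
      then have "sweedler (\<gamma>L y) (\<lambda>u v. sweedler (\<gamma>R u) (\<lambda>p z. sweedler (\<gamma>R z) (\<lambda>q w. ?M c p q (jc w * j v))))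
        = sweedler (\<gamma>L y) (\<lambda>u v. sweedler (\<gamma>R u) (\<lambda>z w. sweedler (\<gamma>R z) (\<lambda>p q. ?M c p q (jc w * j v))))"
        by simp
      also have "\<dots> = sweedler (\<gamma>R y) (\<lambda>p q. ?M c p q 1)"
      proof (rule conv_cancel'; (intro balR balanced_additive1[OF \<beta>] balanced_additive2[OF \<beta>] additive_intros)?)
        show "sweedler (\<gamma>R (h * sR r)) (\<lambda>p q. ?M c p q a) = sweedler (\<gamma>R h) (\<lambda>p q. ?M c p q (\<eta>R r * a))" for a h r
        proof -
          have "?M c p (q * sR r) a = ?M c p q (\<eta>R r * a)" for p q
            using strong_connection_sR[OF l balT_mult[OF \<beta>], of q r "c * j p" a] by (simp add: mult.assoc)
          then show ?thesis by (simp add: \<gamma>R_sR_right[OF balR])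
        qed
      qed
      finally show ?thesis .
    qed
    have "sweedler (connection_of (section_of l) h) \<beta>
      = sweedler (\<gamma>L h) (\<lambda>x y. sweedler (\<gamma>L y) (\<lambda>u v. sweedler (\<gamma>R u) (\<lambda>p z. sweedler (\<gamma>R z) (\<lambda>q w.
          ?M (jc x) p q (jc w * j v)))))"
      by (simp add: sweedler_connection_of[OF \<beta>] sweedler_section_of_strong_connection[OF l balT_mult[OF \<beta>]] mult.assoc)
    also have "\<dots> = sweedler (\<gamma>L h) (\<lambda>x y. sweedler (\<gamma>R y) (\<lambda>p q. ?M (jc x) p q 1))"
      by (simp only: cancel)
    also have "\<dots> = sweedler (\<gamma>L h) (\<lambda>x y. sweedler (\<gamma>R y) (\<lambda>p q. sweedler (l q) (\<lambda>a0 a1. \<beta> (jc x * j p * a0) a1)))"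
      by (simp add: mult.assoc)
    also have "\<dots> = sweedler (l h) (\<lambda>a0 a1. \<beta> (1 * a0) a1)"
    proof (rule conv_cancel)
      have bal: "balT (\<lambda>a0 a1. \<beta> (a * a0) a1)" for a
        using balT_mult[OF \<beta>, of a 1] by simp
      show "additive (\<lambda>h. sweedler (l h) (\<lambda>a0 a1. \<beta> (a * a0) a1))" for a
        by (intro add bal additive_intros)
      show "sweedler (l (h * tR r)) (\<lambda>a0 a1. \<beta> (a * a0) a1) = sweedler (l h) (\<lambda>a0 a1. \<beta> (a * \<eta>R r * a0) a1)" for a h r
        by (simp add: strong_connection_tR[OF l bal] mult.assoc)
    qed (intro add additive_intros)
    finally show "sweedler (connection_of (section_of l) h) \<beta> = sweedler (l h) \<beta>"
      by simp
  qed
qed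

lemma bij_betw_section_of: "bij_betw section_of {l. is_strong_connection l} {f. is_LL_section f}"
  by (rule bij_betw_byWitness[where f' = connection_of])
    (auto simp: connection_of_section_of section_of_connection_of section_of_LL_bilinear section_of_mult strong_connection_of)

end

theorem theorem5p5:
  fixes kH :: "'k::{comm_ring,comm_monoid_mult} \<Rightarrow> 'h::{ring,monoid_mult} \<Rightarrow> 'h"
    and kL :: "'k \<Rightarrow> 'l::{ring,monoid_mult} \<Rightarrow> 'l"
    and sL tL :: "'l \<Rightarrow> 'h"
    and \<gamma>L :: "'h \<Rightarrow> ('h, 'h) tensor" and \<pi>L :: "'h \<Rightarrow> 'l"
    and kR :: "'k \<Rightarrow> 'r::{ring,monoid_mult} \<Rightarrow> 'r"
    and sR tR :: "'r \<Rightarrow> 'h"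
    and \<gamma>R :: "'h \<Rightarrow> ('h, 'h) tensor" and \<pi>R :: "'h \<Rightarrow> 'r"
    and S :: "'h \<Rightarrow> 'h"
    and kA :: "'k \<Rightarrow> 'a::{ring,monoid_mult} \<Rightarrow> 'a"
    and \<eta>R :: "'r \<Rightarrow> 'a" and \<eta>L :: "'l \<Rightarrow> 'a"
    and \<rho>R \<rho>L :: "'a \<Rightarrow> ('a, 'h) tensor"
    and B T :: "'a set"
  assumes "hopf_algebroid kH kL sL tL \<gamma>L \<pi>L kR sR tR \<gamma>R \<pi>R S"
    and "bij S"
    and "cleft_extension kH kL sL tL \<gamma>L \<pi>L kR sR tR \<gamma>R \<pi>R S kA \<eta>R \<rho>R \<rho>L B \<eta>L"
    and "subalgebra kA T" and "T \<subseteq> B"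
  shows "\<exists>\<Phi>. bij_betw \<Phi>
           {l. strong_connection sR tR \<gamma>R S \<eta>R \<rho>R \<rho>L T l}
           {f. LL_bilinear sL tL \<eta>L B T f \<and> (\<forall>h. tensor_mult (f h) = \<eta>L (\<pi>L h))}"
proof -
  interpret cleft_extension kH kL sL tL \<gamma>L \<pi>L kR sR tR \<gamma>R \<pi>R S kA \<eta>R \<rho>R \<rho>L B \<eta>L
    by fact
  have B: "B = Collect coinvariant"
    using B_coinvariants by (auto simp: coinvariant_def)
  obtain j where "cleaving_map \<eta>L j"
    using cleaving_map_exists by blast
  then obtain jc where j: "\<And>l h. j (sL l * h) = \<eta>L l * j h"
    "right_comodule_map (\<lambda>r h. h * tR r) (\<lambda>h r. h * sR r) \<gamma>R (\<lambda>a r. a * \<eta>R r) \<rho>R j"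
    "right_comodule_map (\<lambda>l h. sL l * h) (\<lambda>h l. tL l * h) \<gamma>L (\<lambda>a l. \<eta>R (\<pi>R (tL l)) * a) \<rho>L j"
    "k_linear kH kA jc" "\<And>l h r. jc (tL l * h * tR r) = \<eta>R r * jc h * \<eta>L l"
    "\<And>h. sweedler (\<gamma>R h) (\<lambda>h1 h2. j h1 * jc h2) = \<eta>L (\<pi>L h)"
    "\<And>h. sweedler (\<gamma>L h) (\<lambda>h1 h2. jc h1 * j h2) = \<eta>R (\<pi>R h)"
    unfolding cleaving_map_def by blast
  interpret C: cleft_pair_over kH kL sL tL \<gamma>L \<pi>L kR sR tR \<gamma>R \<pi>R S kA \<eta>R \<rho>R \<rho>L \<eta>L j jc T
    by unfold_locales (use j \<eta>L_map \<eta>L_in_B B assms(2,5) in auto)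
  show ?thesis
    using C.bij_betw_section_of unfolding B by blast
qed

end
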